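(* Let $S$ be a nontrivial semigroup of order at most five such that the pseudovariety $\llbracket S\rrbracket$ is join irreducible. Then $\llbracket S\rrbracket$ coincides with one of the following $30$ pseudovarieties: $\llbracket\mathbb{Z}_2\rrbracket$, $\llbracket\mathbb{Z}_3\rrbracket$, $\llbracket\mathbb{Z}_4\rrbracket$, $\llbracket\mathbb{Z}_5\rrbracket$, $\llbracket\mathbb{Z}_2^{\mathsf{bar}}\rrbracket$, $\llbracket(\mathbb{Z}_2^{\mathsf{bar}})^{\mathsf{op}}\rrbracket$, $\llbracket N_2\rrbracket$, $\llbracket N_3\rrbracket$, $\llbracket N_4\rrbracket$, $\llbracket N_5\rrbracket$, $\llbracket N_1^I\rrbracket$, $\llbracket N_2^I\rrbracket$, $\llbracket N_3^I\rrbracket$, $\llbracket N_4^I\rrbracket$, $\llbracket N_2^{\mathsf{bar}}\rrbracket$, $\llbracket (N_2^{\mathsf{bar}})^{\mathsf{op}}\rrbracket$, $\llbracket (N_2^{\mathsf{bar}})^I\rrbracket$, $\llbracket ((N_2^{\mathsf{bar}})^{\mathsf{op}})^I\rrbracket$, $\llbracket L_2\rrbracket$, $\llbracket R_2\rrbracket$, $\llbracket L_2^I\rrbracket$, $\llbracket R_2^I\rrbracket$, $\llbracket L_2^{\mathsf{bar}}\rrbracket$, $\llbracket (L_2^{\mathsf{bar}})^{\mathsf{op}}\rrbracket$, $\llbracket A_0\rrbracket$, $\llbracket A_0^I\rrbracket$, $\llbracket A_2\rrbracket$, $\llbracket B_2\rrbracket$, $\llbracket \ell_3^{\mathsf{bar}}\rrbracket$,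 $\llbracket (\ell_3^{\mathsf{bar}})^{\mathsf{op}}\rrbracket$.
   Context: All semigroups are finite. A pseudovariety is a class of finite semigroups closed under finite direct products, subsemigroups and homomorphic images; $\llbracket S\rrbracket$ denotes the pseudovariety generated by $S$. Pseudovarieties form a complete lattice; a pseudovariety $\mathbf{V}$ is join irreducible if for every set $\mathscr{X}$ of pseudovarieties, $\mathbf{V}\subseteq\bigvee\mathscr{X}$ implies $\mathbf{V}\subseteq\mathbf{X}$ for some $\mathbf{X}\in\mathscr{X}$. $S^{\mathsf{op}}$ is $S$ with reversed multiplication; $S^I$ is $S$ with an external identity $I$ adjoined. Semigroups: $\mathbb{Z}_n$ is the cyclic group of order $n$; $N_n=\langle a\mid a^n=0\rangle=\{0,a,\dots,a^{n-1}\}$; $L_2=\{e,f\}$ left zero semigroup ($xy=x$); $R_2=\{e,f\}$ right zero semigroup ($xy=y$); $A_0=\langle e,f\mid e^2=e,f^2=f,ef=0\rangle=\{0,e,f,fe\}$; $A_2=\langle a,e\mid a^2=0,aea=a,e^2=eae=e\rangle=\{0,a,e,ae,ea\}$; $B_2=\langle a,b\mid a^2=b^2=0,aba=a,bab=b\rangle=\{0,a,b,ab,ba\}$. The following are given as sets of transformations: $\mathbb{Z}_2^{\mathsf{bar}}=\{1,g,\bar1,\bar g\}$ where $1,g$ multiply as in $\mathbb{Z}_2$, $\bar u\,s=\overline{us}$ for $s\in\{1,g\}$, and $s\,\bar u=\bar u$ for every element $s$. $N_2^{\mathsf{bar}}=\{\bar0,a,\bar a,\bar I\}$ with $xy=y$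 whenever $y\in\{\bar a,\bar I\}$, $x\bar0=\bar0$ for all $x$, $xa=\bar0$ for $x\in\{\bar0,a,\bar a\}$, and $\bar I a=\bar a$. $L_2^{\mathsf{bar}}=\{e,f,\bar e,\bar f,\bar I\}$ with $xy=y$ for $y\in\{\bar e,\bar f,\bar I\}$, $ee=ef=e$, $fe=ff=f$, $\bar e e=\bar e f=\bar e$, $\bar fe=\bar ff=\bar f$, $\bar I e=\bar e$, $\bar I f=\bar f$. $\ell_3^{\mathsf{bar}}=\{\bar0,a,e,\bar a,\bar e\}$ with $xy=y$ for $y\in\{\bar a,\bar e\}$; for $y\in\{\bar0,a,e\}$: $\bar0 y=ay=\bar a y=\bar0$; $e\bar0=\bar0$, $ea=a$, $ee=e$; $\bar e\bar0=\bar0$, $\bar e a=\bar a$, $\bar e e=\bar e$. *)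

theory Defs
  imports Main
begin

type_synonym 'a sg = "'a set \<times> ('a \<Rightarrow> 'a \<Rightarrow> 'a)"

definition sg_car :: "'a sg \<Rightarrow> 'a set" where "sg_car S = fst S"
definition sg_mult :: "'a sg \<Rightarrow> 'a \<Rightarrow> 'a \<Rightarrow> 'a" where "sg_mult S = snd S"

definition is_fsemigroup :: "'a sg \<Rightarrow> bool" where
  "is_fsemigroup S \<longleftrightarrow> finite (sg_car S) \<and> sg_car S \<noteq> {} \<and>
     (\<forall>x\<in>sg_car S. \<forall>y\<in>sg_car S. sg_mult S x y \<in> sg_car S) \<and>
     (\<forall>x\<in>sg_car S. \<forall>y\<in>sg_car S. \<forall>z\<in>sg_car S.
        sg_mult S (sg_mult S x y) z = sg_mult S x (sg_mult S y z))"

definition sg_hom :: "('a \<Rightarrow> 'b) \<Rightarrow> 'a sg \<Rightarrow> 'b sg \<Rightarrow> bool" where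
  "sg_hom h S T \<longleftrightarrow> (\<forall>x\<in>sg_car S. h x \<in> sg_car T) \<and>
     (\<forall>x\<in>sg_car S. \<forall>y\<in>sg_car S. h (sg_mult S x y) = sg_mult T (h x) (h y))"

definition sg_iso :: "'a sg \<Rightarrow> 'b sg \<Rightarrow> bool" where
  "sg_iso S T \<longleftrightarrow> (\<exists>h. sg_hom h S T \<and> bij_betw h (sg_car S) (sg_car T))"

definition sg_prod :: "'a sg \<Rightarrow> 'b sg \<Rightarrow> ('a \<times> 'b) sg" where
  "sg_prod S T = (sg_car S \<times> sg_car T,
     \<lambda>p q. (sg_mult S (fst p) (fst q), sg_mult T (snd p) (snd q)))"

(* Every finite semigroup is isomorphic to one whose carrier is a set of naturals;
   a class of finite semigroups (closed under isomorphism) is thus represented by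
   its members with carrier contained in nat. *)
definition pseudovariety :: "nat sg set \<Rightarrow> bool" where
  "pseudovariety V \<longleftrightarrow>
     (\<forall>S\<in>V. is_fsemigroup S) \<and>
     (\<forall>S\<in>V. \<forall>T\<in>V. \<forall>U. is_fsemigroup U \<and> sg_iso U (sg_prod S T) \<longrightarrow> U \<in> V) \<and>
     (\<forall>S\<in>V. \<forall>D. D \<subseteq> sg_car S \<and> D \<noteq> {} \<and>
          (\<forall>x\<in>D. \<forall>y\<in>D. sg_mult S x y \<in> D) \<longrightarrow> (D, sg_mult S) \<in> V) \<and>
     (\<forall>S\<in>V. \<forall>U h. is_fsemigroup U \<and> sg_hom h S U \<and> h ` sg_car S = sg_car U \<longrightarrow> U \<in> V)"

definition gen_pv :: "'a sg \<Rightarrow> nat sg set" where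
  "gen_pv S = \<Inter>{V. pseudovariety V \<and> (\<forall>U. is_fsemigroup U \<and> sg_iso U S \<longrightarrow> U \<in> V)}"

definition pv_join :: "nat sg set set \<Rightarrow> nat sg set" where
  "pv_join X = \<Inter>{V. pseudovariety V \<and> \<Union>X \<subseteq> V}"

definition join_irreducible :: "nat sg set \<Rightarrow> bool" where
  "join_irreducible V \<longleftrightarrow>
     (\<forall>X. (\<forall>W\<in>X. pseudovariety W) \<longrightarrow> V \<subseteq> pv_join X \<longrightarrow> (\<exists>W\<in>X. V \<subseteq> W))"

definition sg_op :: "'a sg \<Rightarrow> 'a sg" where
  "sg_op S = (sg_car S, \<lambda>x y. sg_mult S y x)"

definition adjI :: "nat sg \<Rightarrow> nat sg" where
  "adjI S = (let i = Suc (Max (sg_car S)) in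
     (insert i (sg_car S), \<lambda>x y. if x = i then y else if y = i then x else sg_mult S x y))"

definition Zn :: "nat \<Rightarrow> nat sg" where
  "Zn n = ({0..<n}, \<lambda>x y. (x + y) mod n)"

(* N_n = <a | a^n = 0>: element k (1 \<le> k < n) is a^k, element n is 0 *)
definition Nn :: "nat \<Rightarrow> nat sg" where
  "Nn n = ({1..n}, \<lambda>x y. min (x + y) n)"

definition L2 :: "nat sg" where "L2 = ({0,1}, \<lambda>x y. x)"
definition R2 :: "nat sg" where "R2 = ({0,1}, \<lambda>x y. y)"

(* A0 = {0,e,f,fe} encoded as 0,1,2,3 *)
definition A0 :: "nat sg" where
  "A0 = ({0,1,2,3}, \<lambda>x y. [[0,0,0,0],[0,1,0,0],[0,3,2,3],[0,3,0,0]] ! x ! y)"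

(* A2 = {0,a,e,ae,ea} encoded as 0,1,2,3,4 *)
definition A2 :: "nat sg" where
  "A2 = ({0,1,2,3,4}, \<lambda>x y. [[0,0,0,0,0],[0,0,3,0,1],[0,4,2,2,4],[0,1,3,3,1],[0,0,2,0,4]] ! x ! y)"

(* B2 = {0,a,b,ab,ba} encoded as 0,1,2,3,4 *)
definition B2 :: "nat sg" where
  "B2 = ({0,1,2,3,4}, \<lambda>x y. [[0,0,0,0,0],[0,0,3,0,1],[0,4,0,2,0],[0,1,0,3,0],[0,0,2,0,4]] ! x ! y)"

(* Z2bar = {1,g,1bar,gbar} encoded as 0,1,2,3 *)
definition Z2bar :: "nat sg" where
  "Z2bar = ({0,1,2,3}, \<lambda>x y. if 2 \<le> y then y else if x < 2 then (x + y) mod 2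
                         else 2 + ((x - 2 + y) mod 2))"

(* N2bar = {0bar,a,abar,Ibar} encoded as 0,1,2,3 *)
definition N2bar :: "nat sg" where
  "N2bar = ({0,1,2,3}, \<lambda>x y. if 2 \<le> y then y else if y = 0 then 0
                         else if x = 3 then 2 else 0)"

(* L2bar = {e,f,ebar,fbar,Ibar} encoded as 0,1,2,3,4 *)
definition L2bar :: "nat sg" where
  "L2bar = ({0,1,2,3,4}, \<lambda>x y. if 2 \<le> y then y else if x = 4 then y + 2 else x)"

(* l3bar = {0bar,a,e,abar,ebar} encoded as 0,1,2,3,4 *)
definition l3bar :: "nat sg" where
  "l3bar = ({0,1,2,3,4}, \<lambda>x y. if 3 \<le> y then y else if x = 2 then y
                         else if x = 4 then (if y = 0 then 0 else y + 2) else 0)"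

definition the_list :: "nat sg list" where
  "the_list = [Zn 2, Zn 3, Zn 4, Zn 5, Z2bar, sg_op Z2bar,
     Nn 2, Nn 3, Nn 4, Nn 5, adjI (Nn 1), adjI (Nn 2), adjI (Nn 3), adjI (Nn 4),
     N2bar, sg_op N2bar, adjI N2bar, adjI (sg_op N2bar),
     L2, R2, adjI L2, adjI R2, L2bar, sg_op L2bar,
     A0, adjI A0, A2, B2, l3bar, sg_op l3bar]"

end

theory Submission
  imports Defs
begin

text \<open>
  If \<open>S\<close> is join irreducible and lies in the join of finitely many \<open>\<lbrakk>T\<^sub>i\<rbrakk>\<close>, then it lies in one of them.
  Taking for the \<open>T\<^sub>i\<close> proper quotients, a smallest counterexample is subdirectly irreducible. The subdirectly
  irreducible semigroups of order at most five are found by a search over partial multiplication tables,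
  which the simplifier evaluates. The labelling is normalised by structure: a zero and a nonzero idempotent;
  the principal ideals of a nilpotent semigroup; and without zero, by comparing the Rees congruence of the minimal
  ideal with the actions on both sides, either a group or a faithful action on left or right zeros, or on the product
  of a two-element left or right zero semigroup with the group of order two.
  For every table found there is a certificate: \<open>S\<close> divides a small product of known semigroups, each of which
  fails to contain \<open>S\<close> because of an identity in two letters, or is a listed semigroup belonging to \<open>\<lbrakk>S\<rbrakk>\<close>.
  Semigroups with \<open>xyz = 0\<close> are treated uniformly: if some square is nonzero, they lie in
  \<open>\<lbrakk>R\<^sub>2\<rbrakk> \<or> \<lbrakk>N\<^sub>3\<rbrakk>\<close>; otherwise they lie in the join of the pseudovarieties of the subsemigroup \<open>{0, f, fe}\<close> of \<open>A\<^sub>0\<close>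
  and of its dual.
\<close>

text \<open>Only an upper bound is claimed, and this keeps certificates short. A semigroup is
  disposed of by one finite join above it: irreducibility puts it below some factor, and each factor
  is either impossible or already the desired answer. The obstacle is the amount of rewriting. There
  are 183732 associative tables on five labelled points, so labels must be normalised before the
  search and entries deduced from associativity during it. Without zero, let \<open>e\<close> be an
  idempotent of the minimal ideal \<open>J\<close>. An element of \<open>J\<close> is determined by
  its left action on \<open>Se\<close> together with its right action on \<open>eS\<close>. Hence
  the two action congruences and the Rees congruence of \<open>J\<close> meet in equality: either
  all three are nontrivial and \<open>S\<close> decomposes, or one action is faithful. In the
  faithful case the bound five leaves little room: a nontrivial group of order m in \<open>J\<close>
  that is not all of \<open>S\<close> forces a second disjoint copy of itself, so \<open>2 m\<close>
  elements, and m is two.\<close>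

declare split_paired_All [simp del] split_paired_Ex [simp del]

section \<open>Finite semigroups, homomorphisms, and copies on other carriers\<close>

lemma fsg_closed: "is_fsemigroup S \<Longrightarrow> x \<in> sg_car S \<Longrightarrow> y \<in> sg_car S \<Longrightarrow> sg_mult S x y \<in> sg_car S"
  and fsg_assoc: "is_fsemigroup S \<Longrightarrow> x \<in> sg_car S \<Longrightarrow> y \<in> sg_car S \<Longrightarrow> z \<in> sg_car S \<Longrightarrow>
     sg_mult S (sg_mult S x y) z = sg_mult S x (sg_mult S y z)"
  and fsg_finite: "is_fsemigroup S \<Longrightarrow> finite (sg_car S)"
  and fsg_nonempty: "is_fsemigroup S \<Longrightarrow> sg_car S \<noteq> {}"
  by (auto simp: is_fsemigroup_def)

lemma sg_car_simp [simp]: "sg_car (A, m) = A" and sg_mult_simp [simp]: "sg_mult (A, m) = m"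
  by (simp_all add: sg_car_def sg_mult_def)

lemma sg_hom_car: "sg_hom h S T \<Longrightarrow> x \<in> sg_car S \<Longrightarrow> h x \<in> sg_car T"
  and sg_hom_mult: "sg_hom h S T \<Longrightarrow> x \<in> sg_car S \<Longrightarrow> y \<in> sg_car S \<Longrightarrow> h (sg_mult S x y) = sg_mult T (h x) (h y)"
  by (auto simp: sg_hom_def)

lemma sg_hom_comp: "sg_hom h S T \<Longrightarrow> sg_hom k T U \<Longrightarrow> sg_hom (k \<circ> h) S U"
  by (auto simp: sg_hom_def)

lemma sg_iso_trans: "sg_iso S T \<Longrightarrow> sg_iso T U \<Longrightarrow> sg_iso S U"
  unfolding sg_iso_def by (meson bij_betw_trans sg_hom_comp)

lemma sg_iso_inv_hom:
  assumes "is_fsemigroup S" and h: "sg_hom h S T" "bij_betw h (sg_car S) (sg_car T)"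
  shows "sg_hom (inv_into (sg_car S) h) T S"
  unfolding sg_hom_def
proof (intro conjI ballI)
  let ?k = "inv_into (sg_car S) h"
  show k: "?k x \<in> sg_car S" if "x \<in> sg_car T" for x
    using that h(2) by (metis bij_betw_imp_surj_on inv_into_into)
  fix x y assume xy: "x \<in> sg_car T" "y \<in> sg_car T"
  have inv: "h (?k z) = z" if "z \<in> sg_car T" for z
    using that h(2) by (metis bij_betw_imp_surj_on f_inv_into_f)
  have "h (sg_mult S (?k x) (?k y)) = sg_mult T x y"
    using h(1) k xy inv by (simp add: sg_hom_def)
  moreover have "sg_mult S (?k x) (?k y) \<in> sg_car S"
    using assms(1) k xy by (simp add: fsg_closed)
  ultimately show "?k (sg_mult T x y) = sg_mult S (?k x) (?k y)"
    using h(2) by (metis bij_betw_imp_inj_on inv_into_f_f)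
qed

lemma sg_iso_sym: "is_fsemigroup S \<Longrightarrow> sg_iso S T \<Longrightarrow> sg_iso T S"
  unfolding sg_iso_def using sg_iso_inv_hom bij_betw_inv_into by blast

text \<open>Associativity is inherited from \<open>S\<close> alone; \<open>T\<close> may be any set
  with a multiplication. This is how structures defined by transport, such as copies and quotients
  on representatives, become semigroups.\<close>

lemma fsg_hom_image:
  assumes "is_fsemigroup S" "sg_hom h S T"
  shows "is_fsemigroup (h ` sg_car S, sg_mult T)"
  using assms(1) fsg_closed[OF assms(1)] fsg_assoc[OF assms(1)]
  unfolding is_fsemigroup_def
  by (simp flip: sg_hom_mult[OF assms(2)])

text \<open>Pseudovarieties contain only semigroups on naturals, so every argument about another
  type passes through such a copy.\<close>

lemma nat_copy:
  fixes S :: "'a sg"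
  assumes "is_fsemigroup S"
  shows "\<exists>U :: nat sg. is_fsemigroup U \<and> sg_iso U S"
proof -
  obtain h :: "'a \<Rightarrow> nat" where inj: "inj_on h (sg_car S)"
    using assms finite_imp_inj_to_nat_seg by (metis fsg_finite)
  let ?k = "inv_into (sg_car S) h"
  define U where "U = (h ` sg_car S, \<lambda>x y. h (sg_mult S (?k x) (?k y)))"
  have hom: "sg_hom h S U" 
    using assms inj by (auto simp: sg_hom_def U_def inv_into_f_f fsg_closed)
  have "is_fsemigroup U" using fsg_hom_image[OF assms hom] by (simp add: U_def)
  moreover have "sg_iso S U"
    unfolding sg_iso_def using hom inj by (auto simp: U_def bij_betw_def)
  ultimately show ?thesis using sg_iso_sym[OF assms] by blast
qed

lemma fsg_prod: "is_fsemigroup S \<Longrightarrow> is_fsemigroup T \<Longrightarrow> is_fsemigroup (sg_prod S T)"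
  by (auto simp: is_fsemigroup_def sg_prod_def)

section \<open>Pseudovarieties, and the pseudovariety generated by a semigroup\<close>

lemma pseudovarietyI:
  assumes "\<And>S. S \<in> V \<Longrightarrow> is_fsemigroup S"
    and "\<And>S T U. S \<in> V \<Longrightarrow> T \<in> V \<Longrightarrow> is_fsemigroup U \<Longrightarrow> sg_iso U (sg_prod S T) \<Longrightarrow> U \<in> V"
    and "\<And>S D. S \<in> V \<Longrightarrow> D \<subseteq> sg_car S \<Longrightarrow> D \<noteq> {} \<Longrightarrow> \<forall>x\<in>D. \<forall>y\<in>D. sg_mult S x y \<in> D \<Longrightarrow>
      (D, sg_mult S) \<in> V"
    and "\<And>S U h. S \<in> V \<Longrightarrow> is_fsemigroup U \<Longrightarrow> sg_hom h S U \<Longrightarrow> h ` sg_car S = sg_car U \<Longrightarrow> U \<in> V"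
  shows "pseudovariety V"
  unfolding pseudovariety_def
  by (intro conjI ballI allI impI; (elim conjE)?) (rule assms; assumption)+

lemma fsg_sub:
  assumes "is_fsemigroup S" "D \<subseteq> sg_car S" "D \<noteq> {}" "\<forall>x\<in>D. \<forall>y\<in>D. sg_mult S x y \<in> D"
  shows "is_fsemigroup (D, sg_mult S)"
  using assms by (auto simp: is_fsemigroup_def subset_iff intro: finite_subset)

lemma pv_fsg: "pseudovariety V \<Longrightarrow> S \<in> V \<Longrightarrow> is_fsemigroup S"
  by (drule pseudovariety_def [THEN iffD1, THEN conjunct1]) (rule bspec)

lemma
  assumes V: "pseudovariety V" and S: "S \<in> V"
  shows pv_prod: "T \<in> V \<Longrightarrow> is_fsemigroup U \<Longrightarrow> sg_iso U (sg_prod S T) \<Longrightarrow> U \<in> V"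
    and pv_sub: "D \<subseteq> sg_car S \<Longrightarrow> D \<noteq> {} \<Longrightarrow>
      (\<And>x y. x \<in> D \<Longrightarrow> y \<in> D \<Longrightarrow> sg_mult S x y \<in> D) \<Longrightarrow> (D, sg_mult S) \<in> V"
    and pv_quot: "is_fsemigroup U \<Longrightarrow> sg_hom h S U \<Longrightarrow> h ` sg_car S = sg_car U \<Longrightarrow> U \<in> V"
proof -
  note V [unfolded pseudovariety_def, THEN conjunct2]
  note V1 = this [THEN conjunct1, THEN bspec, OF S]
    and V2 = this [THEN conjunct2, THEN conjunct1, THEN bspec, OF S]
    and V3 = this [THEN conjunct2, THEN conjunct2, THEN bspec, OF S]
  show "T \<in> V \<Longrightarrow> is_fsemigroup U \<Longrightarrow> sg_iso U (sg_prod S T) \<Longrightarrow> U \<in> V"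
    using V1 by blast
  show "D \<subseteq> sg_car S \<Longrightarrow> D \<noteq> {} \<Longrightarrow>
      (\<And>x y. x \<in> D \<Longrightarrow> y \<in> D \<Longrightarrow> sg_mult S x y \<in> D) \<Longrightarrow> (D, sg_mult S) \<in> V"
    using V2 by blast
  show "is_fsemigroup U \<Longrightarrow> sg_hom h S U \<Longrightarrow> h ` sg_car S = sg_car U \<Longrightarrow> U \<in> V"
    using V3 by blast
qed

text \<open>Guarantees that the intersection defining \<open>gen_pv\<close> runs over a nonempty
  family.\<close>

lemma pv_all: "pseudovariety {U. is_fsemigroup U}"
  by (rule pseudovarietyI) (simp_all add: fsg_sub)

lemma pv_Inter:
  assumes F: "\<And>V. V \<in> F \<Longrightarrow> pseudovariety V" "F \<noteq> {}"
  shows "pseudovariety (\<Inter>F)"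
  unfolding pseudovariety_def
proof (intro conjI ballI allI impI)
  show "is_fsemigroup S" if "S \<in> \<Inter>F" for S using that F by (auto intro: pv_fsg)
  fix S assume S: "S \<in> \<Inter>F"
  show "U \<in> \<Inter>F" if "T \<in> \<Inter>F" "is_fsemigroup U \<and> sg_iso U (sg_prod S T)" for T U
    using that S pv_prod[OF F(1)] by blast
  show "(D, sg_mult S) \<in> \<Inter>F"
    if "D \<subseteq> sg_car S \<and> D \<noteq> {} \<and> (\<forall>x\<in>D. \<forall>y\<in>D. sg_mult S x y \<in> D)" for D
    using that S pv_sub[OF F(1)] by blast
  show "U \<in> \<Inter>F" if "is_fsemigroup U \<and> sg_hom h S U \<and> h ` sg_car S = sg_car U" for U h
    using that S pv_quot[OF F(1)] by blast
qed

text \<open>Replaces membership for a semigroup over an arbitrary type, which cannot itself be an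
  element of a class of semigroups on naturals.\<close>

definition realized_in :: "'a sg \<Rightarrow> nat sg set \<Rightarrow> bool" where
  "realized_in S V \<longleftrightarrow> (\<forall>U. is_fsemigroup U \<and> sg_iso U S \<longrightarrow> U \<in> V)"

lemma gen_pv_alt: "gen_pv S = \<Inter>{V. pseudovariety V \<and> realized_in S V}"
  by (simp add: gen_pv_def realized_in_def)

lemma pv_gen_pv: "pseudovariety (gen_pv S)"
  unfolding gen_pv_alt by (rule pv_Inter) (auto simp: realized_in_def intro: pv_all)

lemma realized_gen_pv: "realized_in S (gen_pv S)"
  by (auto simp: gen_pv_alt realized_in_def)

lemma realized_mono: "realized_in S V \<Longrightarrow> V \<subseteq> W \<Longrightarrow> realized_in S W"
  by (auto simp: realized_in_def)

text \<open>The universal property of generation. It turns every inclusion between generated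
  pseudovarieties into a membership that can be shown by division.\<close>

lemma gen_pv_subset_iff: "pseudovariety V \<Longrightarrow> gen_pv S \<subseteq> V \<longleftrightarrow> realized_in S V"
  using realized_mono[OF realized_gen_pv[of S]] by (auto simp: gen_pv_alt)

lemma realized_iso:
  assumes "is_fsemigroup S" "sg_iso S T"
  shows "realized_in S V \<longleftrightarrow> realized_in T V"
  using sg_iso_sym[OF assms] assms(2) unfolding realized_in_def by (meson sg_iso_trans)

lemma gen_pv_iso: "is_fsemigroup S \<Longrightarrow> sg_iso S T \<Longrightarrow> gen_pv S = gen_pv T"
  unfolding gen_pv_alt using realized_iso by blast

text \<open>Finitely many homomorphisms are combined into one by multiplying the targets, one binary
  product at a time as closure of a pseudovariety allows. The list is nonempty because the empty
  class is also a \<open>pseudovariety\<close> and need not contain the empty product.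
  \<open>G\<close> is only a source and may be infinite.\<close>

lemma common_hom:
  assumes V: "pseudovariety V"
    and "hs \<noteq> []"
    and "\<And>T h. (T, h) \<in> set hs \<Longrightarrow> is_fsemigroup T \<and> realized_in T V \<and> sg_hom h G T"
  shows "\<exists>U\<in>V. \<exists>k. sg_hom k G U \<and> (\<forall>u v. k u = k v \<longrightarrow> (\<forall>(T, h)\<in>set hs. h u = h v \<or> u \<notin> sg_car G \<or> v \<notin> sg_car G))"
  using assms(2,3)
proof (induction hs rule: list_nonempty_induct)
  case (single p)
  obtain T h where p: "p = (T, h)" by (cases p)
  have T: "is_fsemigroup T" "realized_in T V" "sg_hom h G T" using single[of T h] p by simp_all
  obtain U :: "nat sg" where U: "is_fsemigroup U" "sg_iso U T" using nat_copy[OF T(1)] by blast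
  with T have UV: "U \<in> V" by (auto simp: realized_in_def)
  obtain k where k: "sg_hom k T U" "bij_betw k (sg_car T) (sg_car U)"
    using sg_iso_sym[OF U] by (auto simp: sg_iso_def)
  show ?case
  proof (intro bexI[OF _ UV] exI[of _ "k \<circ> h"] conjI allI impI)
    show "sg_hom (k \<circ> h) G U" using T(3) k(1) by (rule sg_hom_comp)
    fix u v assume "(k \<circ> h) u = (k \<circ> h) v"
    then show "\<forall>(T, h)\<in>set [p]. h u = h v \<or> u \<notin> sg_car G \<or> v \<notin> sg_car G"
      using p T(3) k(2) by (auto simp: bij_betw_def inj_on_def sg_hom_def)
  qed
next
  case (cons p hs)
  obtain T h where p: "p = (T, h)" by (cases p)
  have T: "is_fsemigroup T" "realized_in T V" "sg_hom h G T" using cons.prems[of T h] p by simp_all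
  obtain U1 :: "nat sg" where U1: "is_fsemigroup U1" "sg_iso U1 T" using nat_copy[OF T(1)] by blast
  with T have UV1: "U1 \<in> V" by (auto simp: realized_in_def)
  obtain k1 where k1: "sg_hom k1 T U1" "bij_betw k1 (sg_car T) (sg_car U1)"
    using sg_iso_sym[OF U1] by (auto simp: sg_iso_def)
  have "\<exists>U\<in>V. \<exists>k. sg_hom k G U \<and> (\<forall>u v. k u = k v \<longrightarrow> (\<forall>(T, h)\<in>set hs. h u = h v \<or> u \<notin> sg_car G \<or> v \<notin> sg_car G))"
    by (rule cons.IH) (rule cons.prems, simp)
  then obtain U2 k2 where U2: "U2 \<in> V" "sg_hom k2 G U2"
    "\<And>u v. k2 u = k2 v \<Longrightarrow> (\<forall>(T,
      h)\<in>set hs. h u = h v \<or> u \<notin> sg_car G \<or> v \<notin> sg_car G)"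
    by blast
  have P: "is_fsemigroup (sg_prod U1 U2)" using U1 U2(1) pv_fsg[OF V] fsg_prod by blast
  obtain U :: "nat sg" where U: "is_fsemigroup U" "sg_iso U (sg_prod U1 U2)" using nat_copy[OF P] by blast
  have UV: "U \<in> V" using pv_prod[OF V UV1 U2(1) U] .
  obtain k where k: "sg_hom k (sg_prod U1 U2) U" "bij_betw k (sg_car (sg_prod U1 U2)) (sg_car U)"
    using sg_iso_sym[OF U] by (auto simp: sg_iso_def)
  define l where "l = (\<lambda>x. (k1 (h x), k2 x))"
  have l: "sg_hom l G (sg_prod U1 U2)"
    using T(3) k1(1) U2(2) by (auto simp: l_def sg_hom_def sg_prod_def)
  show ?case
  proof (intro bexI[OF _ UV] exI[of _ "k \<circ> l"] conjI allI impI)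
    show "sg_hom (k \<circ> l) G U" using l k(1) by (rule sg_hom_comp)
    fix u v assume eq: "(k \<circ> l) u = (k \<circ> l) v"
    show "\<forall>(T, h)\<in>set (p # hs). h u = h v \<or> u \<notin> sg_car G \<or> v \<notin> sg_car G"
    proof (cases "u \<in> sg_car G \<and> v \<in> sg_car G")
      case True
      then have "l u = l v" using eq k(2) l by (auto simp: bij_betw_def inj_on_def sg_hom_def)
      then have "k1 (h u) = k1 (h v)" "k2 u = k2 v" by (simp_all add: l_def)
      moreover from this(1) have "h u = h v"
        using True k1(2) sg_hom_car[OF T(3)] by (auto simp: bij_betw_def inj_on_def)
      ultimately show ?thesis using U2(3)[of u v] p by simp
    qed auto
  qed
qed

text \<open>The common form of all membership proofs below. If homomorphisms from \<open>G\<close>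
  into members of \<open>V\<close> separate whatever \<open>g\<close> separates, then
  \<open>g\<close> factors through the image of \<open>G\<close> in a finite product.
  \<open>G\<close> will be \<open>S\<close> itself for subdirect decompositions, a semigroup of
  words for arguments by identities, and a listed subsemigroup of a product for
  certificates.\<close>

lemma realized_by_separation:
  assumes V: "pseudovariety V" and "hs \<noteq> []"
    and hs: "\<And>T h. (T, h) \<in> set hs \<Longrightarrow> is_fsemigroup T \<and> realized_in T V \<and> sg_hom h G T"
    and G: "\<And>x y. x \<in> sg_car G \<Longrightarrow> y \<in> sg_car G \<Longrightarrow> sg_mult G x y \<in> sg_car G"
    and S: "is_fsemigroup S" and g: "sg_hom g G S" "g ` sg_car G = sg_car S"
    and sep: "\<And>u v. u \<in> sg_car G \<Longrightarrow> v \<in> sg_car G \<Longrightarrow> (\<And>T h. (T, h) \<in> set hs \<Longrightarrow> h u = h v) \<Longrightarrow> g u = g v"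
  shows "realized_in S V"
  unfolding realized_in_def
proof (intro allI impI)
  fix W :: "nat sg" assume W: "is_fsemigroup W \<and> sg_iso W S"
  then obtain j where j: "sg_hom j S W" "bij_betw j (sg_car S) (sg_car W)"
    using sg_iso_sym[of W S] unfolding sg_iso_def by blast
  obtain U k where U: "U \<in> V" and k: "sg_hom k G U"
    "\<And>u v. k u = k v \<Longrightarrow> \<forall>(T,
      h)\<in>set hs. h u = h v \<or> u \<notin> sg_car G \<or> v \<notin> sg_car G"
    using common_hom[OF V assms(2) hs] by blast
  \<comment> \<open>The kernel of \<open>k\<close> is contained in that of \<open>g\<close>; this
    makes the map \<open>r\<close> on the image well defined.\<close>
  have det: "g u = g v" if "k u = k v" "u \<in> sg_car G" "v \<in> sg_car G" for u v
    by (rule sep) (use k(2)[OF that(1)] that in auto)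
  have nonempty: "sg_car G \<noteq> {}" using g(2) fsg_nonempty[OF S] by auto
  let ?D = "k ` sg_car G"
  have D: "(?D, sg_mult U) \<in> V"
  proof (rule pv_sub[OF V U])
    show "?D \<subseteq> sg_car U" using k(1) by (auto simp: sg_hom_def)
    show "sg_mult U x y \<in> ?D" if "x \<in> ?D" "y \<in> ?D" for x y
      using that G sg_hom_mult[OF k(1)] by (auto simp: image_iff) metis
  qed (use nonempty in auto)
  \<comment> \<open>The factorisation of \<open>g\<close> through \<open>k\<close>, followed by the
    isomorphism onto the copy \<open>W\<close>.\<close>
  define r where "r = (\<lambda>d. j (g (inv_into (sg_car G) k d)))"
  have r: "r (k u) = j (g u)" if "u \<in> sg_car G" for u
    using that unfolding r_def by (metis det f_inv_into_f imageI inv_into_into)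
  show "W \<in> V"
  proof (rule pv_quot[OF V D])
    show "sg_hom r (?D, sg_mult U) W"
    proof -
      have "r (sg_mult U (k u) (k v)) = sg_mult W (r (k u)) (r (k v))"
        if "u \<in> sg_car G" "v \<in> sg_car G" for u v
        using that r G sg_hom_mult[OF k(1)] sg_hom_mult[OF g(1)] sg_hom_mult[OF j(1)] sg_hom_car[OF g(1)]
        by metis
      then show ?thesis
        using r sg_hom_car[OF g(1)] sg_hom_car[OF j(1)] by (auto simp: sg_hom_def)
    qed
    have "r ` ?D = j ` (g ` sg_car G)" using r by (auto simp: image_image)
    then show "r ` sg_car (?D, sg_mult U) = sg_car W"
      using g(2) j(2) by (simp add: bij_betw_def)
  qed (use W in auto)
qed

text \<open>The special case of one separating homomorphism, the inclusion of a
  subsemigroup.\<close>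

lemma realized_divisor:
  assumes V: "pseudovariety V" and "realized_in T V" "is_fsemigroup T"
    and "D \<subseteq> sg_car T" "\<And>x y. x \<in> D \<Longrightarrow> y \<in> D \<Longrightarrow> sg_mult T x y \<in> D"
    and "is_fsemigroup S" "sg_hom g (D, sg_mult T) S" "g ` D = sg_car S"
  shows "realized_in S V"
  by (rule realized_by_separation[OF V, of "[(T, id)]" "(D, sg_mult T)" S g])
     (use assms in \<open>auto simp: sg_hom_def\<close>)

subsection \<open>Identities\<close>

text \<open>Evaluation starts at the first letter because there is no identity element to start
  from. On the empty word the value is the meaningless \<open>a (hd [])\<close>, whence the
  hypotheses \<open>w \<noteq> []\<close>.\<close>

definition ev :: "'a sg \<Rightarrow> ('x \<Rightarrow> 'a) \<Rightarrow> 'x list \<Rightarrow> 'a" where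
  "ev S a w = foldl (\<lambda>p x. sg_mult S p (a x)) (a (hd w)) (tl w)"

lemma ev_single [simp]: "ev S a [x] = a x"
  by (simp add: ev_def)

lemma ev_snoc: "w \<noteq> [] \<Longrightarrow> ev S a (w @ [x]) = sg_mult S (ev S a w) (a x)"
  by (simp add: ev_def)

lemma ev_car:
  assumes "is_fsemigroup S" "w \<noteq> []" "a ` set w \<subseteq> sg_car S"
  shows "ev S a w \<in> sg_car S"
  using assms(2,3)
  by (induction w rule: rev_nonempty_induct) (auto simp: ev_snoc intro: fsg_closed[OF assms(1)])

lemma ev_append:
  assumes "is_fsemigroup S" "u \<noteq> []" "w \<noteq> []" "a ` set u \<subseteq> sg_car S" "a ` set w \<subseteq> sg_car S"
  shows "ev S a (u @ w) = sg_mult S (ev S a u) (ev S a w)"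
  using assms(3,5)
proof (induction w rule: rev_nonempty_induct)
  case (single x)
  then show ?case using assms by (simp add: ev_snoc)
next
  case (snoc x w)
  then show ?case
    using assms(1,2,4) by (simp add: ev_snoc fsg_assoc ev_car flip: append_assoc)
qed

lemma ev_cong: "w \<noteq> [] \<Longrightarrow> (\<And>x. x \<in> set w \<Longrightarrow> a x = b x) \<Longrightarrow> ev S a w = ev S b w"
  by (induction w rule: rev_nonempty_induct) (auto simp: ev_snoc)

lemma ev_hom:
  assumes "is_fsemigroup S" "sg_hom h S T" "w \<noteq> []" "a ` set w \<subseteq> sg_car S"
  shows "ev T (h \<circ> a) w = h (ev S a w)"
  using assms(3,4)
  by (induction w rule: rev_nonempty_induct)
     (auto simp: ev_snoc sg_hom_mult[OF assms(2)] ev_car[OF assms(1)])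

definition satisfies :: "'a sg \<Rightarrow> 'x list \<Rightarrow> 'x list \<Rightarrow> bool" where
  "satisfies S u v \<longleftrightarrow> (\<forall>a. range a \<subseteq> sg_car S \<longrightarrow> ev S a u = ev S a v)"

lemma satisfies_quot:
  fixes S :: "'a sg" and T :: "'b sg" and u v :: "'x list"
  assumes "is_fsemigroup S" "sg_hom h S T" "h ` sg_car S = sg_car T" "satisfies S u v" "u \<noteq> []" "v \<noteq> []"
  shows "satisfies T u v"
  unfolding satisfies_def
proof (intro allI impI)
  fix b :: "'x \<Rightarrow> 'b" assume b: "range b \<subseteq> sg_car T"
  \<comment> \<open>The assignment is lifted through a section of the surjection
    \<open>h\<close>.\<close>
  define a where "a = (\<lambda>x. inv_into (sg_car S) h (b x))"
  have a: "range a \<subseteq> sg_car S" "h \<circ> a = b"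
    using b assms(3) by (auto simp: a_def fun_eq_iff inv_into_into f_inv_into_f subset_iff)
  have "ev T (h \<circ> a) u = ev T (h \<circ> a) v"
    using assms(4-6) a(1) ev_hom[OF assms(1,2), of u a] ev_hom[OF assms(1,2), of v a]
    by (simp add: satisfies_def image_subset_iff)
  then show "ev T b u = ev T b v" using a(2) by simp
qed

lemma satisfies_iso:
  assumes "is_fsemigroup S" "sg_iso S T" "satisfies S u v" "u \<noteq> []" "v \<noteq> []"
  shows "satisfies T u v"
  using assms(2) satisfies_quot[OF assms(1) _ _ assms(3-5)] unfolding sg_iso_def bij_betw_def by blast

lemma ev_sub: "ev (D, sg_mult S) a w = ev S a w"
  by (simp add: ev_def)

lemma ev_prod: "w \<noteq> [] \<Longrightarrow> ev (sg_prod S T) a w = (ev S (fst \<circ> a) w, ev T (snd \<circ> a) w)"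
  by (induction w rule: rev_nonempty_induct) (auto simp: ev_snoc, simp_all add: sg_prod_def)

lemma satisfies_prod:
  fixes S :: "'a sg" and T :: "'b sg" and u v :: "'x list"
  assumes "satisfies S u v" "satisfies T u v" "u \<noteq> []" "v \<noteq> []"
  shows "satisfies (sg_prod S T) u v"
  unfolding satisfies_def
proof (intro allI impI)
  fix a :: "'x \<Rightarrow> 'a \<times> 'b" assume "range a \<subseteq> sg_car (sg_prod S T)"
  then have "range (fst \<circ> a) \<subseteq> sg_car S" "range (snd \<circ> a) \<subseteq> sg_car T"
    by (fastforce simp: sg_prod_def)+
  then show "ev (sg_prod S T) a u = ev (sg_prod S T) a v"
    using assms by (simp add: ev_prod satisfies_def)
qed

lemma pv_identity:
  assumes "u \<noteq> []" "v \<noteq> []"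
  shows "pseudovariety {U. is_fsemigroup U \<and> satisfies U u v}" (is "pseudovariety ?V")
proof (rule pseudovarietyI)
  fix S T U :: "nat sg"
  assume "S \<in> ?V" "T \<in> ?V" and U: "is_fsemigroup U" "sg_iso U (sg_prod S T)"
  then have "satisfies (sg_prod S T) u v" "sg_iso (sg_prod S T) U" "is_fsemigroup (sg_prod S T)"
    using assms satisfies_prod sg_iso_sym fsg_prod by blast+
  then show "U \<in> ?V" using satisfies_iso U(1) assms by blast
next
  fix S :: "nat sg" and D
  assume "S \<in> ?V" and D: "D \<subseteq> sg_car S" "D \<noteq> {}" "\<forall>x\<in>D. \<forall>y\<in>D. sg_mult S x y \<in> D"
  then have S: "is_fsemigroup S" "satisfies S u v" by auto
  then show "(D, sg_mult S) \<in> ?V"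
    using S(2) D(1) fsg_sub[OF S(1) D] by (auto simp: satisfies_def ev_sub)
next
  fix S U :: "nat sg" and h
  assume "S \<in> ?V" "is_fsemigroup U" "sg_hom h S U" "h ` sg_car S = sg_car U"
  then show "U \<in> ?V" using satisfies_quot assms by blast
qed auto

text \<open>The models of an identity form a pseudovariety; it contains everything generated by
  \<open>T\<close> but omits the copies of \<open>S\<close>.\<close>

lemma not_below_by_identity:
  assumes "is_fsemigroup S" "is_fsemigroup T" "satisfies T u v" "\<not> satisfies S u v" "u \<noteq> []" "v \<noteq> []"
  shows "\<not> gen_pv S \<subseteq> gen_pv T"
proof
  assume sub: "gen_pv S \<subseteq> gen_pv T"
  let ?W = "{U. is_fsemigroup U \<and> satisfies U u v}"
  have "realized_in T ?W"
    unfolding realized_in_def using assms satisfies_iso sg_iso_sym by blast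
  then have "gen_pv T \<subseteq> ?W" using gen_pv_subset_iff pv_identity assms by blast
  moreover obtain U :: "nat sg" where U: "is_fsemigroup U" "sg_iso U S"
    using nat_copy[OF assms(1)] by blast
  ultimately have "satisfies U u v" using sub realized_gen_pv[of S] by (auto simp: realized_in_def)
  then show False using satisfies_iso[OF U] assms by blast
qed

text \<open>The second hypothesis expresses that \<open>S\<close> lies in the join of the
  \<open>gen_pv T\<close>, without forming it: the join is the intersection of the pseudovarieties
  above all of them.\<close>

lemma join_irreducible_below:
  assumes "join_irreducible (gen_pv S)"
    and "\<And>V. pseudovariety V \<Longrightarrow> (\<And>T. T \<in> \<T> \<Longrightarrow> realized_in T V) \<Longrightarrow> realized_in S V"
  shows "\<exists>T\<in>\<T>. gen_pv S \<subseteq> gen_pv T"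
proof -
  have "gen_pv S \<subseteq> pv_join (gen_pv ` \<T>)"
    unfolding pv_join_def
  proof (rule Inter_greatest)
    fix V assume "V \<in> {V. pseudovariety V \<and> \<Union> (gen_pv ` \<T>) \<subseteq> V}"
    then have "pseudovariety V" "\<And>T. T \<in> \<T> \<Longrightarrow> realized_in T V"
      using gen_pv_subset_iff by (blast, blast)
    then show "gen_pv S \<subseteq> V" using assms(2) gen_pv_subset_iff by blast
  qed
  moreover have "\<forall>W\<in>gen_pv ` \<T>. pseudovariety W" by (auto intro: pv_gen_pv)
  ultimately show ?thesis using assms(1) unfolding join_irreducible_def by blast
qed

subsection \<open>Multiplication tables\<close>

datatype elt = E0 | E1 | E2 | E3 | E4 | EU

text \<open>\<open>EU\<close> marks an unknown entry of a partial table.\<close>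

datatype row = Row elt elt elt elt elt
text \<open>Five fixed slots, rather than lists or functions, let the simplifier read and update
  entries by matching constructors. Smaller orders fill the surplus slots with
  \<open>EU\<close>.\<close>

datatype tab = Tab row row row row row

fun at :: "row \<Rightarrow> elt \<Rightarrow> elt" where
  "at (Row a b c d e) E0 = a"
| "at (Row a b c d e) E1 = b"
| "at (Row a b c d e) E2 = c"
| "at (Row a b c d e) E3 = d"
| "at (Row a b c d e) E4 = e"
| "at r EU = EU"

fun nthrow :: "tab \<Rightarrow> elt \<Rightarrow> row" where
  "nthrow (Tab a b c d e) E0 = a"
| "nthrow (Tab a b c d e) E1 = b"
| "nthrow (Tab a b c d e) E2 = c"
| "nthrow (Tab a b c d e) E3 = d"
| "nthrow (Tab a b c d e) E4 = e"
| "nthrow t EU = Row EU EU EU EU EU"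

definition mt :: "tab \<Rightarrow> elt \<Rightarrow> elt \<Rightarrow> elt" where
  "mt t x y = at (nthrow t x) y"

definition tsg :: "elt list \<Rightarrow> tab \<Rightarrow> elt sg" where
  "tsg es t = (set es, mt t)"

lemma at_EU [simp]: "at r EU = EU"
  by (cases r) simp

text \<open>Unknown factors give unknown products, so nested products of partially known entries can
  be formed without testing their operands.\<close>

lemma mt_EU [simp]: "mt t x EU = EU" "mt t EU x = EU"
  by (simp_all add: mt_def) (cases x; simp)

fun setr :: "row \<Rightarrow> elt \<Rightarrow> elt \<Rightarrow> row" where
  "setr (Row a b c d e) E0 v = Row v b c d e"
| "setr (Row a b c d e) E1 v = Row a v c d e"
| "setr (Row a b c d e) E2 v = Row a b v d e"
| "setr (Row a b c d e) E3 v = Row a b c v e"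
| "setr (Row a b c d e) E4 v = Row a b c d v"
| "setr r EU v = r"

fun sett :: "tab \<Rightarrow> elt \<Rightarrow> elt \<Rightarrow> elt \<Rightarrow> tab" where
  "sett (Tab a b c d e) E0 y v = Tab (setr a y v) b c d e"
| "sett (Tab a b c d e) E1 y v = Tab a (setr b y v) c d e"
| "sett (Tab a b c d e) E2 y v = Tab a b (setr c y v) d e"
| "sett (Tab a b c d e) E3 y v = Tab a b c (setr d y v) e"
| "sett (Tab a b c d e) E4 y v = Tab a b c d (setr e y v)"
| "sett t EU y v = t"

lemma at_setr: "y \<noteq> EU \<Longrightarrow> at (setr r y v) b = (if b = y then v else at r b)"
  by (cases r; cases y; cases b) simp_all

lemma nthrow_sett: "x \<noteq> EU \<Longrightarrow> nthrow (sett t x y v) a = (if a = x then setr (nthrow t x) y v else nthrow t a)"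
  by (cases t; cases x; cases a) simp_all

lemma mt_sett: "x \<noteq> EU \<Longrightarrow> y \<noteq> EU \<Longrightarrow> mt (sett t x y v) a b = (if a = x \<and> b = y then v else mt t a b)"
  by (simp add: mt_def nthrow_sett at_setr)

fun mem :: "'x \<Rightarrow> 'x list \<Rightarrow> bool" where
  "mem x [] = False"
| "mem x (y # ys) = (if x = y then True else mem x ys)"

lemma mem_iff [simp]: "mem x ys \<longleftrightarrow> x \<in> set ys"
  by (induction ys) auto

fun same :: "elt \<Rightarrow> elt \<Rightarrow> bool" where
  "same E0 E0 = True"
| "same E1 E1 = True"
| "same E2 E2 = True"
| "same E3 E3 = True"
| "same E4 E4 = True"
| "same EU EU = True"
| "same x y = False"

lemma same_iff [simp]: "same x y \<longleftrightarrow> x = y"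
  by (cases x; cases y) simp_all

subsection \<open>Exhaustive search over partial tables\<close>

text \<open>
  All functions below are evaluated by the simplifier inside the kernel. A Boolean first argument
  that is matched on plays the role of a lazy conditional: unlike \<open>if\<close>, it does not make
  the simplifier traverse the tables again.
\<close>

fun clash :: "elt \<Rightarrow> elt \<Rightarrow> bool" where
  "clash EU q = False"
| "clash p EU = False"
| "clash p q = (\<not> same p q)"

lemma clash_iff: "clash p q \<longleftrightarrow> p \<noteq> EU \<and> q \<noteq> EU \<and> p \<noteq> q"
  by (cases p; cases q) simp_all

text \<open>After \<open>x y = v\<close> has been entered, associativity is tested on the triples
  \<open>(x, y, c)\<close> and \<open>(c, x, y)\<close>, where the new entry is an inner product.
  This is a filter only: tables of semigroups have to pass it, while a nonassociative survivor
  merely costs work at a leaf.\<close>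

fun consistent :: "bool \<Rightarrow> elt list \<Rightarrow> tab \<Rightarrow> elt \<Rightarrow> elt \<Rightarrow> elt \<Rightarrow> bool" where
  "consistent False cs t x y v = False"
| "consistent True [] t x y v = True"
| "consistent True (c # cs) t x y v =
     consistent (\<not> (clash (mt t v c) (mt t x (mt t y c)) \<or> clash (mt t (mt t c x) y) (mt t c v))) cs t x y v"

fun add_known :: "elt \<Rightarrow> elt list \<Rightarrow> elt list" where
  "add_known EU vs = vs"
| "add_known v vs = v # vs"

lemma add_known_alt: "add_known v vs = (if v = EU then vs else v # vs)"
  by (cases v) auto

text \<open>A known factorisation determines entries: from \<open>x = a b\<close> follows
  \<open>x y = a (b y)\<close>, and from \<open>y = a b\<close> follows
  \<open>x y = (x a) b\<close>.\<close>

fun via_left :: "bool \<Rightarrow> tab \<Rightarrow> elt \<Rightarrow> elt \<Rightarrow> elt \<Rightarrow> elt" where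
  "via_left True t a b y = mt t a (mt t b y)"
| "via_left False t a b y = EU"

fun via_right :: "bool \<Rightarrow> tab \<Rightarrow> elt \<Rightarrow> elt \<Rightarrow> elt \<Rightarrow> elt" where
  "via_right True t x a b = mt t (mt t x a) b"
| "via_right False t x a b = EU"

definition add_forced :: "elt \<Rightarrow> elt \<Rightarrow> elt \<Rightarrow> tab \<Rightarrow> elt \<Rightarrow> elt \<Rightarrow> elt list \<Rightarrow> elt list" where
  "add_forced c a b t x y vs =
     add_known (via_left (same c x) t a b y) (add_known (via_right (same c y) t x a b) vs)"

fun forced_by :: "elt \<Rightarrow> elt list \<Rightarrow> tab \<Rightarrow> elt \<Rightarrow> elt \<Rightarrow> elt list" where
  "forced_by a [] t x y = []"
| "forced_by a (b # bs) t x y = add_forced (mt t a b) a b t x y (forced_by a bs t x y)"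

fun forced :: "elt list \<Rightarrow> elt list \<Rightarrow> tab \<Rightarrow> elt \<Rightarrow> elt \<Rightarrow> elt list" where
  "forced [] es t x y = []"
| "forced (a # as) es t x y = forced_by a es t x y @ forced as es t x y"

fun all_eq :: "elt \<Rightarrow> elt list \<Rightarrow> bool" where
  "all_eq f [] = True"
| "all_eq f (g # gs) = (if same f g then all_eq f gs else False)"

text \<open>Two different forced values contradict each other and leave no branch, as does a forced
  value that is no candidate. Branching over all candidates occurs only if nothing is
  forced.\<close>

fun select :: "elt list \<Rightarrow> elt list \<Rightarrow> elt list" where
  "select [] cand = cand"
| "select (f # fs) cand = (if all_eq f fs then if mem f cand then [f] else [] else [])"

fun unless :: "bool \<Rightarrow> (tab \<Rightarrow> bool) \<Rightarrow> tab \<Rightarrow> bool" where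
  "unless True k t = True"
| "unless False k t = k t"

fun node :: "bool \<Rightarrow> (tab \<Rightarrow> bool) \<Rightarrow> (tab \<Rightarrow> bool) \<Rightarrow> tab \<Rightarrow> bool" where
  "node True pr k t = unless (pr t) k t"
| "node False pr k t = True"

definition visit :: "elt list \<Rightarrow> (tab \<Rightarrow> bool) \<Rightarrow> (tab \<Rightarrow> bool) \<Rightarrow> elt \<Rightarrow> elt \<Rightarrow> elt \<Rightarrow> tab \<Rightarrow> bool" where
  "visit es pr k x y v t = node (consistent True es t x y v) pr k t"

fun branch :: "bool \<Rightarrow> elt list \<Rightarrow> (tab \<Rightarrow> bool) \<Rightarrow> (tab \<Rightarrow> bool) \<Rightarrow> elt \<Rightarrow> elt \<Rightarrow> tab \<Rightarrow> elt list \<Rightarrow> bool" where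
  "branch False es pr k x y t vs = False"
| "branch True es pr k x y t [] = True"
| "branch True es pr k x y t (v # vs) = branch (visit es pr k x y v (sett t x y v)) es pr k x y t vs"

fun fill :: "bool \<Rightarrow> elt list \<Rightarrow> (tab \<Rightarrow> elt \<Rightarrow> elt \<Rightarrow> elt list) \<Rightarrow> (tab \<Rightarrow> bool) \<Rightarrow> (tab \<Rightarrow> bool)
    \<Rightarrow> elt \<Rightarrow> elt \<Rightarrow> tab \<Rightarrow> bool" where
  "fill True es cand pr k x y t = branch True es pr k x y t (select (forced es es t x y) (cand t x y))"
| "fill False es cand pr k x y t = k t"

text \<open>The list of cells fixes the order of filling, and a cell known in advance is passed
  over. The rest of the search is handed down as a continuation, so success means that
  \<open>leaf\<close> accepts every table reached.\<close>

fun search :: "elt list \<Rightarrow> (tab \<Rightarrow> elt \<Rightarrow> elt \<Rightarrow> elt list) \<Rightarrow> (tab \<Rightarrow> bool) \<Rightarrow> (tab \<Rightarrow> bool)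
    \<Rightarrow> (elt \<times> elt) list \<Rightarrow> tab \<Rightarrow> bool" where
  "search es cand pr leaf [] t = leaf t"
| "search es cand pr leaf ((x, y) # cs) t =
     fill (same (mt t x y) EU) es cand pr (search es cand pr leaf cs) x y t"

definition extends :: "elt list \<Rightarrow> (elt \<Rightarrow> elt \<Rightarrow> elt) \<Rightarrow> tab \<Rightarrow> bool" where
  "extends es f t \<longleftrightarrow> (\<forall>x\<in>set es. \<forall>y\<in>set es. mt t x y = EU \<or> mt t x y = f x y)"

lemma extends_mt: "extends es f t \<Longrightarrow> x \<in> set es \<Longrightarrow> y \<in> set es \<Longrightarrow> mt t x y \<noteq> EU \<Longrightarrow> mt t x y = f x y"
  by (auto simp: extends_def)

context
  fixes es :: "elt list" and f :: "elt \<Rightarrow> elt \<Rightarrow> elt"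
  assumes fsg: "is_fsemigroup (set es, f)"
begin

lemma f_closed: "x \<in> set es \<Longrightarrow> y \<in> set es \<Longrightarrow> f x y \<in> set es"
  using fsg_closed[OF fsg] by simp

lemma f_assoc: "x \<in> set es \<Longrightarrow> y \<in> set es \<Longrightarrow> z \<in> set es \<Longrightarrow> f (f x y) z = f x (f y z)"
  using fsg_assoc[OF fsg] by simp

lemma extends_left:
  assumes "extends es f t" "x \<in> set es" "y \<in> set es" "z \<in> set es" "mt t x (mt t y z) \<noteq> EU"
  shows "mt t x (mt t y z) = f x (f y z)"
proof -
  have "mt t y z \<noteq> EU" using assms(5) by auto
  then have "mt t y z = f y z" using assms extends_mt by blast
  then show ?thesis using assms extends_mt f_closed by metis
qed

lemma extends_right:
  assumes "extends es f t" "x \<in> set es" "y \<in> set es" "z \<in> set es" "mt t (mt t x y) z \<noteq> EU"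
  shows "mt t (mt t x y) z = f (f x y) z"
proof -
  have "mt t x y \<noteq> EU" using assms(5) by auto
  then have "mt t x y = f x y" using assms extends_mt by blast
  then show ?thesis using assms extends_mt f_closed by metis
qed

lemma consistentI:
  assumes "extends es f t" "x \<in> set es" "y \<in> set es" "v = f x y" "set cs \<subseteq> set es"
  shows "consistent True cs t x y v"
  using assms(5)
proof (induction cs)
  case (Cons c cs)
  then have c: "c \<in> set es" by simp
  have v: "v \<in> set es" using assms f_closed by simp
  have "\<not> clash (mt t v c) (mt t x (mt t y c))"
    using extends_mt[OF assms(1) v c] extends_left[OF assms(1-3) c] f_assoc[OF assms(2,3) c] assms(4)
    by (metis clash_iff)
  moreover have "\<not> clash (mt t (mt t c x) y) (mt t c v)"
    using extends_mt[OF assms(1) c v] extends_right[OF assms(1) c assms(2,3)] f_assoc[OF c assms(2,3)] assms(4)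
    by (metis clash_iff)
  ultimately show ?case using Cons by simp
qed simp

lemma forced_by_sound:
  assumes "extends es f t" "x \<in> set es" "y \<in> set es" "a \<in> set es" "set bs \<subseteq> set es"
    "v \<in> set (forced_by a bs t x y)" "EU \<notin> set es"
  shows "v = f x y"
  using assms(5,6)
proof (induction bs)
  case (Cons b bs)
  then have b: "b \<in> set es" by simp
  have 1: "mt t a (mt t b y) = f x y" if "mt t a b = x" "mt t a (mt t b y) \<noteq> EU"
    using extends_left[OF assms(1,4) b assms(3)] extends_mt[OF assms(1,4) b] that f_assoc[OF assms(4) b assms(3)] assms(2,7)
    by force
  have 2: "mt t (mt t x a) b = f x y" if "mt t a b = y" "mt t (mt t x a) b \<noteq> EU"
    using extends_right[OF assms(1,2,4) b] extends_mt[OF assms(1,4) b] that f_assoc[OF assms(2,4) b] assms(3,7)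
    by force
  show ?case
    using Cons 1 2
    by (cases "mt t a b = x"; cases "mt t a b = y") (auto simp: add_forced_def add_known_alt split: if_splits)
qed simp

lemma forced_sound:
  assumes "extends es f t" "x \<in> set es" "y \<in> set es" "set as \<subseteq> set es" "v \<in> set (forced as es t x y)" "EU \<notin> set es"
  shows "v = f x y"
  using assms(4,5) forced_by_sound[OF assms(1-3) _ subset_refl _ assms(6)]
  by (induction as) auto

lemma all_eq_iff: "all_eq g gs \<longleftrightarrow> (\<forall>h\<in>set gs. h = g)"
  by (induction gs) auto

lemma select_sound: "\<forall>v\<in>set fs. v = w \<Longrightarrow> w \<in> set cand \<Longrightarrow> w \<in> set (select fs cand)"
  by (cases fs) (auto simp: all_eq_iff)

lemma branchD: "branch True es pr k x y t vs \<Longrightarrow> v \<in> set vs \<Longrightarrow> visit es pr k x y v (sett t x y v)"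
proof (induction vs)
  case (Cons w vs)
  then show ?case by (cases "visit es pr k x y w (sett t x y w)") auto
qed simp

text \<open>Every candidate branch must succeed, in particular the one that follows the actual
  values of \<open>f\<close>. Along it each partial table is a restriction of \<open>f\<close>,
  hence it is neither inconsistent nor pruned, and it ends at a leaf equal to
  \<open>f\<close>.\<close>

theorem search_sound:
  assumes EU: "EU \<notin> set es"
    and C: "C \<subseteq> set es \<times> set es"
    and cand: "\<And>t x y. extends es f t \<Longrightarrow> (x, y) \<in> C \<Longrightarrow> mt t x y = EU \<Longrightarrow> f x y \<in> set (cand t x y)"
    and pr: "\<And>t. extends es f t \<Longrightarrow> \<not> pr t"
    and "search es cand pr leaf cs t" "extends es f t" "set cs \<subseteq> C"
    and "\<And>x y. x \<in> set es \<Longrightarrow> y \<in> set es \<Longrightarrow> mt t x y = EU \<Longrightarrow> (x, y) \<in> set cs"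
  shows "\<exists>t'. leaf t' \<and> (\<forall>x\<in>set es. \<forall>y\<in>set es. mt t' x y = f x y)"
  using assms(5-)
proof (induction cs arbitrary: t)
  case Nil
  then show ?case by (auto simp: extends_def intro!: exI[of _ t])
next
  case (Cons c cs)
  obtain x y where c: "c = (x, y)" by (cases c)
  have xyC: "(x, y) \<in> C" using Cons.prems c by auto
  then have xy: "x \<in> set es" "y \<in> set es" using C by auto
  then have nU: "x \<noteq> EU" "y \<noteq> EU" using EU by auto
  show ?case
  proof (cases "mt t x y = EU")
    case True
    let ?v = "f x y" let ?t = "sett t x y ?v"
    have "?v \<in> set (select (forced es es t x y) (cand t x y))"
      using forced_sound[OF Cons.prems(2) xy subset_refl _ EU] cand[OF Cons.prems(2) xyC True]
      by (intro select_sound) auto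
    then have "visit es pr (search es cand pr leaf cs) x y ?v ?t"
      using Cons.prems(1) True c branchD by fastforce
    moreover have ext: "extends es f ?t"
      using Cons.prems(2) nU by (auto simp: extends_def mt_sett)
    moreover have "consistent True es ?t x y ?v"
      by (rule consistentI[OF ext xy]) auto
    ultimately have "search es cand pr leaf cs ?t"
      using pr[OF ext] by (auto simp: visit_def)
    then show ?thesis
    proof (rule Cons.IH[OF _ ext])
      show "set cs \<subseteq> C" using Cons.prems by auto
      fix a b assume ab: "a \<in> set es" "b \<in> set es" "mt ?t a b = EU"
      have "?v \<noteq> EU" using f_closed[OF xy] EU by auto
      with ab(3) have "mt t a b = EU" "(a, b) \<noteq> (x, y)" using nU by (auto simp: mt_sett split: if_splits)
      then show "(a, b) \<in> set cs" using Cons.prems(4)[OF ab(1,2)] c by auto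
    qed
  next
    case False
    have "search es cand pr leaf cs t" using Cons.prems(1) False c by simp
    then show ?thesis
      by (rule Cons.IH) (use Cons.prems False c in auto)
  qed
qed

end

subsection \<open>Subdirect decompositions\<close>

text \<open>In this section a row \<open>p\<close> encodes an equivalence by sending each element to
  a representative of its class. Compatibility is tested only between an element and its
  representative; by transitivity this is enough.\<close>

fun cong_at :: "bool \<Rightarrow> elt list \<Rightarrow> tab \<Rightarrow> row \<Rightarrow> elt \<Rightarrow> elt \<Rightarrow> bool" where
  "cong_at False cs t p x x' = False"
| "cong_at True [] t p x x' = True"
| "cong_at True (c # cs) t p x x' =
     cong_at (same (at p (mt t x c)) (at p (mt t x' c)) \<and> same (at p (mt t c x)) (at p (mt t c x'))) cs t p x x'"

fun cong_class :: "bool \<Rightarrow> elt list \<Rightarrow> tab \<Rightarrow> row \<Rightarrow> elt \<Rightarrow> bool" where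
  "cong_class True es t p x = True"
| "cong_class False es t p x = cong_at True es t p x (at p x)"

fun is_cong :: "bool \<Rightarrow> elt list \<Rightarrow> elt list \<Rightarrow> tab \<Rightarrow> row \<Rightarrow> bool" where
  "is_cong False xs es t p = False"
| "is_cong True [] es t p = True"
| "is_cong True (x # xs) es t p = is_cong (cong_class (same (at p x) x) es t p x) xs es t p"

fun cons_if :: "bool \<Rightarrow> row \<Rightarrow> row list \<Rightarrow> row list" where
  "cons_if True p ps = p # ps"
| "cons_if False p ps = ps"

fun congs :: "elt list \<Rightarrow> tab \<Rightarrow> row list \<Rightarrow> row list" where
  "congs es t [] = []"
| "congs es t (p # ps) = cons_if (is_cong True es es t p) p (congs es t ps)"

fun separated :: "elt \<Rightarrow> elt \<Rightarrow> row list \<Rightarrow> bool" where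
  "separated x y [] = False"
| "separated x y (p # ps) = (if same (at p x) (at p y) then separated x y ps else True)"

fun separated_from :: "elt \<Rightarrow> elt list \<Rightarrow> row list \<Rightarrow> bool" where
  "separated_from x [] ps = True"
| "separated_from x (y # ys) ps = (if separated x y ps then separated_from x ys ps else False)"

fun pairwise_separated :: "elt list \<Rightarrow> row list \<Rightarrow> bool" where
  "pairwise_separated [] ps = True"
| "pairwise_separated (x # xs) ps = (if separated_from x xs ps then pairwise_separated xs ps else False)"

text \<open>Rows that are no congruences of \<open>t\<close> are dropped; the remaining ones must
  intersect in equality.\<close>

definition decomposable :: "elt list \<Rightarrow> row list \<Rightarrow> tab \<Rightarrow> bool" where
  "decomposable es ps t = pairwise_separated es (congs es t ps)"

subsection \<open>Leaves\<close>

fun iso_row :: "bool \<Rightarrow> elt list \<Rightarrow> tab \<Rightarrow> tab \<Rightarrow> row \<Rightarrow> elt \<Rightarrow> bool" where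
  "iso_row False ys t s p x = False"
| "iso_row True [] t s p x = True"
| "iso_row True (y # ys) t s p x = iso_row (same (at p (mt t x y)) (mt s (at p x) (at p y))) ys t s p x"

fun iso_by :: "bool \<Rightarrow> elt list \<Rightarrow> elt list \<Rightarrow> tab \<Rightarrow> tab \<Rightarrow> row \<Rightarrow> bool" where
  "iso_by False xs es t s p = False"
| "iso_by True [] es t s p = True"
| "iso_by True (x # xs) es t s p = iso_by (iso_row True es t s p x) xs es t s p"

fun iso_any :: "bool \<Rightarrow> elt list \<Rightarrow> tab \<Rightarrow> tab list \<Rightarrow> row \<Rightarrow> bool" where
  "iso_any True es t ss p = True"
| "iso_any False es t [] p = False"
| "iso_any False es t (s # ss) p = iso_any (iso_by True es es t s p) es t ss p"

fun iso_some :: "bool \<Rightarrow> elt list \<Rightarrow> tab \<Rightarrow> tab list \<Rightarrow> row list \<Rightarrow> bool" where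
  "iso_some True es t ss ps = True"
| "iso_some False es t ss [] = False"
| "iso_some False es t ss (p # ps) = iso_some (iso_any False es t ss p) es t ss ps"

fun triple_zero3 :: "elt list \<Rightarrow> tab \<Rightarrow> elt \<Rightarrow> elt \<Rightarrow> bool" where
  "triple_zero3 [] t x y = True"
| "triple_zero3 (z # zs) t x y = (if same (mt t (mt t x y) z) E0 then triple_zero3 zs t x y else False)"

fun triple_zero2 :: "elt list \<Rightarrow> elt list \<Rightarrow> tab \<Rightarrow> elt \<Rightarrow> bool" where
  "triple_zero2 [] es t x = True"
| "triple_zero2 (y # ys) es t x = (if triple_zero3 es t x y then triple_zero2 ys es t x else False)"

fun triple_zero :: "elt list \<Rightarrow> elt list \<Rightarrow> tab \<Rightarrow> bool" where
  "triple_zero [] es t = True"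
| "triple_zero (x # xs) es t = (if triple_zero2 es es t x then triple_zero xs es t else False)"

subsection \<open>Candidates and pruning\<close>

text \<open>
  Elements are compared by their products with \<open>E1\<close> and by their squares. Requiring the remaining
  elements to be sorted removes most of the symmetry of the labelling.
\<close>

fun kind :: "elt \<Rightarrow> elt \<Rightarrow> elt" where
  "kind EU x = EU"
| "kind E0 x = E0"
| "kind E1 x = E1"
| "kind v x = (if same v x then E2 else E3)"

text \<open>Three-way comparison written as a multiplication table, so that \<open>mt\<close>
  evaluates it: \<open>E2\<close> means greater, \<open>E1\<close> equal, \<open>E0\<close> less,
  and \<open>EU\<close> that an argument is still unknown.\<close>

definition cmp :: "elt \<Rightarrow> elt \<Rightarrow> elt" where
  "cmp x y = mt (Tab (Row E1 E0 E0 E0 EU) (Row E2 E1 E0 E0 EU) (Row E2 E2 E1 E0 EU) (Row E2 E2 E2 E1 EU)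
    (Row EU EU EU EU EU)) x y"

fun key3 :: "elt \<Rightarrow> tab \<Rightarrow> elt \<Rightarrow> elt \<Rightarrow> bool" where
  "key3 E2 t x y = True"
| "key3 E1 t x y = same (cmp (kind (mt t x x) x) (kind (mt t y y) y)) E2"
| "key3 c t x y = False"

fun key2 :: "elt \<Rightarrow> tab \<Rightarrow> elt \<Rightarrow> elt \<Rightarrow> bool" where
  "key2 E2 t x y = True"
| "key2 E1 t x y = key3 (cmp (kind (mt t x E1) x) (kind (mt t y E1) y)) t x y"
| "key2 c t x y = False"

definition key_greater :: "tab \<Rightarrow> elt \<Rightarrow> elt \<Rightarrow> bool" where
  "key_greater t x y = key2 (cmp (kind (mt t E1 x) x) (kind (mt t E1 y) y)) t x y"

fun unsorted :: "bool \<Rightarrow> elt \<Rightarrow> elt list \<Rightarrow> tab \<Rightarrow> bool" where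
  "unsorted True x ys t = True"
| "unsorted False x [] t = False"
| "unsorted False x (y # ys) t = unsorted (key_greater t x y) y ys t"

subsection \<open>Reductions\<close>

text \<open>An implication rather than a bare conclusion: in this form it passes from a quotient
  generating the same pseudovariety back to \<open>S\<close>, with irreducibility carried
  along.\<close>

definition good :: "'a sg \<Rightarrow> bool" where
  "good S \<longleftrightarrow> (join_irreducible (gen_pv S) \<longrightarrow> (\<exists>X\<in>set the_list. gen_pv S = gen_pv X))"

lemma good_iso: "is_fsemigroup S \<Longrightarrow> sg_iso S T \<Longrightarrow> good S \<longleftrightarrow> good T"
  using gen_pv_iso[of S T] by (simp add: good_def)

lemma gen_pv_quotient:
  assumes "is_fsemigroup S" "is_fsemigroup Q" "sg_hom p S Q" "p ` sg_car S = sg_car Q"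
  shows "gen_pv Q \<subseteq> gen_pv S"
proof -
  have "realized_in Q (gen_pv S)"
    by (rule realized_divisor[OF pv_gen_pv realized_gen_pv assms(1), of "sg_car S" _ p])
       (use assms in \<open>auto simp: fsg_closed sg_hom_def\<close>)
  then show ?thesis using gen_pv_subset_iff pv_gen_pv by blast
qed

text \<open>A trivial semigroup satisfies the identity \<open>x = y\<close>, which fails in a
  nontrivial one. It keeps the quotients used in the induction nontrivial.\<close>

lemma card_le_if_gen_pv_le:
  assumes "is_fsemigroup S" "is_fsemigroup Q" "gen_pv S \<subseteq> gen_pv Q" "2 \<le> card (sg_car S)"
  shows "2 \<le> card (sg_car Q)"
proof (rule ccontr)
  assume "\<not> 2 \<le> card (sg_car Q)"
  then have "card (sg_car Q) \<le> Suc 0" by simp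
  then have Q: "\<And>x y. x \<in> sg_car Q \<Longrightarrow> y \<in> sg_car Q \<Longrightarrow> x = y"
    using fsg_finite[OF assms(2)] by (simp add: card_le_Suc0_iff_eq)
  have "satisfies Q [True] [False]" unfolding satisfies_def by (auto intro!: Q)
  moreover have "\<not> satisfies S [True] [False]"
  proof
    assume *: "satisfies S [True] [False]"
    have "x = y" if "x \<in> sg_car S" "y \<in> sg_car S" for x y
      using *[unfolded satisfies_def, rule_format, of "\<lambda>b. if b then x else y"] that by auto
    then have "card (sg_car S) \<le> Suc 0"
      using fsg_finite[OF assms(1)] by (simp add: card_le_Suc0_iff_eq)
    then show False using assms(4) by simp
  qed
  ultimately show False using not_below_by_identity[OF assms(1,2)] assms(3) by blast
qed

text \<open>\<open>S\<close> lies in the join of its quotients, hence below one of them, and then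
  both generate the same pseudovariety; that quotient is smaller. Quotients are placed on
  representatives inside \<open>elt\<close>, so the induction stays within one type.\<close>

lemma good_subdirect:
  fixes S :: "elt sg" and ps :: "(elt \<Rightarrow> elt) list"
  assumes S: "is_fsemigroup S" "2 \<le> card (sg_car S)"
    and IH: "\<And>Q :: elt sg. is_fsemigroup Q \<Longrightarrow> 2 \<le> card (sg_car Q) \<Longrightarrow> card (sg_car Q) < card (sg_car S) \<Longrightarrow> good Q"
    and ps: "\<And>p x y. p \<in> set ps \<Longrightarrow> x \<in> sg_car S \<Longrightarrow> y \<in> sg_car S \<Longrightarrow> p (sg_mult S x y) = p (sg_mult S (p x) (p y))"
      "\<And>p x. p \<in> set ps \<Longrightarrow> x \<in> sg_car S \<Longrightarrow> p x \<in> sg_car S"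
      "\<And>p. p \<in> set ps \<Longrightarrow> \<not> inj_on p (sg_car S)"
    and sep: "\<And>x y. x \<in> sg_car S \<Longrightarrow> y \<in> sg_car S \<Longrightarrow> x \<noteq> y \<Longrightarrow> \<exists>p\<in>set ps. p x \<noteq> p y"
  shows "good S"
  unfolding good_def
proof
  assume ji: "join_irreducible (gen_pv S)"
  define Q where "Q = (\<lambda>p :: elt \<Rightarrow> elt. (p ` sg_car S, \<lambda>x y. p (sg_mult S x y)))"
  \<comment> \<open>The target keeps the whole carrier and need not be a semigroup; its image under
    \<open>p\<close> is \<open>Q p\<close>, which is one by \<open>fsg_hom_image\<close>.\<close>
  have hom0: "sg_hom p S (sg_car S, \<lambda>x y. p (sg_mult S x y))" if "p \<in> set ps" for p
    using ps(1,2)[OF that] by (auto simp: sg_hom_def)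
  have hom: "sg_hom p S (Q p)" if "p \<in> set ps" for p
    using ps(1,2)[OF that] by (auto simp: sg_hom_def Q_def)
  have Q: "is_fsemigroup (Q p)" if "p \<in> set ps" for p
    using fsg_hom_image[OF S(1) hom0[OF that]] by (simp add: Q_def)
  obtain x y where "x \<in> sg_car S" "y \<in> sg_car S" "x \<noteq> y"
    using S card_le_Suc0_iff_eq[OF fsg_finite[OF S(1)]] by fastforce
  with sep have ne: "ps \<noteq> []" by fastforce
  have "\<exists>T\<in>Q ` set ps. gen_pv S \<subseteq> gen_pv T"
  proof (rule join_irreducible_below[OF ji])
    fix V assume V: "pseudovariety V" and r: "\<And>T. T \<in> Q ` set ps \<Longrightarrow> realized_in T V"
    let ?hs = "map (\<lambda>p. (Q p, p)) ps"
    show "realized_in S V"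
    proof (rule realized_by_separation[OF V, of ?hs S S id])
      fix T h assume "(T, h) \<in> set ?hs"
      then have "h \<in> set ps" "T = Q h" by auto
      then show "is_fsemigroup T \<and> realized_in T V \<and> sg_hom h S T" using Q hom r by simp
    next
      fix u v assume uv: "u \<in> sg_car S" "v \<in> sg_car S" and eq: "\<And>T h. (T, h) \<in> set ?hs \<Longrightarrow> h u = h v"
      have "p u = p v" if "p \<in> set ps" for p by (rule eq[of "Q p"]) (use that in simp)
      then show "id u = id v" using sep uv by fastforce
    qed (use ne S(1) in \<open>auto simp: fsg_closed sg_hom_def\<close>)
  qed
  then obtain p where p: "p \<in> set ps" "gen_pv S \<subseteq> gen_pv (Q p)" by auto
  have eq: "gen_pv S = gen_pv (Q p)"
    using p(2) gen_pv_quotient[OF S(1) Q[OF p(1)] hom[OF p(1)]] by (auto simp: Q_def)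
  have "card (p ` sg_car S) < card (sg_car S)"
    using ps(3)[OF p(1)] fsg_finite[OF S(1)]
    by (metis card_image_le eq_card_imp_inj_on le_neq_implies_less)
  moreover have "2 \<le> card (sg_car (Q p))"
    using card_le_if_gen_pv_le[OF S(1) Q[OF p(1)] p(2) S(2)] .
  ultimately have "good (Q p)" using IH[OF Q[OF p(1)]] by (simp add: Q_def)
  then show "\<exists>X\<in>set the_list. gen_pv S = gen_pv X" using ji eq by (simp add: good_def)
qed

text \<open>The same reduction for congruences given as relations, which are first turned into maps
  to representatives.\<close>

lemma good_congruences:
  fixes S :: "elt sg"
  assumes S: "is_fsemigroup S" "2 \<le> card (sg_car S)"
    and IH: "\<And>Q :: elt sg. is_fsemigroup Q \<Longrightarrow> 2 \<le> card (sg_car Q) \<Longrightarrow> card (sg_car Q) < card (sg_car S) \<Longrightarrow> good Q"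
    and rs: "\<And>r. r \<in> set rs \<Longrightarrow> equiv (sg_car S) r"
      "\<And>r x y z. r \<in> set rs \<Longrightarrow> (x,
        y) \<in> r \<Longrightarrow> z \<in> sg_car S \<Longrightarrow>
        (sg_mult S x z, sg_mult S y z) \<in> r \<and> (sg_mult S z x, sg_mult S z y) \<in> r"
      "\<And>r. r \<in> set rs \<Longrightarrow> \<exists>(x, y)\<in>r. x \<noteq> y"
    and sep: "\<And>x y. x \<in> sg_car S \<Longrightarrow> y \<in> sg_car S \<Longrightarrow> (\<And>r. r \<in> set rs \<Longrightarrow> (x, y) \<in> r) \<Longrightarrow> x = y"
  shows "good S"
proof -
  \<comment> \<open>Related elements define the same predicate under \<open>SOME\<close>, so the
    choice depends on the class only.\<close>
  define c where "c = (\<lambda>r (x :: elt). SOME y :: elt. (x, y) \<in> r)"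
  have c: "(x, c r x) \<in> r" if "r \<in> set rs" "x \<in> sg_car S" for r x
    unfolding c_def using rs(1)[OF that(1)] that(2) by (metis someI equiv_class_self Image_singleton_iff)
  have sub: "r \<subseteq> sg_car S \<times> sg_car S" if "r \<in> set rs" for r
    using rs(1)[OF that] by (simp add: equiv_def refl_on_def)
  have c_car: "c r x \<in> sg_car S" if "r \<in> set rs" "x \<in> sg_car S" for r x
    using c[OF that] sub[OF that(1)] by auto
  have c_eq: "c r x = c r y \<longleftrightarrow> (x, y) \<in> r" if "r \<in> set rs" "x \<in> sg_car S" "y \<in> sg_car S" for r x y
  proof
    assume "c r x = c r y"
    then have "(x, c r x) \<in> r" "(y, c r x) \<in> r" using c that by metis+
    then show "(x, y) \<in> r" using rs(1)[OF that(1)] by (meson equiv_def symD transD)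
  next
    assume "(x, y) \<in> r"
    then have "(x, z) \<in> r \<longleftrightarrow> (y, z) \<in> r" for z
      using rs(1)[OF that(1)] by (meson equiv_def symD transD)
    then show "c r x = c r y" by (simp add: c_def)
  qed
  show ?thesis
  proof (rule good_subdirect[OF S, of "map c rs"])
    fix p x y assume p: "p \<in> set (map c rs)" and x: "x \<in> sg_car S" and y: "y \<in> sg_car S"
    then obtain r where r: "r \<in> set rs" "p = c r" by auto
    have "(sg_mult S x y, sg_mult S (p x) y) \<in> r" "(sg_mult S (p x) y, sg_mult S (p x) (p y)) \<in> r"
      using rs(2)[OF r(1)] c[OF r(1)] c_car[OF r(1)] x y r(2) by blast+
    then have "(sg_mult S x y, sg_mult S (p x) (p y)) \<in> r"
      using rs(1)[OF r(1)] by (meson equiv_def transD)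
    then show "p (sg_mult S x y) = p (sg_mult S (p x) (p y))"
      using c_eq[OF r(1)] x y c_car[OF r(1)] r(2) fsg_closed[OF S(1)] by simp
  next
    fix p assume "p \<in> set (map c rs)"
    then obtain r where r: "r \<in> set rs" "p = c r" by auto
    obtain x y where "(x, y) \<in> r" "x \<noteq> y" using rs(3)[OF r(1)] by auto
    then show "\<not> inj_on p (sg_car S)"
      using sub[OF r(1)] c_eq[OF r(1)] r(2) by (auto simp: inj_on_def)
  next
    fix x y assume xy: "x \<in> sg_car S" "y \<in> sg_car S" "x \<noteq> y"
    then obtain r where "r \<in> set rs" "(x, y) \<notin> r" using sep by blast
    then show "\<exists>p\<in>set (map c rs). p x \<noteq> p y" using c_eq xy by auto
  qed (use IH c_car in auto)
qed

text \<open>\<open>S\<close> is a quotient of the free semigroup on its own elements. It is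
  therefore enough that words not separated by any assignment into the \<open>Ts\<close> have the
  same value in \<open>S\<close>.\<close>

lemma realized_by_words:
  fixes S :: "'a sg" and Ts :: "'b sg list"
  assumes V: "pseudovariety V" and S: "is_fsemigroup S" and "Ts \<noteq> []"
    and Ts: "\<And>T. T \<in> set Ts \<Longrightarrow> is_fsemigroup T \<and> realized_in T V"
    and sep: "\<And>u v. u \<noteq> [] \<Longrightarrow> v \<noteq> [] \<Longrightarrow> set u \<subseteq> sg_car S \<Longrightarrow> set v \<subseteq> sg_car S \<Longrightarrow>
      (\<And>T b. T \<in> set Ts \<Longrightarrow> b ` sg_car S \<subseteq> sg_car T \<Longrightarrow> ev T b u = ev T b v) \<Longrightarrow> ev S id u = ev S id v"
  shows "realized_in S V"
proof -
  \<comment> \<open>Assignments are normalised to \<open>undefined\<close> off the carrier, so that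
    only finitely many have to be combined.\<close>
  define B where "B = (\<lambda>T :: 'b sg. {b. \<forall>x. (x \<in> sg_car S \<longrightarrow> b x \<in> sg_car T) \<and> (x \<notin> sg_car S \<longrightarrow> b x = undefined)})"
  have "finite (Sigma (set Ts) B)"
    unfolding B_def by (intro finite_SigmaI finite_set_of_finite_funs fsg_finite S finite_set) (simp add: Ts)
  then obtain l where l: "set l = Sigma (set Ts) B" using finite_list by blast
  obtain T0 where T0: "T0 \<in> set Ts" using \<open>Ts \<noteq> []\<close> by (cases Ts) auto
  then obtain t0 where "t0 \<in> sg_car T0" using Ts fsg_nonempty by blast
  then have "(T0, \<lambda>x. if x \<in> sg_car S then t0 else undefined) \<in> set l" using T0 l by (auto simp: B_def)
  then have ne: "l \<noteq> []" by auto
  let ?G = "({w. w \<noteq> [] \<and> set w \<subseteq> sg_car S}, (@))"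
  show ?thesis
  proof (rule realized_by_separation[OF V, of "map (\<lambda>(T, b). (T, ev T b)) l" ?G S "ev S id"])
    fix T h assume "(T, h) \<in> set (map (\<lambda>(T, b). (T, ev T b)) l)"
    then obtain b where b: "T \<in> set Ts" "h = ev T b" "\<And>x. x \<in> sg_car S \<Longrightarrow> b x \<in> sg_car T"
      using l by (auto simp: B_def)
    have T: "is_fsemigroup T" using Ts[OF b(1)] by simp
    have "b ` set w \<subseteq> sg_car T" if "set w \<subseteq> sg_car S" for w using b(3) that by auto
    then show "is_fsemigroup T \<and> realized_in T V \<and> sg_hom h ?G T"
      using Ts[OF b(1)] b(2) by (auto simp: sg_hom_def ev_car[OF T] ev_append[OF T])
  next
    show "sg_hom (ev S id) ?G S"
      by (auto simp: sg_hom_def ev_car[OF S] ev_append[OF S])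
    have "x \<in> ev S id ` sg_car ?G" if "x \<in> sg_car S" for x
      by (rule image_eqI[of _ _ "[x]"]) (use that in auto)
    moreover have "ev S id ` sg_car ?G \<subseteq> sg_car S" by (auto simp: ev_car[OF S])
    ultimately show "ev S id ` sg_car ?G = sg_car S" by blast
  next
    fix u v assume u: "u \<in> sg_car ?G" and v: "v \<in> sg_car ?G"
      and eq: "\<And>T h. (T, h) \<in> set (map (\<lambda>(T, b). (T, ev T b)) l) \<Longrightarrow> h u = h v"
    show "ev S id u = ev S id v"
    proof (rule sep)
      fix T b assume T: "T \<in> set Ts" and b: "b ` sg_car S \<subseteq> sg_car T"
      let ?b = "\<lambda>x. if x \<in> sg_car S then b x else undefined"
      have "(T, ?b) \<in> set l" using T b l by (auto simp: B_def)
      then have "(T, ev T ?b) \<in> set (map (\<lambda>(T, b). (T, ev T b)) l)" by force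
      then have "ev T ?b u = ev T ?b v" by (rule eq)
      moreover have "ev T ?b u = ev T b u" "ev T ?b v = ev T b v"
        using u v by (auto intro!: ev_cong)
      ultimately show "ev T b u = ev T b v" by simp
    qed (use u v in auto)
  qed (use S ne in auto)
qed

subsection \<open>Semigroups in which all triple products coincide\<close>

lemma fsg_Nn: "1 \<le> n \<Longrightarrow> is_fsemigroup (Nn n)"
  by (auto simp: is_fsemigroup_def Nn_def)

lemma fsg_R2: "is_fsemigroup R2"
  by (auto simp: is_fsemigroup_def R2_def)

lemma ev_R2: "w \<noteq> [] \<Longrightarrow> ev R2 b w = b (last w)"
  by (induction w rule: rev_nonempty_induct) (auto simp: ev_snoc, simp add: R2_def)

lemma ev_Nn: "w \<noteq> [] \<Longrightarrow> \<forall>x\<in>set w. b x \<le> n \<Longrightarrow> ev (Nn n) b w = min (sum_list (map b w)) n"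
  by (induction w rule: rev_nonempty_induct) (auto simp: ev_snoc, auto simp: Nn_def)

text \<open>Here \<open>2\<close> stands for \<open>f\<close> and \<open>1\<close> for
  \<open>fe\<close>. It is also the subsemigroup of \<open>l3bar\<close> on
  \<open>0, 1, 2\<close>.\<close>

definition l3 :: "nat sg" where
  "l3 = ({0, 1, 2}, \<lambda>x y. if x = 2 then y else 0)"

lemma fsg_l3: "is_fsemigroup l3"
  by (auto simp: is_fsemigroup_def l3_def)

lemma fsg_op: "is_fsemigroup S \<Longrightarrow> is_fsemigroup (sg_op S)"
  by (auto simp: is_fsemigroup_def sg_op_def)

lemma ev_op:
  assumes "is_fsemigroup S" "w \<noteq> []" "b ` set w \<subseteq> sg_car S"
  shows "ev (sg_op S) b w = ev S b (rev w)"
  using assms(2,3)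
proof (induction w rule: rev_nonempty_induct)
  case (snoc x w)
  have "ev S b ([x] @ rev w) = sg_mult S (ev S b [x]) (ev S b (rev w))"
    using assms(1) snoc by (intro ev_append) auto
  then show ?case using snoc by (simp add: ev_snoc sg_op_def)
qed simp

text \<open>\<open>2\<close> is a left identity, and every other element annihilates whatever
  follows it.\<close>

lemma ev_l3: "w \<noteq> [] \<Longrightarrow> ev l3 b w = (if \<forall>x\<in>set (butlast w). b x = 2 then b (last w) else 0)"
  by (induction w rule: rev_nonempty_induct)
     (auto simp: ev_snoc, auto simp: l3_def butlast_append in_set_butlast_appendI
        dest: in_set_butlastD split: if_splits, metis append_butlast_last_id in_set_conv_decomp insertE
        rotate1.simps(2) set_ConsD set_append set_rotate1 Un_iff list.set(1,2))

lemma gen_pv_below_divisor: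
  assumes "is_fsemigroup S" "is_fsemigroup T" "D \<subseteq> sg_car S"
    and "\<And>x y. x \<in> D \<Longrightarrow> y \<in> D \<Longrightarrow> sg_mult S x y \<in> D"
    and "sg_hom g (D, sg_mult S) T" "g ` D = sg_car T"
  shows "gen_pv T \<subseteq> gen_pv S"
  using realized_divisor[OF pv_gen_pv realized_gen_pv assms(1,3,4,2,5,6)] gen_pv_subset_iff pv_gen_pv by blast

lemma car_Nn [simp]: "sg_car (Nn n) = {1..n}" and car_R2 [simp]: "sg_car R2 = {0, 1}"
  by (simp_all add: Nn_def R2_def)

definition l3_map :: "('x \<Rightarrow> bool) \<Rightarrow> ('x \<Rightarrow> bool) \<Rightarrow> 'x \<Rightarrow> nat" where
  "l3_map P Q w = (if P w then 2 else if Q w then 1 else 0)"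

text \<open>Words of length at least three have value \<open>z\<close>, so the identities of the
  factors only have to pin down nonzero words of length one and two. The three cases end
  differently: with a nonzero square the result is \<open>Nn 3\<close>; with zero squares and a
  nonzero product irreducibility is contradicted; with zero multiplication the result is
  \<open>Nn 2\<close>.\<close>

lemma good_triple_zero:
  fixes S :: "'a sg"
  assumes S: "is_fsemigroup S" "2 \<le> card (sg_car S)"
    and z: "\<And>x y w. x \<in> sg_car S \<Longrightarrow> y \<in> sg_car S \<Longrightarrow> w \<in> sg_car S \<Longrightarrow> sg_mult S (sg_mult S x y) w = z"
  shows "good S"
  unfolding good_def
proof
  assume ji: "join_irreducible (gen_pv S)"
  note closed = fsg_closed[OF S(1)] and assoc = fsg_assoc[OF S(1)]
  obtain a b where ab: "a \<in> sg_car S" "b \<in> sg_car S" "a \<noteq> b"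
    using S card_le_Suc0_iff_eq[OF fsg_finite[OF S(1)]] by fastforce
  have zS: "z \<in> sg_car S" using z[OF ab(1,1,1)] closed ab(1) by metis
  have zz: "sg_mult S x z = z \<and> sg_mult S z x = z" if "x \<in> sg_car S" for x
  proof -
    have "sg_mult S z x = sg_mult S (sg_mult S (sg_mult S x x) x) x" using z[OF that that that] by simp
    also have "\<dots> = z" using z[of "sg_mult S x x" x x] closed that by simp
    finally have 1: "sg_mult S z x = z" .
    have "sg_mult S x z = sg_mult S x (sg_mult S (sg_mult S x x) x)" using z[OF that that that] by simp
    also have "\<dots> = sg_mult S (sg_mult S x (sg_mult S x x)) x" using assoc closed that by simp
    also have "\<dots> = z" using z[of x "sg_mult S x x" x] closed that by simp
    finally show ?thesis using 1 by simp
  qed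
  have long: "ev S id w = z" if w: "set w \<subseteq> sg_car S" "3 \<le> length w" for w
  proof -
    obtain x y r where r: "w = [x, y] @ r" "r \<noteq> []"
      using w(2) by (metis append_Cons append_Nil length_Cons list.exhaust list.size(3) not_less_eq_eq
          numeral_3_eq_3 One_nat_def Suc_le_mono le0 le_zero_eq nat.simps(3))
    then have "ev S id w = sg_mult S (ev S id [x, y]) (ev S id r)"
      using w(1) ev_append[OF S(1), of "[x, y]" r id] by auto
    moreover have "ev S id [x, y] = sg_mult S x y" by (simp add: ev_def)
    moreover have "ev S id r \<in> sg_car S" using r w(1) by (intro ev_car[OF S(1)]) auto
    ultimately show ?thesis using z r w(1) by simp
  qed
  have short: "(\<exists>x. w = [x]) \<or> (\<exists>x y. w = [x, y] \<and> ev S id w = sg_mult S x y)"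
    if "w \<noteq> []" "set w \<subseteq> sg_car S" "ev S id w \<noteq> z" for w
  proof -
    have "length w < 3" using long that by (meson not_le)
    then show ?thesis using that(1)
      by (cases w rule: remdups_adj.cases) (auto simp: ev_def)
  qed
  consider (A) x where "x \<in> sg_car S" "sg_mult S x x \<noteq> z"
    | (B) x y where "\<forall>x\<in>sg_car S. sg_mult S x x = z" "x \<in> sg_car S" "y \<in> sg_car S" "sg_mult S x y \<noteq> z"
    | (C) "\<forall>x\<in>sg_car S. \<forall>y\<in>sg_car S. sg_mult S x y = z"
    by blast
  then show "\<exists>X\<in>set the_list. gen_pv S = gen_pv X"
  proof cases
    case A
    let ?m = "sg_mult S"
    have ne: "x \<noteq> ?m x x" using z[OF A(1,1,1)] A by metis
    have nz: "x \<noteq> z" using zz A by metis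
    have "\<exists>T\<in>{R2, Nn 3}. gen_pv S \<subseteq> gen_pv T"
    proof (rule join_irreducible_below[OF ji])
      fix V assume V: "pseudovariety V" and r: "\<And>T :: nat sg. T \<in> {R2, Nn 3} \<Longrightarrow> realized_in T V"
      \<comment> \<open>A word of nonzero value is separated from every other word.
        \<open>Nn 3\<close> detects the length up to three and the letters, \<open>R2\<close> the
        last letter.\<close>
      have agree: "u = v"
        if uv: "u \<noteq> []" "v \<noteq> []" "set u \<subseteq> sg_car S" "set v \<subseteq> sg_car S" and nz: "ev S id u \<noteq> z"
          and eq: "\<And>(T :: nat sg) b. T \<in> set [R2, Nn 3] \<Longrightarrow> b ` sg_car S \<subseteq> sg_car T \<Longrightarrow> ev T b u = ev T b v" for u v
      proof -
        \<comment> \<open>Letters in \<open>P\<close> get weight one and all others weight two. A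
          sum of two then forces two letters from \<open>P\<close> or one letter outside it.\<close>
        have N: "min (sum_list (map (\<lambda>w. if P w then 1 else 2) u)) (3 :: nat) = min (sum_list (map (\<lambda>w. if P w then 1 else 2) v)) 3" for P
          using eq[of "Nn 3" "\<lambda>w. if P w then 1 else 2"] uv by (simp add: ev_Nn image_subset_iff)
        have l: "last v = last u"
          using eq[of R2 "\<lambda>w. if w = last u then 1 else 0"] uv
          by (simp add: ev_R2 image_subset_iff split: if_splits)
        have len: "length u = length v \<or> (3 \<le> length u \<and> 3 \<le> length v)"
          using N[of "\<lambda>_. True"] by (auto simp: sum_list_triv min_def split: if_splits)
        from short[OF uv(1,3) nz] show ?thesis
        proof (elim disjE exE conjE)
          fix x assume u: "u = [x]"
          then obtain y where "v = [y]" using len by (cases v) auto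
          then show ?thesis using l u by simp
        next
          fix x y assume u: "u = [x, y]"
          then obtain x' y' where v: "v = [x', y']" using len by (cases v; cases "tl v") (auto simp: length_Suc_conv)
          have y: "y' = y" using l u v by simp
          have "x' = x \<or> x' = y" using N[of "\<lambda>w. w = x \<or> w = y"] u v y by (auto split: if_splits)
          moreover have "x = y" if "x' = y"
            using N[of "\<lambda>w. w = y"] u v y that by (auto split: if_splits)
          ultimately show ?thesis using u v y by blast
        qed
      qed
      show "realized_in S V"
      proof (rule realized_by_words[OF V S(1), of "[R2, Nn 3]"])
        show "is_fsemigroup T \<and> realized_in T V" if "T \<in> set [R2, Nn 3]" for T :: "nat sg"
          using that r fsg_R2 fsg_Nn[of 3] by auto
        fix u v assume uv: "u \<noteq> []" "v \<noteq> []" "set u \<subseteq> sg_car S" "set v \<subseteq> sg_car S"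
          and eq: "\<And>(T :: nat sg) b. T \<in> set [R2, Nn 3] \<Longrightarrow> b ` sg_car S \<subseteq> sg_car T \<Longrightarrow> ev T b u = ev T b v"
        show "ev S id u = ev S id v"
        proof (cases "ev S id u = z")
          case True
          show ?thesis
          proof (rule ccontr)
            assume "ev S id u \<noteq> ev S id v"
            then have "v = u" using agree[OF uv(2,1,4,3)] eq True by metis
            then show False using \<open>ev S id u \<noteq> ev S id v\<close> by simp
          qed
        next
          case False
          then have "u = v" using agree[OF uv] eq by metis
          then show ?thesis by simp
        qed
      qed simp
    qed
    \<comment> \<open>\<open>R2\<close> is idempotent, whereas \<open>x\<close> differs from its
      square.\<close>
    moreover have "\<not> gen_pv S \<subseteq> gen_pv R2"
    proof (rule not_below_by_identity[OF S(1) fsg_R2, of "[True, True]" "[True]"])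
      show "\<not> satisfies S [True, True] [True]"
        using ne A(1) by (auto simp: satisfies_def ev_def intro!: exI[of _ "\<lambda>_. x"])
    qed (auto simp: satisfies_def ev_R2)
    ultimately have le: "gen_pv S \<subseteq> gen_pv (Nn 3)" by auto
    have x: "?m x (?m x x) = z" "?m (?m x x) x = z" "?m (?m x x) (?m x x) = z"
      using z A(1) assoc closed by metis+
    have "gen_pv (Nn 3) \<subseteq> gen_pv S"
    proof (rule gen_pv_below_divisor[OF S(1) fsg_Nn])
      let ?g = "\<lambda>y. if y = x then 1 else if y = z then 3 else 2 :: nat"
      show "{x, ?m x x, z} \<subseteq> sg_car S" using A(1) zS closed by auto
      show "?m u v \<in> {x, ?m x x, z}" if "u \<in> {x, ?m x x, z}" "v \<in> {x, ?m x x, z}" for u v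
        using that x zz A(1) zS closed by auto
      show "sg_hom ?g ({x, ?m x x, z}, ?m) (Nn 3)"
        using x zz A zS closed ne nz by (auto simp: sg_hom_def Nn_def)
      show "?g ` {x, ?m x x, z} = sg_car (Nn 3)" using ne nz A(2) by (auto simp: Nn_def)
    qed simp
    with le show ?thesis by (auto simp: the_list_def)
  next
    case B
    have "\<exists>T\<in>{l3, sg_op l3}. gen_pv S \<subseteq> gen_pv T"
    proof (rule join_irreducible_below[OF ji])
      fix V assume V: "pseudovariety V" and r: "\<And>T :: nat sg. T \<in> {l3, sg_op l3} \<Longrightarrow> realized_in T V"
      have agree: "u = v"
        if uv: "u \<noteq> []" "v \<noteq> []" "set u \<subseteq> sg_car S" "set v \<subseteq> sg_car S" and nz: "ev S id u \<noteq> z"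
          and eq: "\<And>(T :: nat sg) b. T \<in> set [l3, sg_op l3] \<Longrightarrow> b ` sg_car S \<subseteq> sg_car T \<Longrightarrow> ev T b u = ev T b v" for u v
      proof -
        have car: "sg_car l3 = {0, 1, 2}" "sg_car (sg_op l3) = {0, 1, 2}" by (simp_all add: l3_def sg_op_def)
        have L: "ev l3 (l3_map P Q) u = ev l3 (l3_map P Q) v" "ev l3 (l3_map P Q) (rev u) = ev l3 (l3_map P Q) (rev v)" for P Q
          using eq[of l3 "l3_map P Q"] eq[of "sg_op l3" "l3_map P Q"] uv
            ev_op[OF fsg_l3, of u "l3_map P Q"] ev_op[OF fsg_l3, of v "l3_map P Q"]
          by (auto simp: car image_subset_iff l3_map_def)
        from short[OF uv(1,3) nz] show ?thesis
        proof (elim disjE exE conjE)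
          fix x assume u: "u = [x]"
          have *: "ev l3 (l3_map (\<lambda>_. False) (\<lambda>w. w = x)) v = 1"
            using L(1)[of "\<lambda>_. False" "\<lambda>w. w = x"] u by (auto simp: l3_map_def)
          then have "butlast v = []" "last v = x" using uv(2) by (auto simp: ev_l3 l3_map_def split: if_splits)
          then show ?thesis using u uv(2) by (metis append_butlast_last_id append_Nil)
        next
          fix x y assume u: "u = [x, y]" and "ev S id u = sg_mult S x y"
          then have xy: "x \<noteq> y" using nz B(1) uv(3) by auto
          \<comment> \<open>With \<open>x\<close> sent to \<open>f\<close> and \<open>y\<close> to
            \<open>fe\<close>, exactly the words consisting of some \<open>x\<close> followed by one
            final \<open>y\<close> have value \<open>fe\<close>. The dual assignment yields one
            \<open>x\<close> followed by some \<open>y\<close>, and only \<open>xy\<close> is of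
            both kinds.\<close>
          have "ev l3 (l3_map (\<lambda>w. w = x) (\<lambda>w. w = y)) v = 1"
            using L(1)[of "\<lambda>w. w = x" "\<lambda>w. w = y"] u xy by (auto simp: ev_l3 l3_map_def)
          then have 1: "last v = y" "set (butlast v) \<subseteq> {x}"
            using uv(2) xy by (auto simp: ev_l3 l3_map_def split: if_splits)
          have "ev l3 (l3_map (\<lambda>w. w = y) (\<lambda>w. w = x)) (rev v) = 1"
            using L(2)[of "\<lambda>w. w = y" "\<lambda>w. w = x"] u xy by (auto simp: ev_l3 l3_map_def)
          then have 2: "hd v = x" "set (tl v) \<subseteq> {y}"
            using uv(2) xy by (auto simp: ev_l3 l3_map_def last_rev split: if_splits)
          obtain v' where v': "v = x # v'" using 2(1) uv(2) by (cases v) auto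
          then obtain v'' where v'': "v' = v'' @ [y]" using 1(1) xy by (cases v' rule: rev_cases) auto
          then have "v'' = []" using 1(2) 2(2) v' xy by (cases v'') auto
          then show ?thesis using u v' v'' by simp
        qed
      qed
      show "realized_in S V"
      proof (rule realized_by_words[OF V S(1), of "[l3, sg_op l3]"])
        show "is_fsemigroup T \<and> realized_in T V" if "T \<in> set [l3, sg_op l3]" for T :: "nat sg"
          using that r fsg_l3 fsg_op[OF fsg_l3] by auto
        fix u v assume uv: "u \<noteq> []" "v \<noteq> []" "set u \<subseteq> sg_car S" "set v \<subseteq> sg_car S"
          and eq: "\<And>(T :: nat sg) b. T \<in> set [l3, sg_op l3] \<Longrightarrow> b ` sg_car S \<subseteq> sg_car T \<Longrightarrow> ev T b u = ev T b v"
        show "ev S id u = ev S id v"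
        proof (cases "ev S id u = z")
          case True
          show ?thesis
          proof (rule ccontr)
            assume "ev S id u \<noteq> ev S id v"
            then have "v = u" using agree[OF uv(2,1,4,3)] eq True by metis
            then show False using \<open>ev S id u \<noteq> ev S id v\<close> by simp
          qed
        next
          case False
          then have "u = v" using agree[OF uv] eq by metis
          then show ?thesis by simp
        qed
      qed simp
    qed
    moreover have "\<not> gen_pv S \<subseteq> gen_pv l3"
    \<comment> \<open>Repeating the first letter does not matter in \<open>l3\<close>; in
      \<open>S\<close> it turns a nonzero product of two elements into a product of three, which is
      \<open>z\<close>. The dual of \<open>l3\<close> is excluded by repeating the second
      letter.\<close>
    proof (rule not_below_by_identity[OF S(1) fsg_l3, of "[True, True, False]" "[True, False]"])
      have "sg_mult S (sg_mult S x x) y \<noteq> sg_mult S x y" using z B(2-4) by metis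
      then show "\<not> satisfies S [True, True, False] [True, False]"
        using B(2,3) by (auto simp: satisfies_def ev_def intro!: exI[of _ "\<lambda>b. if b then x else y"])
    qed (auto simp: satisfies_def ev_l3)
    moreover have "\<not> gen_pv S \<subseteq> gen_pv (sg_op l3)"
    proof (rule not_below_by_identity[OF S(1) fsg_op[OF fsg_l3], of "[True, False, False]" "[True, False]"])
      have "sg_mult S (sg_mult S x y) y \<noteq> sg_mult S x y" using z B(2-4) by metis
      then show "\<not> satisfies S [True, False, False] [True, False]"
        using B(2,3) by (auto simp: satisfies_def ev_def intro!: exI[of _ "\<lambda>b. if b then x else y"])
      have "ev (sg_op l3) a [True, False, False] = ev (sg_op l3) a [True, False]"
        if "range a \<subseteq> sg_car (sg_op l3)" for a
        using that by (subst (1 2) ev_op[OF fsg_l3]) (auto simp: ev_l3 sg_op_def)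
      then show "satisfies (sg_op l3) [True, False, False] [True, False]" by (simp add: satisfies_def)
    qed auto
    ultimately show ?thesis by blast
  next
    case C
    have "\<exists>T\<in>{Nn 2}. gen_pv S \<subseteq> gen_pv T"
    proof (rule join_irreducible_below[OF ji])
      fix V assume V: "pseudovariety V" and r: "\<And>T :: nat sg. T \<in> {Nn 2} \<Longrightarrow> realized_in T V"
      show "realized_in S V"
      proof (rule realized_by_words[OF V S(1), of "[Nn 2]"])
        show "is_fsemigroup T \<and> realized_in T V" if "T \<in> set [Nn 2]" for T :: "nat sg"
          using that r fsg_Nn[of 2] by auto
        fix u v assume uv: "u \<noteq> []" "v \<noteq> []" "set u \<subseteq> sg_car S" "set v \<subseteq> sg_car S"
          and eq: "\<And>(T :: nat sg) b. T \<in> set [Nn 2] \<Longrightarrow> b ` sg_car S \<subseteq> sg_car T \<Longrightarrow> ev T b u = ev T b v"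
        have N: "min (sum_list (map (\<lambda>w. if P w then 1 else 2) u)) (2 :: nat) = min (sum_list (map (\<lambda>w. if P w then 1 else 2) v)) 2" for P
          using eq[of "Nn 2" "\<lambda>w. if P w then 1 else 2"] uv by (simp add: ev_Nn image_subset_iff)
        have len: "length u = length v \<or> (2 \<le> length u \<and> 2 \<le> length v)"
          using N[of "\<lambda>_. True"] by (auto simp: sum_list_triv min_def split: if_splits)
        show "ev S id u = ev S id v"
        proof (cases "length u = 1")
          case True
          then obtain x y where x: "u = [x]" "v = [y]" using len by (cases u; cases v) auto
          have "y = x" using N[of "\<lambda>w. w = x"] x by (auto split: if_splits)
          then show ?thesis using x by simp
        next
          case False
          have "ev S id w = z" if "2 \<le> length w" "set w \<subseteq> sg_car S" for w
            using short[of w] that C by fastforce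
          moreover have "2 \<le> length u" "2 \<le> length v" using False len uv(1) by (cases u; auto)+
          ultimately show ?thesis using uv(3,4) by simp
        qed
      qed simp
    qed
    then have le: "gen_pv S \<subseteq> gen_pv (Nn 2)" by simp
    obtain x where x: "x \<in> sg_car S" "x \<noteq> z" using ab by blast
    have "gen_pv (Nn 2) \<subseteq> gen_pv S"
      by (rule gen_pv_below_divisor[OF S(1) fsg_Nn, of 2 "{x, z}" "\<lambda>y. if y = x then 1 else 2"])
         (use x zS zz C in \<open>auto simp: sg_hom_def Nn_def\<close>)
    with le show ?thesis by (auto simp: the_list_def)
  qed
qed

subsection \<open>Generators\<close>

text \<open>The factors used in certificates: the listed semigroups except \<open>Nn 2\<close>,
  which arises only in \<open>good_triple_zero\<close>, and in addition \<open>l3\<close> and its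
  dual.\<close>

datatype gen = G_Z2 | G_Z3 | G_Z4 | G_Z5 | G_Z2b | G_Z2bop | G_N3 | G_N4 | G_N5 | G_N1I | G_N2I | G_N3I | G_N4I |
  G_N2b | G_N2bop | G_N2bI | G_N2bopI | G_L2 | G_R2 | G_L2I | G_R2I | G_L2b | G_L2bop | G_A0 | G_A0I | G_A2 |
  G_B2 | G_l3b | G_l3bop | G_l3 | G_l3op

fun gen_tab :: "gen \<Rightarrow> elt list \<times> tab" where
  "gen_tab G_Z2 = ([E0, E1], Tab (Row E0 E1 EU EU EU) (Row E1 E0 EU EU EU) (Row EU EU EU EU EU) (Row EU EU EU EU EU)
    (Row EU EU EU EU EU))"
| "gen_tab G_Z3 = ([E0, E1, E2], Tab (Row E0 E1 E2 EU EU) (Row E1 E2 E0 EU EU) (Row E2 E0 E1 EU EU)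
  (Row EU EU EU EU EU) (Row EU EU EU EU EU))"
| "gen_tab G_Z4 = ([E0, E1, E2, E3], Tab (Row E0 E1 E2 E3 EU) (Row E1 E2 E3 E0 EU) (Row E2 E3 E0 E1 EU)
  (Row E3 E0 E1 E2 EU) (Row EU EU EU EU EU))"
| "gen_tab G_Z5 = ([E0, E1, E2, E3, E4], Tab (Row E0 E1 E2 E3 E4) (Row E1 E2 E3 E4 E0) (Row E2 E3 E4 E0 E1)
  (Row E3 E4 E0 E1 E2) (Row E4 E0 E1 E2 E3))"
| "gen_tab G_Z2b = ([E0, E1, E2, E3], Tab (Row E0 E1 E2 E3 EU) (Row E1 E0 E2 E3 EU) (Row E2 E3 E2 E3 EU)
  (Row E3 E2 E2 E3 EU) (Row EU EU EU EU EU))"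
| "gen_tab G_Z2bop = ([E0, E1, E2, E3], Tab (Row E0 E1 E2 E3 EU) (Row E1 E0 E3 E2 EU) (Row E2 E2 E2 E2 EU)
  (Row E3 E3 E3 E3 EU) (Row EU EU EU EU EU))"
| "gen_tab G_N3 = ([E0, E1, E2], Tab (Row E1 E2 E2 EU EU) (Row E2 E2 E2 EU EU) (Row E2 E2 E2 EU EU)
  (Row EU EU EU EU EU) (Row EU EU EU EU EU))"
| "gen_tab G_N4 = ([E0, E1, E2, E3], Tab (Row E1 E2 E3 E3 EU) (Row E2 E3 E3 E3 EU) (Row E3 E3 E3 E3 EU)
  (Row E3 E3 E3 E3 EU) (Row EU EU EU EU EU))"
| "gen_tab G_N5 = ([E0, E1, E2, E3, E4], Tab (Row E1 E2 E3 E4 E4) (Row E2 E3 E4 E4 E4) (Row E3 E4 E4 E4 E4)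
  (Row E4 E4 E4 E4 E4) (Row E4 E4 E4 E4 E4))"
| "gen_tab G_N1I = ([E0, E1], Tab (Row E0 E0 EU EU EU) (Row E0 E1 EU EU EU) (Row EU EU EU EU EU)
  (Row EU EU EU EU EU) (Row EU EU EU EU EU))"
| "gen_tab G_N2I = ([E0, E1, E2], Tab (Row E1 E1 E0 EU EU) (Row E1 E1 E1 EU EU) (Row E0 E1 E2 EU EU)
  (Row EU EU EU EU EU) (Row EU EU EU EU EU))"
| "gen_tab G_N3I = ([E0, E1, E2, E3], Tab (Row E1 E2 E2 E0 EU) (Row E2 E2 E2 E1 EU) (Row E2 E2 E2 E2 EU)
  (Row E0 E1 E2 E3 EU) (Row EU EU EU EU EU))"
| "gen_tab G_N4I = ([E0, E1, E2, E3, E4], Tab (Row E1 E2 E3 E3 E0) (Row E2 E3 E3 E3 E1) (Row E3 E3 E3 E3 E2)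
  (Row E3 E3 E3 E3 E3) (Row E0 E1 E2 E3 E4))"
| "gen_tab G_N2b = ([E0, E1, E2, E3], Tab (Row E0 E0 E2 E3 EU) (Row E0 E0 E2 E3 EU) (Row E0 E0 E2 E3 EU)
  (Row E0 E2 E2 E3 EU) (Row EU EU EU EU EU))"
| "gen_tab G_N2bop = ([E0, E1, E2, E3], Tab (Row E0 E0 E0 E0 EU) (Row E0 E0 E0 E2 EU) (Row E2 E2 E2 E2 EU)
  (Row E3 E3 E3 E3 EU) (Row EU EU EU EU EU))"
| "gen_tab G_N2bI = ([E0, E1, E2, E3, E4], Tab (Row E0 E0 E2 E3 E0) (Row E0 E0 E2 E3 E1) (Row E0 E0 E2 E3 E2)
  (Row E0 E2 E2 E3 E3) (Row E0 E1 E2 E3 E4))"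
| "gen_tab G_N2bopI = ([E0, E1, E2, E3, E4], Tab (Row E0 E0 E0 E0 E0) (Row E0 E0 E0 E2 E1) (Row E2 E2 E2 E2 E2)
  (Row E3 E3 E3 E3 E3) (Row E0 E1 E2 E3 E4))"
| "gen_tab G_L2 = ([E0, E1], Tab (Row E0 E0 EU EU EU) (Row E1 E1 EU EU EU) (Row EU EU EU EU EU) (Row EU EU EU EU EU)
  (Row EU EU EU EU EU))"
| "gen_tab G_R2 = ([E0, E1], Tab (Row E0 E1 EU EU EU) (Row E0 E1 EU EU EU) (Row EU EU EU EU EU) (Row EU EU EU EU EU)
  (Row EU EU EU EU EU))"
| "gen_tab G_L2I = ([E0, E1, E2], Tab (Row E0 E0 E0 EU EU) (Row E1 E1 E1 EU EU) (Row E0 E1 E2 EU EU)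
  (Row EU EU EU EU EU) (Row EU EU EU EU EU))"
| "gen_tab G_R2I = ([E0, E1, E2], Tab (Row E0 E1 E0 EU EU) (Row E0 E1 E1 EU EU) (Row E0 E1 E2 EU EU)
  (Row EU EU EU EU EU) (Row EU EU EU EU EU))"
| "gen_tab G_L2b = ([E0, E1, E2, E3, E4], Tab (Row E0 E0 E2 E3 E4) (Row E1 E1 E2 E3 E4) (Row E2 E2 E2 E3 E4)
  (Row E3 E3 E2 E3 E4) (Row E2 E3 E2 E3 E4))"
| "gen_tab G_L2bop = ([E0, E1, E2, E3, E4], Tab (Row E0 E1 E2 E3 E2) (Row E0 E1 E2 E3 E3) (Row E2 E2 E2 E2 E2)
  (Row E3 E3 E3 E3 E3) (Row E4 E4 E4 E4 E4))"
| "gen_tab G_A0 = ([E0, E1, E2, E3], Tab (Row E0 E0 E0 E0 EU) (Row E0 E1 E0 E0 EU) (Row E0 E3 E2 E3 EU)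
  (Row E0 E3 E0 E0 EU) (Row EU EU EU EU EU))"
| "gen_tab G_A0I = ([E0, E1, E2, E3, E4], Tab (Row E0 E0 E0 E0 E0) (Row E0 E1 E0 E0 E1) (Row E0 E3 E2 E3 E2)
  (Row E0 E3 E0 E0 E3) (Row E0 E1 E2 E3 E4))"
| "gen_tab G_A2 = ([E0, E1, E2, E3, E4], Tab (Row E0 E0 E0 E0 E0) (Row E0 E0 E3 E0 E1) (Row E0 E4 E2 E2 E4)
  (Row E0 E1 E3 E3 E1) (Row E0 E0 E2 E0 E4))"
| "gen_tab G_B2 = ([E0, E1, E2, E3, E4], Tab (Row E0 E0 E0 E0 E0) (Row E0 E0 E3 E0 E1) (Row E0 E4 E0 E2 E0)
  (Row E0 E1 E0 E3 E0) (Row E0 E0 E2 E0 E4))"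
| "gen_tab G_l3b = ([E0, E1, E2, E3, E4], Tab (Row E0 E0 E0 E3 E4) (Row E0 E0 E0 E3 E4) (Row E0 E1 E2 E3 E4)
  (Row E0 E0 E0 E3 E4) (Row E0 E3 E4 E3 E4))"
| "gen_tab G_l3bop = ([E0, E1, E2, E3, E4], Tab (Row E0 E0 E0 E0 E0) (Row E0 E0 E1 E0 E3) (Row E0 E0 E2 E0 E4)
  (Row E3 E3 E3 E3 E3) (Row E4 E4 E4 E4 E4))"
| "gen_tab G_l3 = ([E0, E1, E2], Tab (Row E0 E0 E0 EU EU) (Row E0 E0 E0 EU EU) (Row E0 E1 E2 EU EU)
  (Row EU EU EU EU EU) (Row EU EU EU EU EU))"
| "gen_tab G_l3op = ([E0, E1, E2], Tab (Row E0 E0 E0 EU EU) (Row E0 E0 E1 EU EU) (Row E0 E0 E2 EU EU)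
  (Row EU EU EU EU EU) (Row EU EU EU EU EU))"

fun gen_sg :: "gen \<Rightarrow> nat sg" where
  "gen_sg G_Z2 = Zn 2"
| "gen_sg G_Z3 = Zn 3"
| "gen_sg G_Z4 = Zn 4"
| "gen_sg G_Z5 = Zn 5"
| "gen_sg G_Z2b = Z2bar"
| "gen_sg G_Z2bop = sg_op Z2bar"
| "gen_sg G_N3 = Nn 3"
| "gen_sg G_N4 = Nn 4"
| "gen_sg G_N5 = Nn 5"
| "gen_sg G_N1I = adjI (Nn 1)"
| "gen_sg G_N2I = adjI (Nn 2)"
| "gen_sg G_N3I = adjI (Nn 3)"
| "gen_sg G_N4I = adjI (Nn 4)"
| "gen_sg G_N2b = N2bar"
| "gen_sg G_N2bop = sg_op N2bar"
| "gen_sg G_N2bI = adjI N2bar"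
| "gen_sg G_N2bopI = adjI (sg_op N2bar)"
| "gen_sg G_L2 = L2"
| "gen_sg G_R2 = R2"
| "gen_sg G_L2I = adjI L2"
| "gen_sg G_R2I = adjI R2"
| "gen_sg G_L2b = L2bar"
| "gen_sg G_L2bop = sg_op L2bar"
| "gen_sg G_A0 = A0"
| "gen_sg G_A0I = adjI A0"
| "gen_sg G_A2 = A2"
| "gen_sg G_B2 = B2"
| "gen_sg G_l3b = l3bar"
| "gen_sg G_l3bop = sg_op l3bar"
| "gen_sg G_l3 = l3"
| "gen_sg G_l3op = sg_op l3"

text \<open>The two auxiliary factors are outside the list, so a certificate has to discard them by
  an identity.\<close>

fun listed :: "gen \<Rightarrow> bool" where
  "listed G_l3 = False"
| "listed G_l3op = False"
| "listed k = True"

fun ball :: "('x \<Rightarrow> bool) \<Rightarrow> 'x list \<Rightarrow> bool" where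
  "ball f [] = True"
| "ball f (x # xs) = (if f x then ball f xs else False)"

lemma ball_iff [simp]: "ball f xs \<longleftrightarrow> (\<forall>x\<in>set xs. f x)"
  by (induction xs) auto

definition closed_pair :: "elt list \<Rightarrow> tab \<Rightarrow> elt \<Rightarrow> elt \<Rightarrow> bool" where
  "closed_pair es t x y = mem (mt t x y) es"

definition closed_row :: "elt list \<Rightarrow> tab \<Rightarrow> elt \<Rightarrow> bool" where
  "closed_row es t x = ball (closed_pair es t x) es"

definition assoc3 :: "tab \<Rightarrow> elt \<Rightarrow> elt \<Rightarrow> elt \<Rightarrow> bool" where
  "assoc3 t x y z = same (mt t (mt t x y) z) (mt t x (mt t y z))"

definition assoc2 :: "elt list \<Rightarrow> tab \<Rightarrow> elt \<Rightarrow> elt \<Rightarrow> bool" where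
  "assoc2 es t x y = ball (assoc3 t x y) es"

definition assoc1 :: "elt list \<Rightarrow> tab \<Rightarrow> elt \<Rightarrow> bool" where
  "assoc1 es t x = ball (assoc2 es t x) es"

definition fsg_check :: "elt list \<times> tab \<Rightarrow> bool" where
  "fsg_check p = (if ball (closed_row (fst p) (snd p)) (fst p) then ball (assoc1 (fst p) (snd p)) (fst p) else False)"

abbreviation tabsg :: "elt list \<times> tab \<Rightarrow> elt sg" where
  "tabsg p \<equiv> tsg (fst p) (snd p)"

lemma tsg_simps [simp]: "sg_car (tsg es t) = set es" "sg_mult (tsg es t) = mt t"
  by (simp_all add: tsg_def)

lemma fsg_check_sound: "fsg_check p \<Longrightarrow> fst p \<noteq> [] \<Longrightarrow> is_fsemigroup (tabsg p)"
  by (auto simp: fsg_check_def closed_row_def closed_pair_def assoc1_def assoc2_def assoc3_def is_fsemigroup_def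
      split: if_splits)

definition fsg_gen_check :: "gen \<Rightarrow> bool" where
  "fsg_gen_check k = fsg_check (gen_tab k)"

lemma fsg_gen: "is_fsemigroup (tabsg (gen_tab k))"
proof (rule fsg_check_sound)
  have "ball fsg_gen_check [G_Z2, G_Z3, G_Z4, G_Z5, G_Z2b, G_Z2bop, G_N3, G_N4, G_N5, G_N1I, G_N2I, G_N3I, G_N4I,
      G_N2b, G_N2bop, G_N2bI, G_N2bopI, G_L2, G_R2, G_L2I, G_R2I, G_L2b, G_L2bop, G_A0, G_A0I, G_A2, G_B2, G_l3b,
      G_l3bop, G_l3, G_l3op]"
    by code_simp
  then show "fsg_check (gen_tab k)" by (cases k) (simp_all add: fsg_gen_check_def)
  show "fst (gen_tab k) \<noteq> []" by (cases k) simp_all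
qed

fun num :: "elt \<Rightarrow> nat" where
  "num E0 = 0" | "num E1 = 1" | "num E2 = 2" | "num E3 = 3" | "num E4 = 4" | "num EU = 5"

lemma inj_num: "num x = num y \<longleftrightarrow> x = y"
  by (cases x; cases y) simp_all

lemma iso_num:
  assumes "(\<lambda>x. num x + d) ` set es = sg_car X"
    and "\<forall>x\<in>set es. \<forall>y\<in>set es. num (mt t x y) + d = sg_mult X (num x + d) (num y + d)"
  shows "sg_iso (tsg es t) X"
  unfolding sg_iso_def using assms
  by (intro exI[of _ "\<lambda>x. num x + d"]) (auto simp: sg_hom_def bij_betw_def inj_on_def inj_num)

lemma small_intervals:
  "{0..<2} = {0, 1 :: nat}" "{0..<3} = {0, 1, 2 :: nat}" "{0..<4} = {0, 1, 2, 3 :: nat}" "{0..<5} = {0, 1, 2, 3, 4 :: nat}"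
  "{Suc 0..2} = {1, 2}" "{Suc 0..3} = {1, 2, 3}" "{Suc 0..4} = {1, 2, 3, 4}" "{Suc 0..5} = {1, 2, 3, 4, 5}"
  by auto

text \<open>The carriers of \<open>Nn n\<close> and \<open>adjI (Nn n)\<close> start at one, the
  other carriers at zero.\<close>

fun offset :: "gen \<Rightarrow> nat" where
  "offset k = (if k \<in> {G_N3, G_N4, G_N5, G_N1I, G_N2I, G_N3I, G_N4I} then 1 else 0)"

lemma gen_pv_gen: "gen_pv (tabsg (gen_tab k)) = gen_pv (gen_sg k)"
proof (rule gen_pv_iso[OF fsg_gen iso_num])
  note defs = mt_def Zn_def Nn_def L2_def R2_def A0_def A2_def B2_def Z2bar_def N2bar_def
      L2bar_def l3bar_def l3_def sg_op_def adjI_def Let_def small_intervals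
  show "(\<lambda>x. num x + offset k) ` set (fst (gen_tab k)) = sg_car (gen_sg k)"
    by (cases k) (auto simp: defs)
  show "\<forall>x\<in>set (fst (gen_tab k)). \<forall>y\<in>set (fst (gen_tab k)).
      num (mt (snd (gen_tab k)) x y) + offset k = sg_mult (gen_sg k) (num x + offset k) (num y + offset k)"
    by (cases k) (simp_all add: defs)
qed

lemma gen_listed: "listed k \<Longrightarrow> gen_sg k \<in> set the_list"
  by (cases k) (simp_all add: the_list_def)

subsection \<open>Certificates\<close>

fun same_list :: "elt list \<Rightarrow> elt list \<Rightarrow> bool" where
  "same_list [] [] = True"
| "same_list (x # xs) (y # ys) = (if same x y then same_list xs ys else False)"
| "same_list xs ys = False"

lemma same_list_iff [simp]: "same_list xs ys \<longleftrightarrow> xs = ys"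
  by (induction xs ys rule: same_list.induct) auto

fun mem_vec :: "elt list \<Rightarrow> elt list list \<Rightarrow> bool" where
  "mem_vec x [] = False"
| "mem_vec x (y # ys) = (if same_list x y then True else mem_vec x ys)"

lemma mem_vec_iff [simp]: "mem_vec x ys \<longleftrightarrow> x \<in> set ys"
  by (induction ys) auto

fun vmul :: "tab list \<Rightarrow> elt list \<Rightarrow> elt list \<Rightarrow> elt list" where
  "vmul (t # ts) (x # xs) (y # ys) = mt t x y # vmul ts xs ys"
| "vmul ts xs ys = []"

lemma vmul_nth:
  "length xs = length ts \<Longrightarrow> length ys = length ts \<Longrightarrow> i < length ts \<Longrightarrow> vmul ts xs ys ! i = mt (ts ! i) (xs ! i) (ys ! i)"
  by (induction ts xs ys arbitrary: i rule: vmul.induct) (auto simp: nth_Cons split: nat.splits)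

fun in_cars :: "elt list list \<Rightarrow> elt list \<Rightarrow> bool" where
  "in_cars [] [] = True"
| "in_cars (c # cs) (x # xs) = (if mem x c then in_cars cs xs else False)"
| "in_cars cs xs = False"

lemma in_cars_iff: "in_cars cs xs \<longleftrightarrow> length xs = length cs \<and> (\<forall>i<length cs. xs ! i \<in> set (cs ! i))"
  by (induction cs xs rule: in_cars.induct) (auto simp: nth_Cons less_Suc_eq_0_disj split: nat.splits)

definition prod_pair :: "tab list \<Rightarrow> elt list list \<Rightarrow> elt list \<Rightarrow> elt list \<Rightarrow> bool" where
  "prod_pair ts P p q = mem_vec (vmul ts p q) P"

definition prod_row :: "tab list \<Rightarrow> elt list list \<Rightarrow> elt list \<Rightarrow> bool" where
  "prod_row ts P p = ball (prod_pair ts P p) P"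

text \<open>The first coordinate belongs to the semigroup under test; it must be a function of the
  remaining ones.\<close>

definition fun_pair :: "elt list \<Rightarrow> elt list \<Rightarrow> bool" where
  "fun_pair p q = (if same_list (tl p) (tl q) then same (hd p) (hd q) else True)"

definition fun_row :: "elt list list \<Rightarrow> elt list \<Rightarrow> bool" where
  "fun_row P p = ball (fun_pair p) P"

fun hit :: "elt list list \<Rightarrow> elt \<Rightarrow> bool" where
  "hit [] x = False"
| "hit (p # ps) x = (if same (hd p) x then True else hit ps x)"

lemma hit_iff [simp]: "hit ps x \<longleftrightarrow> (\<exists>p\<in>set ps. hd p = x)"
  by (induction ps) auto

text \<open>
  \<open>P\<close> lists a subsemigroup of \<open>S \<times> T\<^sub>1 \<times> \<dots> \<times> T\<^sub>k\<close> projecting onto \<open>S\<close>,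
  in which the \<open>S\<close>-component is a function of the others; so \<open>S\<close> divides
  \<open>T\<^sub>1 \<times> \<dots> \<times> T\<^sub>k\<close>.
\<close>

definition member_check :: "elt list \<Rightarrow> tab \<Rightarrow> (elt list \<times> tab) list \<Rightarrow> elt list list \<Rightarrow> bool" where
  "member_check es t Ts P =
     (if ball (in_cars (es # map fst Ts)) P then
      if ball (prod_row (t # map snd Ts) P) P then
      if ball (fun_row P) P then ball (hit P) es else False else False else False)"

text \<open>An instance of \<open>realized_by_separation\<close>: the source is the listed
  subsemigroup, the homomorphisms into members are the projections to the coordinates after the
  first, and the quotient map is \<open>hd\<close>.\<close>

lemma member_check_sound:
  assumes V: "pseudovariety V" and check: "member_check es t Ts P" and ne: "Ts \<noteq> []"
    and S: "is_fsemigroup (tsg es t)"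
    and Ts: "\<And>p. p \<in> set Ts \<Longrightarrow> is_fsemigroup (tabsg p) \<and> realized_in (tabsg p) V"
  shows "realized_in (tsg es t) V"
proof -
  let ?ts = "t # map snd Ts"
  let ?hs = "map (\<lambda>i. (tabsg (Ts ! i), \<lambda>p :: elt list. p ! Suc i)) [0..<length Ts]"
  have cars: "length p = Suc (length Ts) \<and> (\<forall>i<Suc (length Ts). p ! i \<in> set ((es # map fst Ts) ! i))"
    if "p \<in> set P" for p
    using check that by (simp add: member_check_def in_cars_iff split: if_splits)
  have P: "length p = Suc (length Ts)" "hd p \<in> set es" "i < length Ts \<Longrightarrow> p ! Suc i \<in> set (fst (Ts ! i))"
    if "p \<in> set P" for p i
    using cars[OF that] by (cases p; force)+
  have rows: "\<forall>p\<in>set P. prod_row ?ts P p" "\<forall>p\<in>set P. fun_row P p" "\<forall>x\<in>set es. hit P x"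
    using check by (simp_all add: member_check_def split: if_splits)
  have prod: "vmul ?ts p q \<in> set P" if "p \<in> set P" "q \<in> set P" for p q
    using rows(1) that by (simp add: prod_row_def prod_pair_def)
  have func: "hd p = hd q" if "p \<in> set P" "q \<in> set P" "tl p = tl q" for p q
    using rows(2) that unfolding fun_row_def fun_pair_def ball_iff same_list_iff same_iff by metis
  have surj: "\<exists>p\<in>set P. hd p = x" if "x \<in> set es" for x
    using rows(3) that by simp
  have mul: "vmul ?ts p q ! i = mt (?ts ! i) (p ! i) (q ! i)"
    if "p \<in> set P" "q \<in> set P" "i \<le> length Ts" for p q i
    using that P(1) by (intro vmul_nth) auto
  have hd0: "hd p = p ! 0" if "p \<in> set P" for p
    using P(1)[OF that] by (cases p) auto
  show ?thesis
  proof (rule realized_by_separation[OF V, of ?hs "(set P, vmul ?ts)" _ hd])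
    fix T h assume "(T, h) \<in> set ?hs"
    then obtain i where i: "i < length Ts" "T = tabsg (Ts ! i)" "h = (\<lambda>p. p ! Suc i)" by auto
    have "sg_hom h (set P, vmul ?ts) T"
      using i P(3) mul[of _ _ "Suc i"] by (auto simp: sg_hom_def)
    then show "is_fsemigroup T \<and> realized_in T V \<and> sg_hom h (set P, vmul ?ts) T"
      using Ts i by simp
  next
    have "hd (vmul ?ts p q) = mt t (hd p) (hd q)" if "p \<in> set P" "q \<in> set P" for p q
      using hd0[OF prod[OF that]] hd0[OF that(1)] hd0[OF that(2)] mul[OF that, of 0] by simp
    then show "sg_hom hd (set P, vmul ?ts) (tsg es t)"
      using P(2) by (auto simp: sg_hom_def)
    show "hd ` sg_car (set P, vmul ?ts) = sg_car (tsg es t)"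
      using P(2) surj by auto
  next
    fix u v assume u: "u \<in> sg_car (set P, vmul ?ts)" and v: "v \<in> sg_car (set P, vmul ?ts)"
      and eq: "\<And>T h. (T, h) \<in> set ?hs \<Longrightarrow> h u = h v"
    have "u ! Suc i = v ! Suc i" if "i < length Ts" for i
      by (rule eq[of "tabsg (Ts ! i)"]) (use that in force)
    then have "tl u = tl v"
      using u v P(1) by (intro nth_equalityI) (auto simp: nth_tl)
    then show "hd u = hd v" using u v by (intro func) auto
  qed (use ne S prod in simp_all)
qed

fun eval_from :: "tab \<Rightarrow> row \<Rightarrow> elt \<Rightarrow> elt list \<Rightarrow> elt" where
  "eval_from t r p [] = p"
| "eval_from t r p (x # xs) = eval_from t r (mt t p (at r x)) xs"

fun eval :: "tab \<Rightarrow> row \<Rightarrow> elt list \<Rightarrow> elt" where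
  "eval t r [] = EU"
| "eval t r (x # xs) = eval_from t r (at r x) xs"

lemma eval_ev: "w \<noteq> [] \<Longrightarrow> eval t r w = ev (tsg es t) (at r) w"
proof -
  have "eval_from t r p xs = foldl (\<lambda>p x. mt t p (at r x)) p xs" for p xs
    by (induction xs arbitrary: p) auto
  then show "w \<noteq> [] \<Longrightarrow> ?thesis" by (cases w) (auto simp: ev_def)
qed

text \<open>Words are written in the letters \<open>E0\<close> and \<open>E1\<close>; the row serves
  as the assignment, with \<open>x\<close> and \<open>y\<close> as their values.\<close>

definition sat_pair :: "tab \<Rightarrow> elt list \<Rightarrow> elt list \<Rightarrow> elt \<Rightarrow> elt \<Rightarrow> bool" where
  "sat_pair t u v x y = same (eval t (Row x y EU EU EU) u) (eval t (Row x y EU EU EU) v)"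

definition sat_row :: "elt list \<Rightarrow> tab \<Rightarrow> elt list \<Rightarrow> elt list \<Rightarrow> elt \<Rightarrow> bool" where
  "sat_row es t u v x = ball (sat_pair t u v x) es"

definition sat_check :: "elt list \<times> tab \<Rightarrow> elt list \<Rightarrow> elt list \<Rightarrow> bool" where
  "sat_check p u v = ball (sat_row (fst p) (snd p) u v) (fst p)"

fun binary_letter :: "elt \<Rightarrow> bool" where
  "binary_letter E0 = True"
| "binary_letter E1 = True"
| "binary_letter x = False"

fun binary_word :: "elt list \<Rightarrow> bool" where
  "binary_word [] = False"
| "binary_word (x # xs) = ball binary_letter (x # xs)"

lemma binary_word_iff: "binary_word w \<longleftrightarrow> w \<noteq> [] \<and> set w \<subseteq> {E0, E1}"
proof -
  have "binary_letter x \<longleftrightarrow> x \<in> {E0, E1}" for x by (cases x) auto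
  then show ?thesis by (cases w) auto
qed

lemma ev_binary:
  assumes "binary_word w" "a E0 = x" "a E1 = y"
  shows "ev (tsg es t) a w = eval t (Row x y EU EU EU) w"
  using assms by (auto simp: binary_word_iff eval_ev[where es = es] intro!: ev_cong)

lemma sat_check_sound:
  assumes "sat_check p u v" "binary_word u" "binary_word v"
  shows "satisfies (tabsg p) u v"
  unfolding satisfies_def
proof (intro allI impI)
  fix a :: "elt \<Rightarrow> elt" assume "range a \<subseteq> sg_car (tabsg p)"
  then have "a E0 \<in> set (fst p)" "a E1 \<in> set (fst p)" by auto
  then show "ev (tabsg p) a u = ev (tabsg p) a v"
    using assms by (simp add: ev_binary sat_check_def sat_row_def sat_pair_def)
qed

text \<open>
  A generator \<open>T\<close> of the join is discarded by an identity of \<open>T\<close> violated in \<open>S\<close> at the given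
  pair, or it is one of the listed semigroups and belongs to the pseudovariety of \<open>S\<close>.
\<close>

datatype reason = Ident "elt list" "elt list" elt elt | Member "elt list list"

fun copies :: "'x \<Rightarrow> 'y list \<Rightarrow> 'x list" where
  "copies x [] = []"
| "copies x (y # ys) = x # copies x ys"

text \<open>For \<open>Member\<close> the roles are exchanged: the generator is the first
  coordinate, and the others range over copies of the semigroup being certified. Together with the
  inclusion given by irreducibility this yields equality of pseudovarieties.\<close>

fun reason_check :: "elt list \<Rightarrow> tab \<Rightarrow> gen \<times> reason \<Rightarrow> bool" where
  "reason_check es t (k, Ident u v x y) =
     (if binary_word u then if binary_word v then if sat_check (gen_tab k) u v then
      if mem x es then if mem y es then \<not> sat_pair t u v x y
      else False else False else False else False else False)"
| "reason_check es t (k, Member P) =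
     (if listed k then if tl (hd P) \<noteq> [] then
      member_check (fst (gen_tab k)) (snd (gen_tab k)) (copies (es, t) (tl (hd P))) P else False else False)"

fun cert_check :: "elt list \<Rightarrow> tab \<times> elt list list \<times> (gen \<times> reason) list \<Rightarrow> bool" where
  "cert_check es (t, P, ks) =
     (if ks \<noteq> [] then if member_check es t (map gen_tab (map fst ks)) P then ball (reason_check es t) ks
      else False else False)"

text \<open>Irreducibility does not tell which factor lies above the semigroup, hence a reason is
  checked for every factor. An identity contradicts the inclusion, and a membership supplies the
  converse inclusion for a listed semigroup.\<close>

lemma good_by_cert:
  assumes S: "is_fsemigroup (tsg es t)" and check: "cert_check es (t, P, ks)"
  shows "good (tsg es t)"
  unfolding good_def
proof
  assume ji: "join_irreducible (gen_pv (tsg es t))"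
  have c: "ks \<noteq> []" "member_check es t (map gen_tab (map fst ks)) P" "\<And>p. p \<in> set ks \<Longrightarrow> reason_check es t p"
    using check by (auto split: if_splits)
  have "\<exists>T\<in>(\<lambda>p. tabsg (gen_tab (fst p))) ` set ks. gen_pv (tsg es t) \<subseteq> gen_pv T"
  proof (rule join_irreducible_below[OF ji])
    fix V assume V: "pseudovariety V"
      and r: "\<And>T. T \<in> (\<lambda>p. tabsg (gen_tab (fst p))) ` set ks \<Longrightarrow> realized_in T V"
    show "realized_in (tsg es t) V"
    proof (rule member_check_sound[OF V c(2) _ S])
      fix p assume "p \<in> set (map gen_tab (map fst ks))"
      then obtain q where "q \<in> set ks" "p = gen_tab (fst q)" by auto
      then show "is_fsemigroup (tabsg p) \<and> realized_in (tabsg p) V" using r fsg_gen by blast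
    qed (use c(1) in simp)
  qed
  then obtain k why where k: "(k, why) \<in> set ks" "gen_pv (tsg es t) \<subseteq> gen_pv (tabsg (gen_tab k))" by auto
  show "\<exists>X\<in>set the_list. gen_pv (tsg es t) = gen_pv X"
  proof (cases why)
    case (Ident u v x y)
    then have i: "binary_word u" "binary_word v" "sat_check (gen_tab k) u v" "x \<in> set es" "y \<in> set es"
        "\<not> sat_pair t u v x y"
      using c(3)[OF k(1)] by (auto split: if_splits)
    have "\<not> satisfies (tsg es t) u v"
    proof
      let ?a = "\<lambda>c. if c = E1 then y else x"
      assume "satisfies (tsg es t) u v"
      moreover have "range ?a \<subseteq> sg_car (tsg es t)" using i(4,5) by auto
      ultimately have "ev (tsg es t) ?a u = ev (tsg es t) ?a v" unfolding satisfies_def by blast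
      then show False using i(1,2,6) by (simp add: ev_binary sat_pair_def)
    qed
    then have False
      using not_below_by_identity[OF S fsg_gen sat_check_sound[OF i(3,1,2)]] i(1,2) k(2)
      by (auto simp: binary_word_iff)
    then show ?thesis ..
  next
    case (Member Q)
    then have m: "listed k" "tl (hd Q) \<noteq> []"
        "member_check (fst (gen_tab k)) (snd (gen_tab k)) (copies (es, t) (tl (hd Q))) Q"
      using c(3)[OF k(1)] by (auto split: if_splits)
    have cop: "set (copies p ys) \<subseteq> {p}" "ys \<noteq> [] \<Longrightarrow> copies p ys \<noteq> []" for p :: "elt list \<times> tab" and ys :: "elt list"
      by (induction ys) auto
    have "realized_in (tabsg (gen_tab k)) (gen_pv (tsg es t))"
      by (rule member_check_sound[OF pv_gen_pv m(3)])
         (use cop m(2) S fsg_gen in \<open>fastforce simp: realized_gen_pv\<close>)+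
    then have "gen_pv (tsg es t) = gen_pv (gen_sg k)"
      using k(2) gen_pv_subset_iff[OF pv_gen_pv] gen_pv_gen by blast
    then show ?thesis using gen_listed[OF m(1)] by blast
  qed
qed

subsection \<open>Leaves of the search\<close>

fun row_ok :: "elt list \<Rightarrow> row \<Rightarrow> elt \<Rightarrow> bool" where
  "row_ok es p x = mem (at p x) es"

fun idem_at :: "row \<Rightarrow> elt \<Rightarrow> bool" where
  "idem_at p x = same (at p (at p x)) (at p x)"

fun all_fixed :: "elt list \<Rightarrow> row \<Rightarrow> bool" where
  "all_fixed [] p = True"
| "all_fixed (x # xs) p = (if same (at p x) x then all_fixed xs p else False)"

text \<open>An idempotent self-map other than the identity: a choice of representatives for an
  equivalence that identifies something.\<close>

definition part_ok :: "elt list \<Rightarrow> row \<Rightarrow> bool" where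
  "part_ok es p = (if ball (row_ok es p) es then if ball (idem_at p) es then \<not> all_fixed es p else False else False)"

fun onto_at :: "elt list \<Rightarrow> row \<Rightarrow> elt \<Rightarrow> bool" where
  "onto_at [] p y = False"
| "onto_at (x # xs) p y = (if same (at p x) y then True else onto_at xs p y)"

definition perm_ok :: "elt list \<Rightarrow> row \<Rightarrow> bool" where
  "perm_ok es p = (if ball (row_ok es p) es then ball (onto_at es p) es else False)"

lemma all_fixed_iff: "all_fixed xs p \<longleftrightarrow> (\<forall>x\<in>set xs. at p x = x)"
  by (induction xs) auto

lemma onto_at_iff: "onto_at xs p y \<longleftrightarrow> (\<exists>x\<in>set xs. at p x = y)"
  by (induction xs) auto

lemma cong_at_iff: "cong_at b cs t p x x' \<longleftrightarrow>
    b \<and> (\<forall>c\<in>set cs. at p (mt t x c) = at p (mt t x' c) \<and> at p (mt t c x) = at p (mt t c x'))"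
  by (induction b cs t p x x' rule: cong_at.induct) auto

lemma is_cong_iff: "is_cong b xs es t p \<longleftrightarrow> b \<and> (\<forall>x\<in>set xs. \<forall>c\<in>set es.
    at p (mt t x c) = at p (mt t (at p x) c) \<and> at p (mt t c x) = at p (mt t c (at p x)))"
proof (induction b xs es t p rule: is_cong.induct)
  case (3 x xs es t p)
  have "cong_class (same (at p x) x) es t p x \<longleftrightarrow> (\<forall>c\<in>set es.
      at p (mt t x c) = at p (mt t (at p x) c) \<and> at p (mt t c x) = at p (mt t c (at p x)))"
    by (cases "same (at p x) x") (auto simp: cong_at_iff)
  then show ?case using 3 by simp
qed auto

lemma congs_sub: "p \<in> set (congs es t ps) \<Longrightarrow> p \<in> set ps \<and> is_cong True es es t p"
proof (induction ps)
  case (Cons q ps)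
  then show ?case by (cases "is_cong True es es t q") auto
qed simp

lemma separated_iff: "separated x y ps \<longleftrightarrow> (\<exists>p\<in>set ps. at p x \<noteq> at p y)"
  by (induction ps) auto

lemma separated_from_iff: "separated_from x ys ps \<longleftrightarrow> (\<forall>y\<in>set ys. separated x y ps)"
  by (induction ys) auto

lemma pairwise_separatedD:
  "pairwise_separated xs ps \<Longrightarrow> x \<in> set xs \<Longrightarrow> y \<in> set xs \<Longrightarrow> x \<noteq> y \<Longrightarrow> \<exists>p\<in>set ps. at p x \<noteq> at p y"
proof (induction xs)
  case (Cons z xs)
  then show ?case by (auto simp: separated_iff separated_from_iff split: if_splits) metis
qed simp

lemma good_decomposable:
  assumes S: "is_fsemigroup (tsg es t)" "2 \<le> card (set es)"
    and IH: "\<And>Q :: elt sg. is_fsemigroup Q \<Longrightarrow> 2 \<le> card (sg_car Q) \<Longrightarrow> card (sg_car Q) < card (set es) \<Longrightarrow> good Q"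
    and ps: "ball (part_ok es) ps" and dec: "decomposable es ps t"
  shows "good (tsg es t)"
proof (rule good_subdirect[OF S(1), of "map at (congs es t ps)"])
  have ok: "part_ok es p" "is_cong True es es t p" if "p \<in> set (congs es t ps)" for p
    using congs_sub[OF that] ps by auto
  fix q x y assume q: "q \<in> set (map at (congs es t ps))" and x: "x \<in> sg_car (tsg es t)"
  obtain p where p: "q = at p" "p \<in> set (congs es t ps)" using q by auto
  show "q x \<in> sg_car (tsg es t)" using ok(1)[OF p(2)] x p(1) by (auto simp: part_ok_def split: if_splits)
  assume y: "y \<in> sg_car (tsg es t)"
  have "at p x \<in> set es" using ok(1)[OF p(2)] x by (auto simp: part_ok_def split: if_splits)
  moreover have "\<forall>x\<in>set es. \<forall>c\<in>set es. at p (mt t x c) = at p (mt t (at p x) c) \<and> at p (mt t c x) = at p (mt t c (at p x))"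
    using ok(2)[OF p(2)] unfolding is_cong_iff by blast
  ultimately have "at p (mt t x y) = at p (mt t (at p x) y)" "at p (mt t (at p x) y) = at p (mt t (at p x) (at p y))"
    using x y unfolding tsg_simps by blast+
  then show "q (sg_mult (tsg es t) x y) = q (sg_mult (tsg es t) (q x) (q y))"
    using p(1) by simp
next
  fix q assume "q \<in> set (map at (congs es t ps))"
  then obtain p where p: "q = at p" "part_ok es p" using congs_sub ps by auto
  then obtain x where "x \<in> set es" "at p x \<noteq> x" "at p (at p x) = at p x" "at p x \<in> set es"
    by (auto simp: part_ok_def all_fixed_iff split: if_splits)
  then show "\<not> inj_on q (sg_car (tsg es t))" using p(1) by (auto simp: inj_on_def)
next
  fix x y assume "x \<in> sg_car (tsg es t)" "y \<in> sg_car (tsg es t)" "x \<noteq> y"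
  then show "\<exists>p\<in>set (map at (congs es t ps)). p x \<noteq> p y"
    using pairwise_separatedD dec by (fastforce simp: decomposable_def)
qed (use S IH in auto)

lemma iso_row_iff: "iso_row b ys t s p x \<longleftrightarrow> b \<and> (\<forall>y\<in>set ys. at p (mt t x y) = mt s (at p x) (at p y))"
  by (induction b ys t s p x rule: iso_row.induct) auto

lemma iso_by_iff: "iso_by b xs es t s p \<longleftrightarrow> b \<and> (\<forall>x\<in>set xs. \<forall>y\<in>set es. at p (mt t x y) = mt s (at p x) (at p y))"
  by (induction b xs es t s p rule: iso_by.induct) (auto simp: iso_row_iff)

lemma iso_any_iff: "iso_any b es t ss p \<longleftrightarrow> b \<or> (\<exists>s\<in>set ss. iso_by True es es t s p)"
  by (induction b es t ss p rule: iso_any.induct) auto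

lemma iso_some_iff: "iso_some b es t ss ps \<longleftrightarrow> b \<or> (\<exists>p\<in>set ps. iso_any False es t ss p)"
  by (induction b es t ss ps rule: iso_some.induct) auto

text \<open>Certificates are stored for one labelling; here the row \<open>p\<close> is an
  isomorphism from the table found onto the certified one.\<close>

lemma good_iso_some:
  assumes S: "is_fsemigroup (tsg es t)"
    and ps: "ball (perm_ok es) ps" and certs: "ball (cert_check es) certs"
    and iso: "iso_some False es t (map fst certs) ps"
  shows "good (tsg es t)"
proof -
  obtain p s P ks where p: "p \<in> set ps" "iso_by True es es t s p" "(s, P, ks) \<in> set certs"
    using iso by (auto simp: iso_some_iff iso_any_iff)
  have im: "at p ` set es = set es"
    using ps p(1) by (fastforce simp: perm_ok_def onto_at_iff split: if_splits)
  then have "inj_on (at p) (set es)" by (metis List.finite_set finite_surj_inj subset_refl endo_inj_surj eq_card_imp_inj_on)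
  then have iso: "sg_iso (tsg es t) (tsg es s)"
    unfolding sg_iso_def using im p(2) by (intro exI[of _ "at p"]) (auto simp: sg_hom_def bij_betw_def iso_by_iff)
  have hom: "sg_hom (at p) (tsg es t) (tsg es s)"
    using im p(2) by (auto simp: sg_hom_def iso_by_iff)
  \<comment> \<open>Associativity of the certified table is transported from \<open>t\<close>, so
    certificates contain no check of it.\<close>
  have "is_fsemigroup (tsg es s)"
    using fsg_hom_image[OF S hom] im by (simp add: tsg_def)
  then have "good (tsg es s)" using good_by_cert certs p(3) by auto
  then show ?thesis using good_iso[OF S iso] by simp
qed

lemma triple_zero_iff: "triple_zero xs es t \<longleftrightarrow>
    (\<forall>x\<in>set xs. \<forall>y\<in>set es. \<forall>z\<in>set es. mt t (mt t x y) z = E0)"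
proof -
  have 3: "triple_zero3 zs t x y \<longleftrightarrow> (\<forall>z\<in>set zs. mt t (mt t x y) z = E0)" for zs x y
    by (induction zs) auto
  have 2: "triple_zero2 ys es t x \<longleftrightarrow> (\<forall>y\<in>set ys. triple_zero3 es t x y)" for ys x
    by (induction ys) auto
  show ?thesis by (induction xs) (auto simp: 2 3)
qed

definition solved :: "elt list \<Rightarrow> row list \<Rightarrow> row list \<Rightarrow> (tab \<times> elt list list \<times> (gen \<times> reason) list) list \<Rightarrow> bool" where
  "solved es ps qs certs = (if ball (part_ok es) ps then if ball (perm_ok es) qs then ball (cert_check es) certs
     else False else False)"

definition closed_leaf :: "elt list \<Rightarrow> row list \<Rightarrow> row list \<Rightarrow> (tab \<times> elt list list \<times> (gen \<times> reason) list) list \<Rightarrow> tab \<Rightarrow> bool" where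
  "closed_leaf es ps qs certs t \<longleftrightarrow>
     decomposable es ps t \<or> triple_zero es es t \<or> iso_some False es t (map fst certs) qs"

lemma good_by_leaf:
  assumes S: "is_fsemigroup (set es, f)" "2 \<le> card (set es)"
    and IH: "\<And>Q :: elt sg. is_fsemigroup Q \<Longrightarrow> 2 \<le> card (sg_car Q) \<Longrightarrow> card (sg_car Q) < card (set es) \<Longrightarrow> good Q"
    and solved: "solved es ps qs certs" and leaf: "closed_leaf es ps qs certs t"
    and t: "\<forall>x\<in>set es. \<forall>y\<in>set es. mt t x y = f x y"
  shows "good (set es, f)"
proof -
  have iso: "sg_iso (set es, f) (tsg es t)"
    unfolding sg_iso_def
    by (intro exI[of _ id]) (use t fsg_closed[OF S(1)] in \<open>auto simp: sg_hom_def\<close>)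
  have T: "is_fsemigroup (tsg es t)"
    using S(1) t by (auto simp: is_fsemigroup_def)
  have "good (tsg es t)"
    using leaf unfolding closed_leaf_def
  proof (elim disjE)
    assume "triple_zero es es t"
    then show ?thesis using S(2) by (intro good_triple_zero[OF T]) (auto simp: triple_zero_iff)
  next
    assume "decomposable es ps t"
    then show ?thesis using good_decomposable[OF T S(2) IH] solved by (simp add: solved_def split: if_splits)
  next
    assume "iso_some False es t (map fst certs) qs"
    then show ?thesis using good_iso_some[OF T] solved by (auto simp: solved_def split: if_splits)
  qed
  then show ?thesis using good_iso[OF S(1) iso] by simp
qed

section \<open>The normal forms: initial entries, order of cells, congruences and
  certificates\<close>

abbreviation "row2 a b \<equiv> Row a b EU EU EU"
abbreviation "row3 a b c \<equiv> Row a b c EU EU"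
abbreviation "row4 a b c d \<equiv> Row a b c d EU"
abbreviation "no_row \<equiv> Row EU EU EU EU EU"
abbreviation "tab2 a b \<equiv> Tab a b no_row no_row no_row"
abbreviation "tab3 a b c \<equiv> Tab a b c no_row no_row"
abbreviation "tab4 a b c d \<equiv> Tab a b c d no_row"

text \<open>
  The final number is the order. \<open>Lft\<close> and \<open>Rgt\<close>: the minimal ideal is left or right zero, of the
  order given first, or the direct product of \<open>L2\<close> or \<open>R2\<close> with the group of order two (\<open>_Z\<close>).
\<close>

datatype mode = Zero2 | Zero3 | Zero4 | Zero5 | Nil2 | Nil3 | Nil4 | Nil5 | Lft2_2 | Lft2_3 | Lft3_3 | Lft2_4 |
  Lft3_4 | Lft4_4 | Lft2_5 | Lft3_5 | Lft4_5 | Lft5_5 | Rgt2_2 | Rgt2_3 | Rgt3_3 | Rgt2_4 | Rgt3_4 | Rgt4_4 |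
  Rgt2_5 | Rgt3_5 | Rgt4_5 | Rgt5_5 | Grp2 | Grp3 | Grp4 | Grp5 | Lft_Z4 | Lft_Z5 | Rgt_Z4 | Rgt_Z5

datatype fam = Fam_zero | Fam_nil | Fam_group | Fam_any | Fam_left "elt list" | Fam_right "elt list"

fun m_fam :: "mode \<Rightarrow> fam" where
  "m_fam Zero2 = Fam_zero"
| "m_fam Zero3 = Fam_zero"
| "m_fam Zero4 = Fam_zero"
| "m_fam Zero5 = Fam_zero"
| "m_fam Nil2 = Fam_nil"
| "m_fam Nil3 = Fam_nil"
| "m_fam Nil4 = Fam_nil"
| "m_fam Nil5 = Fam_nil"
| "m_fam Lft2_2 = Fam_left [E0, E1]"
| "m_fam Lft2_3 = Fam_left [E0, E1]"
| "m_fam Lft3_3 = Fam_left [E0, E1, E2]"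
| "m_fam Lft2_4 = Fam_left [E0, E1]"
| "m_fam Lft3_4 = Fam_left [E0, E1, E2]"
| "m_fam Lft4_4 = Fam_left [E0, E1, E2, E3]"
| "m_fam Lft2_5 = Fam_left [E0, E1]"
| "m_fam Lft3_5 = Fam_left [E0, E1, E2]"
| "m_fam Lft4_5 = Fam_left [E0, E1, E2, E3]"
| "m_fam Lft5_5 = Fam_left [E0, E1, E2, E3, E4]"
| "m_fam Rgt2_2 = Fam_right [E0, E1]"
| "m_fam Rgt2_3 = Fam_right [E0, E1]"
| "m_fam Rgt3_3 = Fam_right [E0, E1, E2]"
| "m_fam Rgt2_4 = Fam_right [E0, E1]"
| "m_fam Rgt3_4 = Fam_right [E0, E1, E2]"
| "m_fam Rgt4_4 = Fam_right [E0, E1, E2, E3]"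
| "m_fam Rgt2_5 = Fam_right [E0, E1]"
| "m_fam Rgt3_5 = Fam_right [E0, E1, E2]"
| "m_fam Rgt4_5 = Fam_right [E0, E1, E2, E3]"
| "m_fam Rgt5_5 = Fam_right [E0, E1, E2, E3, E4]"
| "m_fam Grp2 = Fam_group"
| "m_fam Grp3 = Fam_group"
| "m_fam Grp4 = Fam_group"
| "m_fam Grp5 = Fam_group"
| "m_fam Lft_Z4 = Fam_any"
| "m_fam Lft_Z5 = Fam_any"
| "m_fam Rgt_Z4 = Fam_any"
| "m_fam Rgt_Z5 = Fam_any"

fun m_els :: "mode \<Rightarrow> elt list" where
  "m_els Zero2 = [E0, E1]"
| "m_els Zero3 = [E0, E1, E2]"
| "m_els Zero4 = [E0, E1, E2, E3]"
| "m_els Zero5 = [E0, E1, E2, E3, E4]"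
| "m_els Nil2 = [E0, E1]"
| "m_els Nil3 = [E0, E1, E2]"
| "m_els Nil4 = [E0, E1, E2, E3]"
| "m_els Nil5 = [E0, E1, E2, E3, E4]"
| "m_els Lft2_2 = [E0, E1]"
| "m_els Lft2_3 = [E0, E1, E2]"
| "m_els Lft3_3 = [E0, E1, E2]"
| "m_els Lft2_4 = [E0, E1, E2, E3]"
| "m_els Lft3_4 = [E0, E1, E2, E3]"
| "m_els Lft4_4 = [E0, E1, E2, E3]"
| "m_els Lft2_5 = [E0, E1, E2, E3, E4]"
| "m_els Lft3_5 = [E0, E1, E2, E3, E4]"
| "m_els Lft4_5 = [E0, E1, E2, E3, E4]"
| "m_els Lft5_5 = [E0, E1, E2, E3, E4]"
| "m_els Rgt2_2 = [E0, E1]"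
| "m_els Rgt2_3 = [E0, E1, E2]"
| "m_els Rgt3_3 = [E0, E1, E2]"
| "m_els Rgt2_4 = [E0, E1, E2, E3]"
| "m_els Rgt3_4 = [E0, E1, E2, E3]"
| "m_els Rgt4_4 = [E0, E1, E2, E3]"
| "m_els Rgt2_5 = [E0, E1, E2, E3, E4]"
| "m_els Rgt3_5 = [E0, E1, E2, E3, E4]"
| "m_els Rgt4_5 = [E0, E1, E2, E3, E4]"
| "m_els Rgt5_5 = [E0, E1, E2, E3, E4]"
| "m_els Grp2 = [E0, E1]"
| "m_els Grp3 = [E0, E1, E2]"
| "m_els Grp4 = [E0, E1, E2, E3]"
| "m_els Grp5 = [E0, E1, E2, E3, E4]"
| "m_els Lft_Z4 = [E0, E1, E2, E3]"
| "m_els Lft_Z5 = [E0, E1, E2, E3, E4]"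
| "m_els Rgt_Z4 = [E0, E1, E2, E3]"
| "m_els Rgt_Z5 = [E0, E1, E2, E3, E4]"

fun m_init :: "mode \<Rightarrow> tab" where
  "m_init Zero2 = tab2 (row2 E0 E0) (row2 E0 E1)"
| "m_init Zero3 = tab3 (row3 E0 E0 E0) (row3 E0 E1 EU) (row3 E0 EU EU)"
| "m_init Zero4 = tab4 (row4 E0 E0 E0 E0) (row4 E0 E1 EU EU) (row4 E0 EU EU EU) (row4 E0 EU EU EU)"
| "m_init Zero5 = Tab (Row E0 E0 E0 E0 E0) (Row E0 E1 EU EU EU) (Row E0 EU EU EU EU) (Row E0 EU EU EU EU)
  (Row E0 EU EU EU EU)"
| "m_init Nil2 = tab2 (row2 E0 E0) (row2 E0 EU)"
| "m_init Nil3 = tab3 (row3 E0 E0 E0) (row3 E0 EU EU) (row3 E0 EU EU)"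
| "m_init Nil4 = tab4 (row4 E0 E0 E0 E0) (row4 E0 EU EU EU) (row4 E0 EU EU EU) (row4 E0 EU EU EU)"
| "m_init Nil5 = Tab (Row E0 E0 E0 E0 E0) (Row E0 EU EU EU EU) (Row E0 EU EU EU EU) (Row E0 EU EU EU EU)
  (Row E0 EU EU EU EU)"
| "m_init Lft2_2 = tab2 (row2 E0 E0) (row2 E1 E1)"
| "m_init Lft2_3 = tab3 (row3 E0 E0 E0) (row3 E1 E1 E1) (row3 EU EU EU)"
| "m_init Lft3_3 = tab3 (row3 E0 E0 E0) (row3 E1 E1 E1) (row3 E2 E2 E2)"
| "m_init Lft2_4 = tab4 (row4 E0 E0 E0 E0) (row4 E1 E1 E1 E1) (row4 EU EU EU EU) (row4 EU EU EU EU)"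
| "m_init Lft3_4 = tab4 (row4 E0 E0 E0 E0) (row4 E1 E1 E1 E1) (row4 E2 E2 E2 E2) (row4 EU EU EU EU)"
| "m_init Lft4_4 = tab4 (row4 E0 E0 E0 E0) (row4 E1 E1 E1 E1) (row4 E2 E2 E2 E2) (row4 E3 E3 E3 E3)"
| "m_init Lft2_5 = Tab (Row E0 E0 E0 E0 E0) (Row E1 E1 E1 E1 E1) (Row EU EU EU EU EU) (Row EU EU EU EU EU)
  (Row EU EU EU EU EU)"
| "m_init Lft3_5 = Tab (Row E0 E0 E0 E0 E0) (Row E1 E1 E1 E1 E1) (Row E2 E2 E2 E2 E2) (Row EU EU EU EU EU)
  (Row EU EU EU EU EU)"
| "m_init Lft4_5 = Tab (Row E0 E0 E0 E0 E0) (Row E1 E1 E1 E1 E1) (Row E2 E2 E2 E2 E2) (Row E3 E3 E3 E3 E3)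
  (Row EU EU EU EU EU)"
| "m_init Lft5_5 = Tab (Row E0 E0 E0 E0 E0) (Row E1 E1 E1 E1 E1) (Row E2 E2 E2 E2 E2) (Row E3 E3 E3 E3 E3)
  (Row E4 E4 E4 E4 E4)"
| "m_init Rgt2_2 = tab2 (row2 E0 E1) (row2 E0 E1)"
| "m_init Rgt2_3 = tab3 (row3 E0 E1 EU) (row3 E0 E1 EU) (row3 E0 E1 EU)"
| "m_init Rgt3_3 = tab3 (row3 E0 E1 E2) (row3 E0 E1 E2) (row3 E0 E1 E2)"
| "m_init Rgt2_4 = tab4 (row4 E0 E1 EU EU) (row4 E0 E1 EU EU) (row4 E0 E1 EU EU) (row4 E0 E1 EU EU)"
| "m_init Rgt3_4 = tab4 (row4 E0 E1 E2 EU) (row4 E0 E1 E2 EU) (row4 E0 E1 E2 EU) (row4 E0 E1 E2 EU)"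
| "m_init Rgt4_4 = tab4 (row4 E0 E1 E2 E3) (row4 E0 E1 E2 E3) (row4 E0 E1 E2 E3) (row4 E0 E1 E2 E3)"
| "m_init Rgt2_5 = Tab (Row E0 E1 EU EU EU) (Row E0 E1 EU EU EU) (Row E0 E1 EU EU EU) (Row E0 E1 EU EU EU)
  (Row E0 E1 EU EU EU)"
| "m_init Rgt3_5 = Tab (Row E0 E1 E2 EU EU) (Row E0 E1 E2 EU EU) (Row E0 E1 E2 EU EU) (Row E0 E1 E2 EU EU)
  (Row E0 E1 E2 EU EU)"
| "m_init Rgt4_5 = Tab (Row E0 E1 E2 E3 EU) (Row E0 E1 E2 E3 EU) (Row E0 E1 E2 E3 EU) (Row E0 E1 E2 E3 EU)
  (Row E0 E1 E2 E3 EU)"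
| "m_init Rgt5_5 = Tab (Row E0 E1 E2 E3 E4) (Row E0 E1 E2 E3 E4) (Row E0 E1 E2 E3 E4) (Row E0 E1 E2 E3 E4)
  (Row E0 E1 E2 E3 E4)"
| "m_init Grp2 = tab2 (row2 E0 E1) (row2 E1 EU)"
| "m_init Grp3 = tab3 (row3 E0 E1 E2) (row3 E1 EU EU) (row3 E2 EU EU)"
| "m_init Grp4 = tab4 (row4 E0 E1 E2 E3) (row4 E1 EU EU EU) (row4 E2 EU EU EU) (row4 E3 EU EU EU)"
| "m_init Grp5 = Tab (Row E0 E1 E2 E3 E4) (Row E1 EU EU EU EU) (Row E2 EU EU EU EU) (Row E3 EU EU EU EU)
  (Row E4 EU EU EU EU)"
| "m_init Lft_Z4 = tab4 (row4 E0 E1 E0 E1) (row4 E1 E0 E1 E0) (row4 E2 E3 E2 E3) (row4 E3 E2 E3 E2)"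
| "m_init Lft_Z5 = Tab (Row E0 E1 E0 E1 EU) (Row E1 E0 E1 E0 EU) (Row E2 E3 E2 E3 EU) (Row E3 E2 E3 E2 EU)
  (Row EU EU EU EU EU)"
| "m_init Rgt_Z4 = tab4 (row4 E0 E1 E2 E3) (row4 E1 E0 E3 E2) (row4 E0 E1 E2 E3) (row4 E1 E0 E3 E2)"
| "m_init Rgt_Z5 = Tab (Row E0 E1 E2 E3 EU) (Row E1 E0 E3 E2 EU) (Row E0 E1 E2 E3 EU) (Row E1 E0 E3 E2 EU)
  (Row EU EU EU EU EU)"

text \<open>Entries read by the pruning come first: products with \<open>E1\<close> if there is a
  zero and a nonzero idempotent, the action on the zeros in the modes \<open>Lft\<close> and
  \<open>Rgt\<close> by number. Nilpotent semigroups and groups are filled in growing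
  squares.\<close>

fun m_cells :: "mode \<Rightarrow> (elt \<times> elt) list" where
  "m_cells Zero2 = []"
| "m_cells Zero3 = [(E1, E2), (E2, E1), (E2, E2)]"
| "m_cells Zero4 = [(E1, E2), (E1, E3), (E2, E1), (E3, E1), (E2, E2), (E3, E2), (E2, E3), (E3, E3)]"
| "m_cells Zero5 = [(E1, E2), (E1, E3), (E1, E4), (E2, E1), (E3, E1), (E4, E1), (E2, E2), (E3, E2), (E2, E3), (E3, E3), (E4, E2), (E2, E4), (E4, E3), (E3, E4), (E4, E4)]"
| "m_cells Nil2 = [(E1, E1)]"
| "m_cells Nil3 = [(E1, E1), (E2, E1), (E1, E2), (E2, E2)]"
| "m_cells Nil4 = [(E1, E1), (E2, E1), (E1, E2), (E2, E2), (E3, E1), (E1, E3), (E3, E2), (E2, E3), (E3, E3)]"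
| "m_cells Nil5 = [(E1, E1), (E2, E1), (E1, E2), (E2, E2), (E3, E1), (E1, E3), (E3, E2), (E2, E3), (E3, E3), (E4, E1), (E1, E4), (E4, E2), (E2, E4), (E4, E3), (E3, E4), (E4, E4)]"
| "m_cells Lft2_2 = []"
| "m_cells Lft2_3 = [(E2, E0), (E2, E1), (E2, E2)]"
| "m_cells Lft3_3 = []"
| "m_cells Lft2_4 = [(E2, E0), (E2, E1), (E3, E0), (E3, E1), (E2, E2), (E3, E2), (E2, E3), (E3, E3)]"
| "m_cells Lft3_4 = [(E3, E0), (E3, E1), (E3, E2), (E3, E3)]"
| "m_cells Lft4_4 = []"
| "m_cells Lft2_5 = [(E2, E0), (E2, E1), (E3, E0), (E3, E1), (E4, E0), (E4, E1), (E2, E2), (E3, E2), (E2, E3), (E3, E3), (E4, E2), (E2, E4), (E4, E3), (E3, E4), (E4, E4)]"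
| "m_cells Lft3_5 = [(E3, E0), (E3, E1), (E3, E2), (E4, E0), (E4, E1), (E4, E2), (E3, E3), (E4, E3), (E3, E4), (E4, E4)]"
| "m_cells Lft4_5 = [(E4, E0), (E4, E1), (E4, E2), (E4, E3), (E4, E4)]"
| "m_cells Lft5_5 = []"
| "m_cells Rgt2_2 = []"
| "m_cells Rgt2_3 = [(E0, E2), (E1, E2), (E2, E2)]"
| "m_cells Rgt3_3 = []"
| "m_cells Rgt2_4 = [(E0, E2), (E1, E2), (E0, E3), (E1, E3), (E2, E2), (E3, E2), (E2, E3), (E3, E3)]"
| "m_cells Rgt3_4 = [(E0, E3), (E1, E3), (E2, E3), (E3, E3)]"
| "m_cells Rgt4_4 = []"
| "m_cells Rgt2_5 = [(E0, E2), (E1, E2), (E0, E3), (E1, E3), (E0, E4), (E1, E4), (E2, E2), (E3, E2), (E2, E3), (E3,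
  E3), (E4, E2), (E2, E4), (E4, E3), (E3, E4), (E4, E4)]"
| "m_cells Rgt3_5 = [(E0, E3), (E1, E3), (E2, E3), (E0, E4), (E1, E4), (E2, E4), (E3, E3), (E4, E3), (E3, E4), (E4,
  E4)]"
| "m_cells Rgt4_5 = [(E0, E4), (E1, E4), (E2, E4), (E3, E4), (E4, E4)]"
| "m_cells Rgt5_5 = []"
| "m_cells Grp2 = [(E1, E1)]"
| "m_cells Grp3 = [(E1, E1), (E2, E1), (E1, E2), (E2, E2)]"
| "m_cells Grp4 = [(E1, E1), (E2, E1), (E1, E2), (E2, E2), (E3, E1), (E1, E3), (E3, E2), (E2, E3), (E3, E3)]"
| "m_cells Grp5 = [(E1, E1), (E2, E1), (E1, E2), (E2, E2), (E3, E1), (E1, E3), (E3, E2), (E2, E3), (E3, E3), (E4, E1), (E1, E4), (E4, E2), (E2, E4), (E4, E3), (E3, E4), (E4, E4)]"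
| "m_cells Lft_Z4 = []"
| "m_cells Lft_Z5 = [(E4, E0), (E0, E4), (E4, E1), (E1, E4), (E4, E2), (E2, E4), (E4, E3), (E3, E4), (E4, E4)]"
| "m_cells Rgt_Z4 = []"
| "m_cells Rgt_Z5 = [(E4, E0), (E0, E4), (E4, E1), (E1, E4), (E4, E2), (E2, E4), (E4, E3), (E3, E4), (E4, E4)]"

text \<open>A selection of equivalences on the labels, not all of them congruences of a given table;
  \<open>congs\<close> picks those that are.\<close>

fun m_parts :: "mode \<Rightarrow> row list" where
  "m_parts Zero2 = []"
| "m_parts Zero3 = [(row3 E0 E0 E2), (row3 E0 E1 E0), (row3 E0 E1 E1)]"
| "m_parts Zero4 = [(row4 E0 E0 E2 E3), (row4 E0 E1 E0 E3), (row4 E0 E1 E1 E3), (row4 E0 E1 E2 E0),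
  (row4 E0 E1 E2 E1),
    (row4 E0 E1 E2 E2)]"
| "m_parts Zero5 = [(Row E0 E0 E2 E3 E4), (Row E0 E1 E0 E3 E4), (Row E0 E1 E1 E3 E4), (Row E0 E1 E2 E0 E4),
  (Row E0 E1 E2 E1 E4),
    (Row E0 E1 E2 E2 E4), (Row E0 E1 E2 E3 E0), (Row E0 E1 E2 E3 E1), (Row E0 E1 E2 E3 E2), (Row E0 E1 E2 E3 E3),
    (Row E0 E1 E1 E3 E3), (Row E0 E1 E2 E1 E1), (Row E0 E1 E2 E1 E2), (Row E0 E0 E0 E0 E4), (Row E0 E1 E0 E0 E0),
    (Row E0 E1 E1 E1 E1)]"
| "m_parts Nil2 = []"
| "m_parts Nil3 = [(row3 E0 E1 E0), (row3 E0 E1 E1)]"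
| "m_parts Nil4 = [(row4 E0 E0 E2 E3), (row4 E0 E1 E1 E3), (row4 E0 E1 E2 E1), (row4 E0 E1 E2 E2)]"
| "m_parts Nil5 = [(Row E0 E0 E2 E3 E4), (Row E0 E1 E1 E3 E4), (Row E0 E1 E2 E1 E4), (Row E0 E1 E2 E2 E4),
  (Row E0 E1 E2 E3 E1),
    (Row E0 E1 E2 E3 E2), (Row E0 E1 E2 E3 E3)]"
| "m_parts Lft2_2 = []"
| "m_parts Lft2_3 = []"
| "m_parts Lft3_3 = [(row3 E0 E1 E0), (row3 E0 E1 E1)]"
| "m_parts Lft2_4 = []"
| "m_parts Lft3_4 = [(row4 E0 E0 E2 E3), (row4 E0 E1 E0 E3), (row4 E0 E1 E1 E3)]"
| "m_parts Lft4_4 = [(row4 E0 E1 E0 E1), (row4 E0 E1 E1 E0)]"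
| "m_parts Lft2_5 = []"
| "m_parts Lft3_5 = [(Row E0 E0 E2 E3 E4), (Row E0 E1 E0 E3 E4), (Row E0 E1 E1 E3 E4)]"
| "m_parts Lft4_5 = [(Row E0 E0 E2 E3 E4), (Row E0 E1 E0 E3 E4), (Row E0 E1 E1 E3 E4), (Row E0 E1 E2 E0 E4),
  (Row E0 E1 E2 E1 E4),
    (Row E0 E1 E2 E2 E4)]"
| "m_parts Lft5_5 = [(Row E0 E1 E0 E1 E1), (Row E0 E1 E1 E0 E1), (Row E0 E1 E1 E1 E0)]"
| "m_parts Rgt2_2 = []"
| "m_parts Rgt2_3 = []"
| "m_parts Rgt3_3 = [(row3 E0 E1 E0), (row3 E0 E1 E1)]"
| "m_parts Rgt2_4 = []"
| "m_parts Rgt3_4 = [(row4 E0 E0 E2 E3), (row4 E0 E1 E0 E3), (row4 E0 E1 E1 E3)]"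
| "m_parts Rgt4_4 = [(row4 E0 E1 E0 E1), (row4 E0 E1 E1 E0)]"
| "m_parts Rgt2_5 = []"
| "m_parts Rgt3_5 = [(Row E0 E0 E2 E3 E4), (Row E0 E1 E0 E3 E4), (Row E0 E1 E1 E3 E4)]"
| "m_parts Rgt4_5 = [(Row E0 E0 E2 E3 E4), (Row E0 E1 E0 E3 E4), (Row E0 E1 E1 E3 E4), (Row E0 E1 E2 E0 E4),
  (Row E0 E1 E2 E1 E4),
    (Row E0 E1 E2 E2 E4)]"
| "m_parts Rgt5_5 = [(Row E0 E1 E0 E1 E1), (Row E0 E1 E1 E0 E1), (Row E0 E1 E1 E1 E0)]"
| "m_parts Grp2 = []"
| "m_parts Grp3 = []"
| "m_parts Grp4 = [(row4 E0 E1 E0 E1), (row4 E0 E1 E1 E0)]"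
| "m_parts Grp5 = []"
| "m_parts Lft_Z4 = [(row4 E0 E0 E2 E2), (row4 E0 E1 E0 E1)]"
| "m_parts Lft_Z5 = [(Row E0 E0 E2 E2 E4), (Row E0 E1 E0 E1 E4)]"
| "m_parts Rgt_Z4 = [(row4 E0 E0 E2 E2), (row4 E0 E1 E0 E1)]"
| "m_parts Rgt_Z5 = [(Row E0 E0 E2 E2 E4), (Row E0 E1 E0 E1 E4)]"

text \<open>Relabellings that respect the normal form: they fix the zero or the group identity
  \<open>E0\<close>, or preserve the block of left or right zeros. The list is empty where
  \<open>m_certs\<close> is.\<close>

fun m_perms :: "mode \<Rightarrow> row list" where
  "m_perms Zero2 = [(row2 E0 E1)]"
| "m_perms Zero3 = [(row3 E0 E1 E2), (row3 E0 E2 E1)]"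
| "m_perms Zero4 = [(row4 E0 E1 E2 E3), (row4 E0 E1 E3 E2), (row4 E0 E2 E1 E3), (row4 E0 E2 E3 E1),
  (row4 E0 E3 E1 E2),
    (row4 E0 E3 E2 E1)]"
| "m_perms Zero5 = [(Row E0 E1 E2 E3 E4), (Row E0 E1 E2 E4 E3), (Row E0 E1 E3 E2 E4), (Row E0 E1 E3 E4 E2),
  (Row E0 E1 E4 E2 E3),
    (Row E0 E1 E4 E3 E2), (Row E0 E2 E1 E3 E4), (Row E0 E2 E1 E4 E3), (Row E0 E2 E3 E1 E4), (Row E0 E2 E3 E4 E1),
    (Row E0 E2 E4 E1 E3), (Row E0 E2 E4 E3 E1), (Row E0 E3 E1 E2 E4), (Row E0 E3 E1 E4 E2), (Row E0 E3 E2 E1 E4),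
    (Row E0 E3 E2 E4 E1), (Row E0 E3 E4 E1 E2), (Row E0 E3 E4 E2 E1), (Row E0 E4 E1 E2 E3), (Row E0 E4 E1 E3 E2),
    (Row E0 E4 E2 E1 E3), (Row E0 E4 E2 E3 E1), (Row E0 E4 E3 E1 E2), (Row E0 E4 E3 E2 E1)]"
| "m_perms Nil2 = []"
| "m_perms Nil3 = []"
| "m_perms Nil4 = [(row4 E0 E1 E2 E3), (row4 E0 E1 E3 E2), (row4 E0 E2 E1 E3), (row4 E0 E2 E3 E1), (row4 E0 E3 E1 E2),
    (row4 E0 E3 E2 E1)]"
| "m_perms Nil5 = [(Row E0 E1 E2 E3 E4), (Row E0 E1 E2 E4 E3), (Row E0 E1 E3 E2 E4), (Row E0 E1 E3 E4 E2),
  (Row E0 E1 E4 E2 E3),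
    (Row E0 E1 E4 E3 E2), (Row E0 E2 E1 E3 E4), (Row E0 E2 E1 E4 E3), (Row E0 E2 E3 E1 E4), (Row E0 E2 E3 E4 E1),
    (Row E0 E2 E4 E1 E3), (Row E0 E2 E4 E3 E1), (Row E0 E3 E1 E2 E4), (Row E0 E3 E1 E4 E2), (Row E0 E3 E2 E1 E4),
    (Row E0 E3 E2 E4 E1), (Row E0 E3 E4 E1 E2), (Row E0 E3 E4 E2 E1), (Row E0 E4 E1 E2 E3), (Row E0 E4 E1 E3 E2),
    (Row E0 E4 E2 E1 E3), (Row E0 E4 E2 E3 E1), (Row E0 E4 E3 E1 E2), (Row E0 E4 E3 E2 E1)]"
| "m_perms Lft2_2 = [(row2 E0 E1), (row2 E1 E0)]"
| "m_perms Lft2_3 = [(row3 E0 E1 E2), (row3 E1 E0 E2)]"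
| "m_perms Lft3_3 = []"
| "m_perms Lft2_4 = [(row4 E0 E1 E2 E3), (row4 E0 E1 E3 E2), (row4 E1 E0 E2 E3), (row4 E1 E0 E3 E2)]"
| "m_perms Lft3_4 = [(row4 E0 E1 E2 E3), (row4 E0 E2 E1 E3), (row4 E1 E0 E2 E3), (row4 E1 E2 E0 E3),
  (row4 E2 E0 E1 E3),
    (row4 E2 E1 E0 E3)]"
| "m_perms Lft4_4 = []"
| "m_perms Lft2_5 = []"
| "m_perms Lft3_5 = [(Row E0 E1 E2 E3 E4), (Row E0 E1 E2 E4 E3), (Row E0 E2 E1 E3 E4), (Row E0 E2 E1 E4 E3),
  (Row E1 E0 E2 E3 E4),
    (Row E1 E0 E2 E4 E3), (Row E1 E2 E0 E3 E4), (Row E1 E2 E0 E4 E3), (Row E2 E0 E1 E3 E4), (Row E2 E0 E1 E4 E3),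
    (Row E2 E1 E0 E3 E4), (Row E2 E1 E0 E4 E3)]"
| "m_perms Lft4_5 = []"
| "m_perms Lft5_5 = []"
| "m_perms Rgt2_2 = [(row2 E0 E1), (row2 E1 E0)]"
| "m_perms Rgt2_3 = [(row3 E0 E1 E2), (row3 E1 E0 E2)]"
| "m_perms Rgt3_3 = []"
| "m_perms Rgt2_4 = [(row4 E0 E1 E2 E3), (row4 E0 E1 E3 E2), (row4 E1 E0 E2 E3), (row4 E1 E0 E3 E2)]"
| "m_perms Rgt3_4 = [(row4 E0 E1 E2 E3), (row4 E0 E2 E1 E3), (row4 E1 E0 E2 E3), (row4 E1 E2 E0 E3),
  (row4 E2 E0 E1 E3),
    (row4 E2 E1 E0 E3)]"
| "m_perms Rgt4_4 = []"
| "m_perms Rgt2_5 = []"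
| "m_perms Rgt3_5 = [(Row E0 E1 E2 E3 E4), (Row E0 E1 E2 E4 E3), (Row E0 E2 E1 E3 E4), (Row E0 E2 E1 E4 E3),
  (Row E1 E0 E2 E3 E4),
    (Row E1 E0 E2 E4 E3), (Row E1 E2 E0 E3 E4), (Row E1 E2 E0 E4 E3), (Row E2 E0 E1 E3 E4), (Row E2 E0 E1 E4 E3),
    (Row E2 E1 E0 E3 E4), (Row E2 E1 E0 E4 E3)]"
| "m_perms Rgt4_5 = []"
| "m_perms Rgt5_5 = []"
| "m_perms Grp2 = [(row2 E0 E1)]"
| "m_perms Grp3 = [(row3 E0 E1 E2), (row3 E0 E2 E1)]"
| "m_perms Grp4 = [(row4 E0 E1 E2 E3), (row4 E0 E1 E3 E2), (row4 E0 E2 E1 E3), (row4 E0 E2 E3 E1), (row4 E0 E3 E1 E2),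
    (row4 E0 E3 E2 E1)]"
| "m_perms Grp5 = [(Row E0 E1 E2 E3 E4), (Row E0 E1 E2 E4 E3), (Row E0 E1 E3 E2 E4), (Row E0 E1 E3 E4 E2),
  (Row E0 E1 E4 E2 E3),
    (Row E0 E1 E4 E3 E2), (Row E0 E2 E1 E3 E4), (Row E0 E2 E1 E4 E3), (Row E0 E2 E3 E1 E4), (Row E0 E2 E3 E4 E1),
    (Row E0 E2 E4 E1 E3), (Row E0 E2 E4 E3 E1), (Row E0 E3 E1 E2 E4), (Row E0 E3 E1 E4 E2), (Row E0 E3 E2 E1 E4),
    (Row E0 E3 E2 E4 E1), (Row E0 E3 E4 E1 E2), (Row E0 E3 E4 E2 E1), (Row E0 E4 E1 E2 E3), (Row E0 E4 E1 E3 E2),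
    (Row E0 E4 E2 E1 E3), (Row E0 E4 E2 E3 E1), (Row E0 E4 E3 E1 E2), (Row E0 E4 E3 E2 E1)]"
| "m_perms Lft_Z4 = []"
| "m_perms Lft_Z5 = []"
| "m_perms Rgt_Z4 = []"
| "m_perms Rgt_Z5 = []"

text \<open>An entry consists of a table, a subsemigroup of the product with the chosen factors, and
  one reason per factor. Without entries, every table reached is decomposable or has vanishing
  triple products. In \<open>Lft2_5\<close> and \<open>Rgt2_5\<close> none is reached, since five
  elements cannot act faithfully on two points, which have only four self-maps.\<close>

fun m_certs :: "mode \<Rightarrow> (tab \<times> elt list list \<times> (gen \<times> reason) list) list" where
  "m_certs Zero2 = [(tab2 (row2 E0 E0) (row2 E0 E1),
     [[E0, E0], [E1, E1]],
     [(G_N1I, Member [[E0, E0], [E1, E1]])])]"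
| "m_certs Zero3 = [(tab3 (row3 E0 E0 E0) (row3 E0 E1 E0) (row3 E0 E2 E0),
     [[E0, E0, E1], [E0, E0, E2], [E0, E3, E2], [E1, E0, E3], [E2, E3, E1]],
     [(G_N2bop, Ident [E0, E0] [E0, E0, E1] E1 E0), (G_N3I, Ident [E0, E1] [E1, E0] E1 E2)]),
    (tab3 (row3 E0 E0 E0) (row3 E0 E1 E1) (row3 E0 E2 E2),
     [[E0, E0, E0], [E0, E1, E0], [E1, E1, E1], [E2, E0, E1]],
     [(G_L2, Ident [E0] [E0, E1] E1 E0), (G_N1I, Ident [E0, E1] [E1, E0] E1 E2)]),
    (tab3 (row3 E0 E0 E0) (row3 E0 E1 E2) (row3 E0 E0 E0),
     [[E0, E0, E0], [E0, E0, E1], [E0, E3, E1], [E1, E0, E2], [E2, E3, E0]],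
     [(G_N2b, Ident [E0, E0] [E1, E0, E0] E1 E0), (G_N2I, Ident [E0, E1] [E1, E0] E1 E2)]),
    (tab3 (row3 E0 E0 E0) (row3 E0 E1 E2) (row3 E0 E1 E2),
     [[E0, E0, E3], [E0, E1, E3], [E1, E1, E4], [E2, E0, E4]],
     [(G_R2, Ident [E0] [E1, E0] E1 E0), (G_N4I, Ident [E0, E1] [E1, E0] E1 E2)]),
    (tab3 (row3 E0 E0 E0) (row3 E0 E1 E2) (row3 E0 E2 E0),
     [[E0, E1], [E1, E2], [E2, E0]],
     [(G_N2I, Member [[E0, E2], [E1, E0], [E2, E1]])]),
    (tab3 (row3 E0 E0 E0) (row3 E0 E1 E2) (row3 E0 E2 E1),
     [[E0, E0, E0], [E0, E1, E0], [E1, E0, E1], [E2, E1, E1]],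
     [(G_Z2, Ident [E0] [E0, E1, E1] E1 E0), (G_N1I, Ident [E0] [E0, E0] E2 E0)])]"
| "m_certs Zero4 = [(tab4 (row4 E0 E0 E0 E0) (row4 E0 E1 E0 E0) (row4 E0 E0 E2 E3) (row4 E0 E3 E0 E0),
     [[E0, E0, E0, E0], [E0, E0, E0, E1], [E0, E0, E1, E0], [E0, E2, E0, E0], [E0, E2, E0, E1], [E0, E2, E1, E0],
       [E0, E2, E1, E1], [E0, E2, E4, E0], [E1, E4, E4, E0], [E2, E2, E4, E2], [E3, E0, E1, E1]],
     [(G_N2bI, Ident [E0, E1, E1] [E1, E0, E1, E1] E3 E1), (G_N2bI, Ident [E0, E1, E1] [E1, E0, E1, E1] E3 E1),
       (G_L2I, Ident [E0] [E0, E0] E3 E0)]),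
    (tab4 (row4 E0 E0 E0 E0) (row4 E0 E1 E0 E0) (row4 E0 E2 E0 E0) (row4 E0 E2 E2 E3),
     [[E0, E0], [E1, E1], [E2, E3], [E3, E2]],
     [(G_A0, Member [[E0, E0], [E1, E1], [E2, E3], [E3, E2]])]),
    (tab4 (row4 E0 E0 E0 E0) (row4 E0 E1 E0 E1) (row4 E0 E2 E0 E2) (row4 E0 E1 E2 E3),
     [[E0, E0, E0], [E0, E1, E0], [E0, E1, E4], [E1, E2, E0], [E2, E0, E4], [E3, E2, E2]],
     [(G_N2I, Ident [E0, E1] [E1, E0] E1 E2), (G_l3bop, Ident [E0, E1] [E0, E1, E1] E3 E2)]),
    (tab4 (row4 E0 E0 E0 E0) (row4 E0 E1 E1 E1) (row4 E0 E1 E2 E3) (row4 E0 E3 E3 E3),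
     [[E0, E0, E0], [E0, E0, E1], [E1, E2, E0], [E2, E2, E2], [E3, E2, E1]],
     [(G_L2I, Member [[E0, E1], [E1, E3], [E2, E2]]), (G_L2I, Member [[E0, E1], [E1, E3], [E2, E2]])]),
    (tab4 (row4 E0 E0 E0 E0) (row4 E0 E1 E1 E3) (row4 E0 E1 E2 E3) (row4 E0 E0 E3 E0),
     [[E0, E0, E2], [E0, E1, E2], [E0, E1, E3], [E1, E2, E2], [E2, E2, E0], [E3, E0, E3]],
     [(G_N2I, Ident [E0, E1] [E1, E0] E1 E3), (G_L2b, Ident [E0] [E0, E0] E3 E0)]),
    (tab4 (row4 E0 E0 E0 E0) (row4 E0 E1 E1 E3) (row4 E0 E1 E2 E3) (row4 E0 E1 E3 E3),
     [[E0, E0, E0], [E0, E0, E1], [E1, E2, E0], [E2, E2, E2], [E3, E2, E1]],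
     [(G_R2I, Member [[E0, E1], [E1, E3], [E2, E2]]), (G_R2I, Member [[E0, E1], [E1, E3], [E2, E2]])]),
    (tab4 (row4 E0 E0 E0 E0) (row4 E0 E1 E2 E3) (row4 E0 E2 E0 E0) (row4 E0 E3 E0 E2),
     [[E0, E2], [E1, E3], [E2, E1], [E3, E0]],
     [(G_N3I, Member [[E0, E3], [E1, E2], [E2, E0], [E3, E1]])]),
    (tab4 (row4 E0 E0 E0 E0) (row4 E0 E1 E2 E3) (row4 E0 E2 E3 E1) (row4 E0 E3 E1 E2),
     [[E0, E0, E0], [E0, E0, E1], [E0, E0, E2], [E1, E1, E0], [E2, E1, E1], [E3, E1, E2]],
     [(G_N1I, Ident [E0] [E0, E0] E2 E0), (G_Z3, Ident [E0] [E0, E1, E1, E1] E1 E0)])]"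
| "m_certs Zero5 = [(Tab (Row E0 E0 E0 E0 E0) (Row E0 E1 E0 E0 E0) (Row E0 E0 E2 E3 E4) (Row E0 E3 E0 E0 E0)
  (Row E0 E3 E2 E3 E4),
     [[E0, E2, E0], [E0, E2, E3], [E0, E3, E0], [E0, E4, E0], [E1, E4, E1], [E2, E0, E2], [E3, E3, E3], [E4, E1, E2]],
     [(G_L2bop, Ident [E0] [E0, E0] E3 E0), (G_A0, Ident [E0, E1, E0] [E1, E0, E1] E2 E4)]),
    (Tab (Row E0 E0 E0 E0 E0) (Row E0 E1 E0 E0 E0) (Row E0 E0 E0 E0 E3) (Row E0 E3 E0 E0 E0) (Row E0 E4 E0 E0 E0),
     [[E0, E0, E0], [E0, E0, E1], [E0, E0, E2], [E0, E2, E2], [E0, E3, E1], [E0, E3, E2], [E1, E0, E3], [E2, E1, E0],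
       [E3, E2, E1], [E4, E3, E0]],
     [(G_N2bop, Ident [E0, E0] [E0, E0, E1] E1 E0), (G_N3I, Ident [E0, E1] [E1, E0] E1 E3)]),
    (Tab (Row E0 E0 E0 E0 E0) (Row E0 E1 E0 E0 E0) (Row E0 E2 E0 E0 E0) (Row E0 E3 E0 E0 E0) (Row E0 E2 E0 E2 E0),
     [[E0, E0, E3, E0], [E0, E0, E3, E1], [E0, E0, E3, E2], [E0, E3, E0, E1], [E0, E3, E0, E2], [E0, E3, E3, E2],
       [E0, E3, E4, E1], [E0, E3, E4, E2], [E1, E2, E3, E3], [E2, E3, E0, E0], [E2, E3, E3, E1], [E3, E3, E4, E0],
       [E4, E3, E1, E0]],
     [(G_l3bop, Ident [E0, E1] [E0, E1, E1] E4 E3), (G_l3bop, Ident [E0, E1] [E0, E1, E1] E4 E3), (G_N3I, Ident [E0,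
       E1] [E1, E0] E1 E2)]),
    (Tab (Row E0 E0 E0 E0 E0) (Row E0 E1 E0 E0 E0) (Row E0 E2 E0 E0 E0) (Row E0 E3 E0 E0 E0) (Row E0 E2 E3 E0 E3),
     [[E0, E0, E3], [E0, E1, E2], [E0, E1, E3], [E0, E2, E0], [E0, E2, E2], [E0, E2, E3], [E1, E3, E3], [E2, E0, E2],
       [E3, E1, E0], [E4, E0, E1]],
     [(G_N3I, Ident [E0, E1] [E1, E0] E1 E2), (G_N2bop, Ident [E0, E0] [E0, E0, E0] E4 E0)]),
    (Tab (Row E0 E0 E0 E0 E0) (Row E0 E1 E0 E0 E1) (Row E0 E0 E2 E3 E2) (Row E0 E3 E0 E0 E3) (Row E0 E1 E2 E3 E4),
     [[E0, E0, E0, E0], [E0, E0, E0, E1], [E0, E0, E1, E1], [E0, E1, E0, E0], [E0, E1, E0, E1], [E0, E1, E1, E0],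
       [E0, E1, E1, E1], [E0, E2, E0, E1], [E1, E2, E0, E2], [E2, E2, E2, E1], [E3, E0, E1, E0], [E4, E2, E2, E2]],
     [(G_N2I, Ident [E0, E1] [E1, E0] E1 E3), (G_L2I, Ident [E0] [E0, E0] E3 E0), (G_R2I, Ident [E0] [E0,
       E0] E3 E0)]),
    (Tab (Row E0 E0 E0 E0 E0) (Row E0 E1 E0 E0 E1) (Row E0 E0 E0 E0 E3) (Row E0 E3 E0 E0 E3) (Row E0 E4 E0 E0 E4),
     [[E0, E0, E0], [E0, E0, E2], [E0, E0, E3], [E0, E1, E0], [E1, E2, E0], [E2, E1, E1], [E3, E1, E2], [E4, E2, E3]],
     [(G_l3op, Ident [E0, E0, E1] [E1, E0, E1] E1 E4), (G_N2bop, Ident [E0, E0] [E0, E0, E1] E1 E0)]),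
    (Tab (Row E0 E0 E0 E0 E0) (Row E0 E1 E0 E0 E1) (Row E0 E0 E2 E3 E3) (Row E0 E3 E0 E0 E3) (Row E0 E4 E0 E0 E4),
     [[E0, E0, E2], [E0, E0, E3], [E0, E0, E4], [E0, E3, E2], [E1, E1, E0], [E2, E2, E4], [E3, E3, E3], [E4, E1, E1]],
     [(G_A0, Ident [E0, E1, E0] [E1, E0, E1] E1 E4), (G_L2b, Ident [E0] [E0, E0] E3 E0)]),
    (Tab (Row E0 E0 E0 E0 E0) (Row E0 E1 E0 E0 E1) (Row E0 E2 E0 E0 E2) (Row E0 E2 E2 E3 E3) (Row E0 E1 E2 E3 E4),
     [[E0, E0], [E1, E1], [E2, E3], [E3, E2], [E4, E4]],
     [(G_A0I, Member [[E0, E0], [E1, E1], [E2, E3], [E3, E2], [E4, E4]])]),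
    (Tab (Row E0 E0 E0 E0 E0) (Row E0 E1 E0 E0 E1) (Row E0 E2 E0 E0 E2) (Row E0 E3 E0 E0 E3) (Row E0 E1 E0 E2 E1),
     [[E0, E0, E0], [E0, E1, E0], [E0, E1, E2], [E0, E1, E3], [E1, E2, E0], [E2, E0, E2], [E3, E0, E3], [E4, E2, E1]],
     [(G_N2I, Ident [E0, E1] [E1, E0] E1 E2), (G_N2bop, Ident [E0, E0] [E0, E0, E1] E1 E0)]),
    (Tab (Row E0 E0 E0 E0 E0) (Row E0 E1 E0 E0 E4) (Row E0 E0 E0 E0 E0) (Row E0 E3 E0 E0 E2) (Row E0 E0 E0 E0 E0),
     [[E0, E0, E0], [E0, E0, E1], [E0, E0, E2], [E0, E1, E0], [E0, E2, E0], [E1, E2, E2], [E2, E1, E1], [E3, E1, E2],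
       [E4, E2, E1]],
     [(G_l3op, Ident [E0, E1] [E0, E1, E1] E1 E4), (G_l3, Ident [E0, E1] [E0, E0, E1] E3 E1)]),
    (Tab (Row E0 E0 E0 E0 E0) (Row E0 E1 E0 E0 E4) (Row E0 E0 E2 E3 E0) (Row E0 E3 E0 E0 E2) (Row E0 E0 E4 E1 E0),
     [[E0, E0], [E1, E4], [E2, E3], [E3, E1], [E4, E2]],
     [(G_B2, Member [[E0, E0], [E1, E3], [E2, E4], [E3, E2], [E4, E1]])]),
    (Tab (Row E0 E0 E0 E0 E0) (Row E0 E1 E0 E0 E4) (Row E0 E2 E0 E0 E3) (Row E0 E2 E0 E0 E3) (Row E0 E1 E0 E0 E4),
     [[E0, E0, E0], [E0, E2, E0], [E0, E4, E0], [E1, E4, E1], [E2, E0, E3], [E2, E4, E3], [E3, E2, E3], [E4, E2, E1]],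
     [(G_L2b, Ident [E0] [E0, E0] E2 E0), (G_A0I, Ident [E0, E1, E0, E1] [E0, E1, E1, E0] E1 E4)]),
    (Tab (Row E0 E0 E0 E0 E0) (Row E0 E1 E0 E0 E4) (Row E0 E2 E0 E0 E3) (Row E0 E2 E2 E3 E3) (Row E0 E1 E1 E4 E4),
     [[E0, E0], [E1, E4], [E2, E1], [E3, E3], [E4, E2]],
     [(G_A2, Member [[E0, E0], [E1, E2], [E2, E4], [E3, E3], [E4, E1]])]),
    (Tab (Row E0 E0 E0 E0 E0) (Row E0 E1 E0 E0 E4) (Row E0 E2 E0 E0 E0) (Row E0 E3 E0 E0 E2) (Row E0 E4 E0 E0 E0),
     [[E0, E0, E1], [E0, E0, E2], [E0, E0, E3], [E0, E1, E3], [E1, E0, E4], [E2, E1, E2], [E3, E1, E1], [E4, E0, E0]],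
     [(G_L2, Ident [E0] [E0, E0] E2 E0), (G_N4I, Ident [E0, E1] [E1, E0] E1 E2)]),
    (Tab (Row E0 E0 E0 E0 E0) (Row E0 E1 E0 E0 E4) (Row E0 E2 E0 E0 E3) (Row E0 E3 E0 E0 E2) (Row E0 E4 E0 E0 E1),
     [[E0, E0, E0], [E0, E1, E0], [E1, E0, E2], [E2, E0, E1], [E3, E1, E1], [E4, E1, E2]],
     [(G_Z2, Ident [E0] [E0, E0, E0] E2 E0), (G_l3op, Ident [E0, E0] [E0, E0, E0] E4 E0)]),
    (Tab (Row E0 E0 E0 E0 E0) (Row E0 E1 E0 E3 E3) (Row E0 E2 E0 E0 E0) (Row E0 E3 E0 E0 E0) (Row E0 E4 E0 E2 E2),
     [[E0, E0, E1], [E0, E0, E2], [E0, E1, E2], [E1, E0, E3], [E2, E1, E1], [E3, E0, E0], [E4, E1, E0]],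
     [(G_L2, Ident [E0] [E0, E0] E2 E0), (G_N3I, Ident [E0, E1] [E1, E0] E1 E2)]),
    (Tab (Row E0 E0 E0 E0 E0) (Row E0 E1 E0 E3 E4) (Row E0 E0 E0 E0 E0) (Row E0 E0 E0 E0 E0) (Row E0 E0 E3 E0 E0),
     [[E0, E0, E0], [E0, E0, E1], [E0, E0, E2], [E0, E3, E2], [E0, E4, E1], [E0, E4, E2], [E1, E0, E3], [E2, E1, E0],
       [E3, E3, E1], [E4, E4, E0]],
     [(G_l3b, Ident [E0, E1] [E0, E0, E1] E4 E2), (G_N3I, Ident [E0, E1] [E1, E0] E1 E3)]),
    (Tab (Row E0 E0 E0 E0 E0) (Row E0 E1 E0 E3 E4) (Row E0 E0 E0 E0 E0) (Row E0 E0 E0 E0 E0) (Row E0 E1 E3 E3 E4),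
     [[E0, E0, E0], [E0, E2, E0], [E0, E3, E0], [E0, E3, E1], [E1, E3, E2], [E2, E0, E1], [E3, E2, E1], [E4, E2, E2]],
     [(G_Z2b, Ident [E0] [E0, E0, E0] E2 E0), (G_l3, Ident [E0, E1, E0] [E0, E1, E1] E1 E4)]),
    (Tab (Row E0 E0 E0 E0 E0) (Row E0 E1 E0 E3 E4) (Row E0 E2 E0 E0 E0) (Row E0 E0 E4 E0 E0) (Row E0 E4 E0 E0 E0),
     [[E0, E0, E0, E2], [E0, E0, E0, E3], [E0, E0, E0, E4], [E0, E0, E1, E2], [E0, E0, E1, E3], [E0, E0, E1, E4],
       [E0, E0, E4, E0], [E0, E0, E4, E1], [E0, E1, E0, E2], [E0, E1, E0, E3], [E0, E1, E0, E4], [E0, E1, E1, E3],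
       [E0, E1, E1, E4], [E0, E1, E4, E1], [E0, E4, E0, E3], [E0, E4, E0, E4], [E0, E4, E1, E3], [E1, E4, E4, E1],
       [E2, E1, E4, E0], [E3, E4, E1, E4], [E4, E1, E1, E2]],
     [(G_N2bI, Ident [E0, E1, E1] [E1, E0, E1, E1] E2 E1), (G_N2bI, Ident [E0, E1, E1] [E1, E0, E1, E1] E2 E1),
       (G_L2b, Ident [E0] [E0, E0] E2 E0)]),
    (Tab (Row E0 E0 E0 E0 E0) (Row E0 E1 E0 E3 E4) (Row E0 E2 E0 E2 E0) (Row E0 E1 E4 E3 E4) (Row E0 E4 E0 E4 E0),
     [[E0, E2, E0], [E0, E2, E1], [E0, E3, E1], [E0, E4, E1], [E1, E0, E2], [E2, E4, E0], [E3, E1, E2], [E4, E3, E0]],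
     [(G_L2bop, Ident [E0] [E0, E0] E2 E0), (G_N2I, Ident [E0, E1] [E1, E0] E1 E2)]),
    (Tab (Row E0 E0 E0 E0 E0) (Row E0 E1 E0 E3 E4) (Row E0 E2 E0 E0 E0) (Row E0 E3 E0 E0 E0) (Row E0 E3 E3 E0 E0),
     [[E0, E0, E1], [E0, E0, E3], [E0, E0, E4], [E0, E1, E1], [E0, E1, E3], [E0, E2, E3], [E0, E3, E1], [E0, E3, E3],
       [E0, E4, E3], [E1, E4, E4], [E2, E1, E4], [E3, E4, E1], [E4, E2, E1]],
     [(G_A2, Ident [E0, E1, E0] [E0, E1, E0, E1, E0] E1 E3), (G_N4I, Ident [E0, E1] [E1, E0] E1 E2)]),
    (Tab (Row E0 E0 E0 E0 E0) (Row E0 E1 E1 E1 E1) (Row E0 E1 E2 E3 E4) (Row E0 E3 E3 E3 E3) (Row E0 E3 E4 E1 E2),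
     [[E0, E2, E2], [E0, E3, E2], [E1, E3, E0], [E2, E0, E0], [E3, E2, E0], [E4, E1, E0]],
     [(G_Z2bop, Member [[E0, E2], [E1, E4], [E2, E1], [E3, E3]]), (G_Z2bop, Member [[E0, E2], [E1, E4], [E2, E1],
       [E3, E3]])]),
    (Tab (Row E0 E0 E0 E0 E0) (Row E0 E1 E1 E1 E1) (Row E0 E1 E1 E1 E3) (Row E0 E3 E3 E3 E3) (Row E0 E4 E4 E4 E4),
     [[E0, E0, E0], [E0, E0, E2], [E0, E0, E3], [E1, E1, E0], [E2, E1, E1], [E3, E1, E2], [E4, E1, E3]],
     [(G_N1I, Ident [E0] [E0, E0] E2 E0), (G_N2bop, Ident [E0, E0] [E0, E0, E1] E1 E0)]),
    (Tab (Row E0 E0 E0 E0 E0) (Row E0 E1 E1 E3 E3) (Row E0 E1 E2 E3 E4) (Row E0 E1 E3 E3 E1) (Row E0 E1 E4 E3 E2),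
     [[E0, E2, E0], [E0, E2, E1], [E0, E2, E2], [E0, E2, E3], [E1, E0, E2], [E2, E0, E0], [E3, E0, E3], [E4, E0, E1]],
     [(G_Z2b, Member [[E0, E2], [E1, E4], [E2, E1], [E3, E3]]), (G_Z2b, Member [[E0, E2], [E1, E4], [E2, E1], [E3,
       E3]])]),
    (Tab (Row E0 E0 E0 E0 E0) (Row E0 E1 E1 E3 E3) (Row E0 E2 E2 E4 E4) (Row E0 E0 E0 E0 E0) (Row E0 E0 E0 E0 E0),
     [[E0, E0, E0], [E0, E4, E0], [E1, E0, E2], [E2, E4, E2], [E3, E0, E1], [E4, E4, E1]],
     [(G_l3bop, Ident [E0, E1] [E0, E1, E1] E1 E3), (G_l3, Ident [E0, E1, E0] [E1, E0, E0] E1 E2)]),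
    (Tab (Row E0 E0 E0 E0 E0) (Row E0 E1 E1 E3 E3) (Row E0 E2 E2 E4 E4) (Row E0 E3 E3 E0 E0) (Row E0 E4 E4 E0 E0),
     [[E0, E0, E3], [E0, E1, E3], [E1, E1, E4], [E2, E0, E4], [E3, E1, E1], [E4, E0, E1]],
     [(G_L2I, Ident [E0] [E0, E0] E3 E0), (G_N4I, Ident [E0, E1] [E1, E0] E1 E2)]),
    (Tab (Row E0 E0 E0 E0 E0) (Row E0 E1 E1 E3 E4) (Row E0 E1 E1 E3 E4) (Row E0 E0 E0 E0 E0) (Row E0 E0 E3 E0 E0),
     [[E0, E0, E0], [E0, E0, E1], [E0, E2, E0], [E0, E3, E0], [E1, E0, E4], [E2, E1, E4], [E3, E2, E1], [E4, E3, E1]],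
     [(G_N2b, Ident [E0, E0] [E1, E0, E0] E1 E0), (G_N2bopI, Ident [E0, E0, E1] [E0, E0, E1, E0] E1 E3)]),
    (Tab (Row E0 E0 E0 E0 E0) (Row E0 E1 E1 E3 E4) (Row E0 E1 E1 E3 E4) (Row E0 E1 E1 E3 E4) (Row E0 E1 E3 E3 E4),
     [[E0, E0, E0], [E0, E0, E2], [E0, E0, E3], [E1, E1, E0], [E2, E1, E1], [E3, E1, E2], [E4, E1, E3]],
     [(G_N1I, Ident [E0] [E0, E0] E2 E0), (G_N2b, Ident [E0, E0] [E1, E0, E0] E1 E0)]),
    (Tab (Row E0 E0 E0 E0 E0) (Row E0 E1 E1 E3 E4) (Row E0 E2 E2 E3 E4) (Row E0 E0 E4 E0 E0) (Row E0 E4 E4 E0 E0),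
     [[E0, E0, E2], [E0, E0, E3], [E0, E0, E4], [E0, E3, E2], [E1, E4, E0], [E2, E4, E1], [E3, E3, E4], [E4, E3, E3]],
     [(G_A0I, Ident [E0, E1, E0, E1] [E1, E0, E0, E1] E1 E2), (G_L2b, Ident [E0] [E0, E0] E3 E0)]),
    (Tab (Row E0 E0 E0 E0 E0) (Row E0 E1 E2 E3 E2) (Row E0 E0 E0 E0 E0) (Row E0 E0 E0 E0 E2) (Row E0 E0 E0 E0 E0),
     [[E0, E0, E3, E2], [E0, E1, E1, E2], [E0, E1, E3, E2], [E0, E2, E1, E0], [E0, E2, E3, E0], [E0, E2, E3, E1],
       [E0, E3, E1, E0], [E0, E3, E1, E1], [E0, E3, E3, E0], [E0, E3, E3, E1], [E0, E3, E4, E0], [E0, E4, E1, E0],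
       [E0, E4, E3, E0], [E0, E4, E4, E0], [E1, E1, E4, E2], [E2, E2, E1, E1], [E2, E3, E4, E1], [E3, E0, E1, E2],
       [E4, E4, E4, E1]],
     [(G_L2bop, Ident [E0] [E0, E0] E2 E0), (G_N4I, Ident [E0, E1] [E1, E0] E1 E2), (G_l3, Ident [E0, E1] [E0, E0,
       E1] E3 E4)]),
    (Tab (Row E0 E0 E0 E0 E0) (Row E0 E1 E2 E3 E2) (Row E0 E0 E0 E0 E3) (Row E0 E0 E0 E0 E0) (Row E0 E0 E0 E0 E3),
     [[E0, E0, E3], [E0, E1, E2], [E0, E1, E3], [E0, E2, E0], [E0, E2, E2], [E0, E2, E3], [E1, E3, E3], [E2, E0, E2],
       [E3, E1, E0], [E4, E0, E1]],
     [(G_N3I, Ident [E0, E1] [E1, E0] E1 E2), (G_N2b, Ident [E0, E0] [E0, E0, E0] E4 E0)]),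
    (Tab (Row E0 E0 E0 E0 E0) (Row E0 E1 E2 E3 E2) (Row E0 E2 E0 E0 E0) (Row E0 E2 E0 E0 E2) (Row E0 E4 E0 E0 E0),
     [[E0, E0, E1], [E0, E0, E2], [E0, E1, E2], [E0, E2, E2], [E0, E3, E2], [E0, E4, E1], [E0, E4, E2], [E1, E3, E3],
       [E2, E0, E0], [E2, E3, E1], [E3, E1, E0], [E4, E2, E0]],
     [(G_B2, Ident [E0, E0, E1, E0] [E0, E0, E1, E1] E1 E2), (G_N3I, Ident [E0, E1] [E1, E0] E1 E3)]),
    (Tab (Row E0 E0 E0 E0 E0) (Row E0 E1 E2 E3 E3) (Row E0 E0 E0 E0 E3) (Row E0 E3 E0 E0 E0) (Row E0 E4 E0 E0 E0),
     [[E0, E0, E0], [E0, E0, E1], [E0, E0, E4], [E0, E1, E0], [E0, E1, E1], [E0, E2, E0], [E0, E3, E0], [E0, E4, E0],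
       [E0, E4, E1], [E1, E3, E4], [E2, E1, E4], [E3, E3, E1], [E4, E2, E1]],
     [(G_A2, Ident [E0, E1, E0] [E0, E1, E0, E1, E0] E1 E3), (G_N2bI, Ident [E0, E1, E1] [E1, E0, E1, E1] E4 E1)]),
    (Tab (Row E0 E0 E0 E0 E0) (Row E0 E1 E2 E3 E4) (Row E0 E0 E0 E0 E0) (Row E0 E0 E0 E0 E0) (Row E0 E4 E0 E2 E0),
     [[E0, E0, E0], [E0, E0, E1], [E0, E0, E2], [E0, E1, E1], [E0, E2, E1], [E1, E2, E2], [E2, E1, E0], [E3, E1, E2],
       [E4, E2, E0]],
     [(G_l3b, Ident [E0, E1] [E0, E0, E1] E4 E1), (G_N2I, Ident [E0, E1] [E1, E0] E1 E2)]),
    (Tab (Row E0 E0 E0 E0 E0) (Row E0 E1 E2 E3 E4) (Row E0 E0 E0 E0 E0) (Row E0 E0 E0 E0 E0) (Row E0 E4 E3 E2 E1),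
     [[E0, E0, E0], [E0, E1, E0], [E1, E0, E2], [E2, E0, E1], [E3, E1, E1], [E4, E1, E2]],
     [(G_Z2, Ident [E0] [E0, E0, E0] E2 E0), (G_l3, Ident [E0, E0] [E0, E0, E0] E4 E0)]),
    (Tab (Row E0 E0 E0 E0 E0) (Row E0 E1 E2 E3 E4) (Row E0 E0 E0 E0 E0) (Row E0 E3 E0 E0 E2) (Row E0 E3 E0 E0 E2),
     [[E0, E2, E1], [E0, E2, E2], [E0, E4, E2], [E1, E0, E3], [E2, E4, E1], [E3, E2, E0], [E4, E4, E0]],
     [(G_L2b, Ident [E0] [E0, E0] E2 E0), (G_N3I, Ident [E0, E1] [E1, E0] E1 E2)]),
    (Tab (Row E0 E0 E0 E0 E0) (Row E0 E1 E2 E3 E4) (Row E0 E1 E2 E3 E4) (Row E0 E3 E4 E0 E0) (Row E0 E3 E4 E0 E0),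
     [[E0, E2, E3], [E0, E3, E3], [E1, E2, E4], [E2, E3, E4], [E3, E2, E2], [E4, E3, E2]],
     [(G_Z2b, Ident [E0] [E0, E0, E0] E3 E0), (G_N4I, Ident [E0, E1] [E1, E0] E1 E2)]),
    (Tab (Row E0 E0 E0 E0 E0) (Row E0 E1 E2 E3 E4) (Row E0 E2 E0 E0 E0) (Row E0 E3 E0 E0 E2) (Row E0 E4 E0 E0 E0),
     [[E0, E0, E1], [E0, E0, E2], [E0, E0, E3], [E0, E1, E3], [E1, E2, E4], [E2, E1, E2], [E3, E1, E1], [E4, E0, E0]],
     [(G_L2I, Ident [E0] [E0, E0] E2 E0), (G_N4I, Ident [E0, E1] [E1, E0] E3 E4)]),
    (Tab (Row E0 E0 E0 E0 E0) (Row E0 E1 E2 E3 E4) (Row E0 E2 E0 E0 E0) (Row E0 E3 E0 E0 E2) (Row E0 E4 E0 E0 E2),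
     [[E0, E0, E1], [E0, E0, E2], [E0, E1, E2], [E1, E2, E3], [E2, E1, E1], [E3, E0, E0], [E4, E1, E0]],
     [(G_R2I, Ident [E0] [E0, E0] E2 E0), (G_N3I, Ident [E0, E1] [E1, E0] E3 E4)]),
    (Tab (Row E0 E0 E0 E0 E0) (Row E0 E1 E2 E3 E4) (Row E0 E2 E0 E0 E0) (Row E0 E3 E0 E0 E0) (Row E0 E4 E0 E2 E2),
     [[E0, E0, E2], [E0, E4, E1], [E0, E4, E2], [E1, E2, E3], [E2, E0, E1], [E3, E4, E0], [E4, E0, E0]],
     [(G_l3bop, Ident [E0, E0] [E0, E0, E0] E4 E0), (G_N3I, Ident [E0, E1] [E1, E0] E3 E4)]),
    (Tab (Row E0 E0 E0 E0 E0) (Row E0 E1 E2 E3 E4) (Row E0 E2 E0 E0 E0) (Row E0 E3 E0 E0 E2) (Row E0 E4 E0 E2 E0),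
     [[E0, E0, E1], [E0, E1, E0], [E0, E1, E1], [E0, E1, E2], [E0, E2, E1], [E1, E2, E2], [E2, E0, E0], [E3, E0, E2],
       [E4, E2, E0]],
     [(G_N2I, Member [[E0, E2], [E1, E0], [E2, E1]]), (G_N2I, Member [[E0, E2], [E1, E0], [E2, E1]])]),
    (Tab (Row E0 E0 E0 E0 E0) (Row E0 E1 E2 E3 E4) (Row E0 E2 E0 E0 E0) (Row E0 E3 E0 E0 E2) (Row E0 E4 E0 E2 E2),
     [[E0, E1, E1], [E0, E2, E2], [E1, E3, E3], [E2, E1, E2], [E3, E0, E0], [E4, E0, E1]],
     [(G_N3I, Member [[E0, E4], [E1, E2], [E2, E0], [E3, E1]]), (G_N3I, Member [[E0, E4], [E1, E2], [E2, E0], [E3,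
       E1]])]),
    (Tab (Row E0 E0 E0 E0 E0) (Row E0 E1 E2 E3 E4) (Row E0 E2 E0 E0 E0) (Row E0 E3 E0 E0 E2) (Row E0 E4 E0 E2 E3),
     [[E0, E3], [E1, E4], [E2, E2], [E3, E1], [E4, E0]],
     [(G_N4I, Member [[E0, E4], [E1, E3], [E2, E2], [E3, E0], [E4, E1]])]),
    (Tab (Row E0 E0 E0 E0 E0) (Row E0 E1 E2 E3 E4) (Row E0 E2 E0 E0 E3) (Row E0 E3 E0 E0 E2) (Row E0 E4 E2 E3 E1),
     [[E0, E0, E2], [E0, E0, E3], [E1, E4, E0], [E2, E1, E2], [E3, E1, E3], [E4, E4, E1]],
     [(G_N2bopI, Ident [E0, E0] [E0, E0, E0] E4 E0), (G_Z2b, Ident [E0] [E0, E0, E0] E2 E0)]),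
    (Tab (Row E0 E0 E0 E0 E0) (Row E0 E1 E2 E3 E4) (Row E0 E2 E0 E0 E2) (Row E0 E3 E0 E0 E3) (Row E0 E4 E3 E2 E1),
     [[E0, E1, E2], [E0, E1, E3], [E1, E2, E0], [E2, E0, E2], [E3, E0, E3], [E4, E2, E1]],
     [(G_N2I, Ident [E0, E1] [E1, E0] E2 E4), (G_Z2bop, Ident [E0] [E0, E0, E0] E2 E0)]),
    (Tab (Row E0 E0 E0 E0 E0) (Row E0 E1 E2 E3 E4) (Row E0 E2 E0 E0 E3) (Row E0 E3 E0 E0 E2) (Row E0 E4 E3 E2 E1),
     [[E0, E0, E1], [E0, E1, E1], [E1, E0, E2], [E2, E0, E0], [E3, E1, E0], [E4, E1, E2]],
     [(G_Z2, Ident [E0] [E0, E0, E0] E2 E0), (G_N2I, Ident [E0, E0] [E0, E0, E0] E4 E0)]),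
    (Tab (Row E0 E0 E0 E0 E0) (Row E0 E1 E2 E3 E4) (Row E0 E2 E0 E0 E0) (Row E0 E3 E0 E2 E0) (Row E0 E4 E0 E0 E2),
     [[E0, E2, E2], [E1, E3, E3], [E2, E1, E2], [E2, E2, E1], [E3, E1, E0], [E4, E0, E1]],
     [(G_N3I, Member [[E0, E3], [E1, E2], [E2, E0], [E3, E1]]), (G_N3I, Member [[E0, E3], [E1, E2], [E2, E0], [E3,
       E1]])]),
    (Tab (Row E0 E0 E0 E0 E0) (Row E0 E1 E2 E3 E4) (Row E0 E2 E0 E0 E0) (Row E0 E3 E0 E2 E2) (Row E0 E4 E0 E0 E2),
     [[E0, E0, E2], [E0, E2, E2], [E0, E3, E1], [E0, E3, E2], [E1, E4, E3], [E2, E0, E1], [E2, E2, E1], [E3, E3, E0],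
       [E4, E2, E0]],
     [(G_A0I, Ident [E0, E0] [E0, E0, E0] E3 E0), (G_N3I, Ident [E0, E1] [E1, E0] E3 E4)]),
    (Tab (Row E0 E0 E0 E0 E0) (Row E0 E1 E2 E3 E4) (Row E0 E2 E1 E4 E3) (Row E0 E3 E4 E2 E1) (Row E0 E4 E3 E1 E2),
     [[E0, E0, E0], [E0, E0, E1], [E0, E0, E2], [E0, E0, E3], [E1, E1, E0], [E2, E1, E2], [E3, E1, E1], [E4, E1, E3]],
     [(G_N1I, Ident [E0] [E0, E0] E2 E0), (G_Z4, Ident [E0, E0, E0, E0] [E1, E1, E1, E1] E0 E1)])]"
| "m_certs Nil2 = []"
| "m_certs Nil3 = []"
| "m_certs Nil4 = [(tab4 (row4 E0 E0 E0 E0) (row4 E0 E0 E0 E0) (row4 E0 E0 E0 E1) (row4 E0 E0 E1 E2),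
     [[E0, E3], [E1, E2], [E2, E1], [E3, E0]],
     [(G_N4, Member [[E0, E3], [E1, E2], [E2, E1], [E3, E0]])])]"
| "m_certs Nil5 = [(Tab (Row E0 E0 E0 E0 E0) (Row E0 E0 E0 E0 E0) (Row E0 E0 E0 E0 E1) (Row E0 E0 E0 E0 E1)
  (Row E0 E0 E0 E1 E3),
     [[E0, E0, E2], [E0, E0, E3], [E0, E1, E3], [E1, E1, E2], [E2, E0, E1], [E3, E1, E1], [E4, E1, E0]],
     [(G_R2I, Ident [E0] [E0, E0] E1 E0), (G_N4I, Ident [E0, E1] [E1, E0] E2 E4)]),
    (Tab (Row E0 E0 E0 E0 E0) (Row E0 E0 E0 E0 E0) (Row E0 E0 E0 E0 E0) (Row E0 E0 E0 E0 E1) (Row E0 E0 E1 E1 E3),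
     [[E0, E0, E3], [E0, E2, E2], [E0, E2, E3], [E0, E4, E3], [E1, E0, E2], [E2, E4, E1], [E3, E0, E1], [E4, E2, E0]],
     [(G_B2, Ident [E0, E0] [E0, E0, E0] E4 E0), (G_N4, Ident [E0, E1] [E1, E0] E2 E4)]),
    (Tab (Row E0 E0 E0 E0 E0) (Row E0 E0 E0 E0 E0) (Row E0 E0 E0 E0 E1) (Row E0 E0 E0 E1 E0) (Row E0 E0 E1 E0 E2),
     [[E0, E2, E3], [E0, E3, E3], [E1, E1, E3], [E1, E3, E2], [E2, E3, E1], [E3, E0, E2], [E4, E3, E0]],
     [(G_N4, Member [[E0, E4], [E1, E2], [E2, E1], [E3, E0]]), (G_N4, Member [[E0, E4], [E1, E2], [E2, E1], [E3,
       E0]])]),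
    (Tab (Row E0 E0 E0 E0 E0) (Row E0 E0 E0 E0 E0) (Row E0 E0 E0 E0 E1) (Row E0 E0 E0 E1 E1) (Row E0 E0 E1 E0 E2),
     [[E0, E0, E4, E4], [E0, E1, E3, E4], [E0, E1, E4, E3], [E0, E1, E4, E4], [E1, E0, E3, E4], [E1, E1, E4, E2],
       [E2, E1, E3, E1], [E3, E0, E1, E3], [E4, E1, E1, E0]],
     [(G_L2I, Ident [E0] [E0, E0] E1 E0), (G_N5, Ident [E0, E1] [E1, E0] E3 E4), (G_N5, Ident [E0, E1] [E1,
       E0] E3 E4)]),
    (Tab (Row E0 E0 E0 E0 E0) (Row E0 E0 E0 E0 E0) (Row E0 E0 E0 E0 E1) (Row E0 E0 E0 E1 E0) (Row E0 E0 E1 E1 E2),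
     [[E0, E2, E0, E2], [E0, E3, E0, E2], [E0, E3, E2, E2], [E1, E2, E2, E2], [E1, E3, E0, E1], [E2, E1, E2, E2],
       [E3, E1, E1, E0], [E4, E0, E2, E1]],
     [(G_N4I, Ident [E0, E1] [E1, E0] E3 E4), (G_N2bop, Ident [E0, E0] [E0, E0, E0] E3 E0), (G_N3, Ident [E0,
       E1] [E1, E0] E3 E4)]),
    (Tab (Row E0 E0 E0 E0 E0) (Row E0 E0 E0 E0 E0) (Row E0 E0 E0 E0 E1) (Row E0 E0 E0 E1 E1) (Row E0 E0 E1 E1 E2),
     [[E0, E2, E3], [E0, E3, E3], [E1, E1, E3], [E1, E3, E2], [E2, E3, E1], [E3, E0, E1], [E4, E2, E0]],
     [(G_N4, Member [[E0, E4], [E1, E2], [E2, E1], [E3, E0]]), (G_N4, Member [[E0, E4], [E1, E2], [E2, E1], [E3,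
       E0]])]),
    (Tab (Row E0 E0 E0 E0 E0) (Row E0 E0 E0 E0 E0) (Row E0 E0 E0 E0 E1) (Row E0 E0 E0 E1 E2) (Row E0 E0 E1 E2 E3),
     [[E0, E4], [E1, E3], [E2, E2], [E3, E1], [E4, E0]],
     [(G_N5, Member [[E0, E4], [E1, E3], [E2, E2], [E3, E1], [E4, E0]])])]"
| "m_certs Lft2_2 = [(tab2 (row2 E0 E0) (row2 E1 E1),
     [[E0, E0], [E1, E1]],
     [(G_L2, Member [[E0, E0], [E1, E1]])])]"
| "m_certs Lft2_3 = [(tab3 (row3 E0 E0 E0) (row3 E1 E1 E1) (row3 E0 E1 E2),
     [[E0, E0], [E1, E1], [E2, E2]],
     [(G_L2I, Member [[E0, E0], [E1, E1], [E2, E2]])])]"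
| "m_certs Lft3_3 = []"
| "m_certs Lft2_4 = [(tab4 (row4 E0 E0 E0 E0) (row4 E1 E1 E1 E1) (row4 E0 E1 E2 E3) (row4 E1 E0 E3 E2),
     [[E0, E2], [E1, E3], [E2, E0], [E3, E1]],
     [(G_Z2bop, Member [[E0, E2], [E1, E3], [E2, E0], [E3, E1]])])]"
| "m_certs Lft3_4 = [(tab4 (row4 E0 E0 E0 E0) (row4 E1 E1 E1 E1) (row4 E2 E2 E2 E2) (row4 E0 E0 E1 E0),
     [[E0, E0], [E1, E2], [E2, E3], [E3, E1]],
     [(G_N2bop, Member [[E0, E0], [E1, E3], [E2, E1], [E3, E2]])])]"
| "m_certs Lft4_4 = []"
| "m_certs Lft2_5 = []"
| "m_certs Lft3_5 = [(Tab (Row E0 E0 E0 E0 E0) (Row E1 E1 E1 E1 E1) (Row E2 E2 E2 E2 E2) (Row E0 E0 E1 E0 E3)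
  (Row E0 E0 E2 E0 E4),
     [[E0, E0], [E1, E3], [E2, E4], [E3, E1], [E4, E2]],
     [(G_l3bop, Member [[E0, E0], [E1, E3], [E2, E4], [E3, E1], [E4, E2]])]),
    (Tab (Row E0 E0 E0 E0 E0) (Row E1 E1 E1 E1 E1) (Row E2 E2 E2 E2 E2) (Row E0 E0 E1 E0 E0) (Row E0 E1 E0 E3 E4),
     [[E0, E0, E0], [E0, E0, E1], [E0, E0, E2], [E0, E0, E3], [E0, E1, E1], [E0, E2, E3], [E0, E3, E3], [E1, E2, E2],
       [E2, E3, E4], [E3, E1, E0], [E4, E4, E1]],
     [(G_N2bopI, Ident [E0, E0, E1] [E0, E0, E1, E0] E4 E3), (G_L2bop, Ident [E0] [E0, E0] E3 E0)]),
    (Tab (Row E0 E0 E0 E0 E0) (Row E1 E1 E1 E1 E1) (Row E2 E2 E2 E2 E2) (Row E0 E0 E1 E0 E0) (Row E0 E1 E1 E3 E4),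
     [[E0, E0, E0], [E0, E0, E1], [E0, E0, E2], [E0, E0, E3], [E0, E1, E1], [E0, E2, E3], [E1, E2, E2], [E1, E3, E3],
       [E2, E3, E4], [E3, E1, E0], [E4, E4, E1]],
     [(G_N2bopI, Ident [E0, E0, E1] [E0, E0, E1, E0] E4 E3), (G_L2bop, Ident [E0] [E0, E0] E3 E0)]),
    (Tab (Row E0 E0 E0 E0 E0) (Row E1 E1 E1 E1 E1) (Row E2 E2 E2 E2 E2) (Row E0 E0 E1 E0 E3) (Row E0 E1 E2 E3 E4),
     [[E0, E0], [E1, E2], [E2, E3], [E3, E1], [E4, E4]],
     [(G_N2bopI, Member [[E0, E0], [E1, E3], [E2, E1], [E3, E2], [E4, E4]])]),
    (Tab (Row E0 E0 E0 E0 E0) (Row E1 E1 E1 E1 E1) (Row E2 E2 E2 E2 E2) (Row E0 E0 E1 E0 E0) (Row E1 E1 E0 E1 E1),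
     [[E0, E0, E0], [E0, E2, E2], [E1, E2, E0], [E2, E3, E3], [E3, E1, E0], [E4, E2, E1]],
     [(G_N2bop, Member [[E0, E0], [E1, E3], [E2, E1], [E3, E2]]), (G_N2bop, Member [[E0, E0], [E1, E3], [E2, E1],
       [E3, E2]])]),
    (Tab (Row E0 E0 E0 E0 E0) (Row E1 E1 E1 E1 E1) (Row E2 E2 E2 E2 E2) (Row E0 E0 E1 E0 E3) (Row E1 E1 E2 E1 E4),
     [[E0, E3, E0], [E1, E0, E0], [E1, E3, E3], [E2, E0, E4], [E3, E3, E1], [E4, E0, E2], [E4, E1, E2]],
     [(G_l3bop, Member [[E0, E0, E0], [E0, E1, E1], [E1, E3, E3], [E2, E4, E4], [E3, E0, E1], [E4, E1, E2]]),
       (G_l3bop, Member [[E0, E0, E0], [E0, E1, E1], [E1, E3, E3], [E2, E4, E4], [E3, E0, E1], [E4, E1, E2]])]),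
    (Tab (Row E0 E0 E0 E0 E0) (Row E1 E1 E1 E1 E1) (Row E2 E2 E2 E2 E2) (Row E0 E0 E2 E3 E4) (Row E0 E2 E2 E3 E4),
     [[E0, E2], [E1, E4], [E2, E3], [E3, E0], [E4, E1]],
     [(G_L2bop, Member [[E0, E3], [E1, E4], [E2, E0], [E3, E2], [E4, E1]])]),
    (Tab (Row E0 E0 E0 E0 E0) (Row E1 E1 E1 E1 E1) (Row E2 E2 E2 E2 E2) (Row E0 E0 E2 E3 E3) (Row E1 E1 E2 E4 E4),
     [[E0, E1, E1], [E1, E0, E1], [E2, E0, E0], [E2, E1, E0], [E3, E1, E2], [E4, E0, E2]],
     [(G_L2I, Member [[E0, E0], [E1, E2], [E2, E3]]), (G_L2I, Member [[E0, E0], [E1, E2], [E2, E3]])]),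
    (Tab (Row E0 E0 E0 E0 E0) (Row E1 E1 E1 E1 E1) (Row E2 E2 E2 E2 E2) (Row E0 E1 E2 E3 E4) (Row E0 E2 E1 E4 E3),
     [[E0, E2, E2], [E0, E3, E2], [E1, E3, E3], [E2, E2, E3], [E3, E0, E0], [E4, E1, E0]],
     [(G_Z2bop, Member [[E0, E3], [E1, E4], [E2, E1], [E3, E2]]), (G_Z2bop, Member [[E0, E3], [E1, E4], [E2, E1],
       [E3, E2]])])]"
| "m_certs Lft4_5 = []"
| "m_certs Lft5_5 = []"
| "m_certs Rgt2_2 = [(tab2 (row2 E0 E1) (row2 E0 E1),
     [[E0, E0], [E1, E1]],
     [(G_R2, Member [[E0, E0], [E1, E1]])])]"
| "m_certs Rgt2_3 = [(tab3 (row3 E0 E1 E0) (row3 E0 E1 E1) (row3 E0 E1 E2),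
     [[E0, E0], [E1, E1], [E2, E2]],
     [(G_R2I, Member [[E0, E0], [E1, E1], [E2, E2]])])]"
| "m_certs Rgt3_3 = []"
| "m_certs Rgt2_4 = [(tab4 (row4 E0 E1 E0 E1) (row4 E0 E1 E1 E0) (row4 E0 E1 E2 E3) (row4 E0 E1 E3 E2),
     [[E0, E2], [E1, E3], [E2, E0], [E3, E1]],
     [(G_Z2b, Member [[E0, E2], [E1, E3], [E2, E0], [E3, E1]])])]"
| "m_certs Rgt3_4 = [(tab4 (row4 E0 E1 E2 E0) (row4 E0 E1 E2 E0) (row4 E0 E1 E2 E1) (row4 E0 E1 E2 E0),
     [[E0, E0], [E1, E2], [E2, E3], [E3, E1]],
     [(G_N2b, Member [[E0, E0], [E1, E3], [E2, E1], [E3, E2]])])]"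
| "m_certs Rgt4_4 = []"
| "m_certs Rgt2_5 = []"
| "m_certs Rgt3_5 = [(Tab (Row E0 E1 E2 E0 E0) (Row E0 E1 E2 E0 E0) (Row E0 E1 E2 E1 E2) (Row E0 E1 E2 E0 E0)
  (Row E0 E1 E2 E3 E4),
     [[E0, E0], [E1, E3], [E2, E4], [E3, E1], [E4, E2]],
     [(G_l3b, Member [[E0, E0], [E1, E3], [E2, E4], [E3, E1], [E4, E2]])]),
    (Tab (Row E0 E1 E2 E0 E0) (Row E0 E1 E2 E0 E1) (Row E0 E1 E2 E1 E0) (Row E0 E1 E2 E0 E3) (Row E0 E1 E2 E0 E4),
     [[E0, E0, E0], [E0, E1, E0], [E0, E1, E1], [E0, E2, E0], [E0, E3, E0], [E0, E3, E2], [E0, E3, E3], [E1, E2, E2],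
       [E2, E4, E3], [E3, E0, E1], [E4, E1, E4]],
     [(G_L2b, Ident [E0] [E0, E0] E3 E0), (G_N2bI, Ident [E0, E1, E1] [E1, E0, E1, E1] E3 E4)]),
    (Tab (Row E0 E1 E2 E0 E0) (Row E0 E1 E2 E0 E1) (Row E0 E1 E2 E1 E1) (Row E0 E1 E2 E0 E3) (Row E0 E1 E2 E0 E4),
     [[E0, E0, E0], [E0, E1, E0], [E0, E1, E1], [E0, E2, E0], [E0, E3, E0], [E0, E3, E2], [E1, E2, E2], [E1, E3, E3],
       [E2, E4, E3], [E3, E0, E1], [E4, E1, E4]],
     [(G_L2b, Ident [E0] [E0, E0] E3 E0), (G_N2bI, Ident [E0, E1, E1] [E1, E0, E1, E1] E3 E4)]),
    (Tab (Row E0 E1 E2 E0 E0) (Row E0 E1 E2 E0 E1) (Row E0 E1 E2 E1 E2) (Row E0 E1 E2 E0 E3) (Row E0 E1 E2 E3 E4),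
     [[E0, E0], [E1, E2], [E2, E3], [E3, E1], [E4, E4]],
     [(G_N2bI, Member [[E0, E0], [E1, E3], [E2, E1], [E3, E2], [E4, E4]])]),
    (Tab (Row E0 E1 E2 E0 E1) (Row E0 E1 E2 E0 E1) (Row E0 E1 E2 E1 E0) (Row E0 E1 E2 E0 E1) (Row E0 E1 E2 E0 E1),
     [[E0, E0, E0], [E0, E2, E2], [E1, E0, E2], [E2, E3, E3], [E3, E0, E1], [E4, E1, E2]],
     [(G_N2b, Member [[E0, E0], [E1, E3], [E2, E1], [E3, E2]]), (G_N2b, Member [[E0, E0], [E1, E3], [E2, E1], [E3,
       E2]])]),
    (Tab (Row E0 E1 E2 E0 E1) (Row E0 E1 E2 E0 E1) (Row E0 E1 E2 E1 E2) (Row E0 E1 E2 E0 E1) (Row E0 E1 E2 E3 E4),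
     [[E0, E3, E0], [E1, E0, E0], [E1, E3, E3], [E2, E4, E4], [E3, E3, E1], [E4, E2, E2]],
     [(G_l3b, Member [[E0, E0, E0], [E0, E1, E1], [E1, E3, E3], [E2, E4, E4], [E3, E0, E1], [E4, E1, E2]]), (G_l3b,
       Member [[E0, E0, E0], [E0, E1, E1], [E1, E3, E3], [E2, E4, E4], [E3, E0, E1], [E4, E1, E2]])]),
    (Tab (Row E0 E1 E2 E0 E0) (Row E0 E1 E2 E0 E2) (Row E0 E1 E2 E2 E2) (Row E0 E1 E2 E3 E3) (Row E0 E1 E2 E4 E4),
     [[E0, E2], [E1, E4], [E2, E3], [E3, E0], [E4, E1]],
     [(G_L2b, Member [[E0, E3], [E1, E4], [E2, E0], [E3, E2], [E4, E1]])]),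
    (Tab (Row E0 E1 E2 E0 E1) (Row E0 E1 E2 E0 E1) (Row E0 E1 E2 E2 E2) (Row E0 E1 E2 E3 E4) (Row E0 E1 E2 E3 E4),
     [[E0, E1, E0], [E1, E0, E0], [E2, E0, E1], [E2, E1, E1], [E3, E1, E2], [E4, E0, E2]],
     [(G_R2I, Member [[E0, E0], [E1, E2], [E2, E3]]), (G_R2I, Member [[E0, E0], [E1, E2], [E2, E3]])]),
    (Tab (Row E0 E1 E2 E0 E0) (Row E0 E1 E2 E1 E2) (Row E0 E1 E2 E2 E1) (Row E0 E1 E2 E3 E4) (Row E0 E1 E2 E4 E3),
     [[E0, E2, E2], [E0, E3, E2], [E1, E3, E3], [E2, E2, E3], [E3, E0, E0], [E4, E1, E0]],
     [(G_Z2b, Member [[E0, E3], [E1, E4], [E2, E1], [E3, E2]]), (G_Z2b, Member [[E0, E3], [E1, E4], [E2, E1], [E3,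
       E2]])])]"
| "m_certs Rgt4_5 = []"
| "m_certs Rgt5_5 = []"
| "m_certs Grp2 = [(tab2 (row2 E0 E1) (row2 E1 E0),
     [[E0, E0], [E1, E1]],
     [(G_Z2, Member [[E0, E0], [E1, E1]])])]"
| "m_certs Grp3 = [(tab3 (row3 E0 E1 E2) (row3 E1 E2 E0) (row3 E2 E0 E1),
     [[E0, E0], [E1, E1], [E2, E2]],
     [(G_Z3, Member [[E0, E0], [E1, E1], [E2, E2]])])]"
| "m_certs Grp4 = [(tab4 (row4 E0 E1 E2 E3) (row4 E1 E0 E3 E2) (row4 E2 E3 E1 E0) (row4 E3 E2 E0 E1),
     [[E0, E0], [E1, E2], [E2, E1], [E3, E3]],
     [(G_Z4, Member [[E0, E0], [E1, E2], [E2, E1], [E3, E3]])])]"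
| "m_certs Grp5 = [(Tab (Row E0 E1 E2 E3 E4) (Row E1 E2 E3 E4 E0) (Row E2 E3 E4 E0 E1) (Row E3 E4 E0 E1 E2)
  (Row E4 E0 E1 E2 E3),
     [[E0, E0], [E1, E1], [E2, E2], [E3, E3], [E4, E4]],
     [(G_Z5, Member [[E0, E0], [E1, E1], [E2, E2], [E3, E3], [E4, E4]])])]"
| "m_certs Lft_Z4 = []"
| "m_certs Lft_Z5 = []"
| "m_certs Rgt_Z4 = []"
| "m_certs Rgt_Z5 = []"

section \<open>Admissible values and pruning in each normal form\<close>

fun lower :: "elt \<Rightarrow> elt list" where
  "lower E0 = []" | "lower E1 = [E0]" | "lower E2 = [E0, E1]" | "lower E3 = [E0, E1, E2]"
| "lower E4 = [E0, E1, E2, E3]" | "lower EU = []"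

fun common :: "elt list \<Rightarrow> elt list \<Rightarrow> elt list" where
  "common [] ys = []"
| "common (x # xs) ys = (if mem x ys then x # common xs ys else common xs ys)"

fun in_row :: "elt list \<Rightarrow> tab \<Rightarrow> elt \<Rightarrow> elt \<Rightarrow> bool" where
  "in_row [] t x v = False"
| "in_row (c # cs) t x v = (if same (mt t x c) v then True else in_row cs t x v)"

fun in_col :: "elt list \<Rightarrow> tab \<Rightarrow> elt \<Rightarrow> elt \<Rightarrow> bool" where
  "in_col [] t y v = False"
| "in_col (c # cs) t y v = (if same (mt t c y) v then True else in_col cs t y v)"

text \<open>Cancellation in a group: a value already present in the row or column is
  excluded.\<close>

fun latin :: "elt list \<Rightarrow> elt list \<Rightarrow> tab \<Rightarrow> elt \<Rightarrow> elt \<Rightarrow> elt list" where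
  "latin [] es t x y = []"
| "latin (v # vs) es t x y =
     (if in_row es t x v then latin vs es t x y else if in_col es t y v then latin vs es t x y
      else v # latin vs es t x y)"

text \<open>The zeros form an ideal. For left zeros this restricts the columns indexed by them, for
  right zeros the rows.\<close>

fun cand_of :: "fam \<Rightarrow> elt list \<Rightarrow> tab \<Rightarrow> elt \<Rightarrow> elt \<Rightarrow> elt list" where
  "cand_of Fam_zero es t x y = es"
| "cand_of Fam_nil es t x y = common (lower x) (lower y)"
| "cand_of Fam_group es t x y = latin es es t x y"
| "cand_of Fam_any es t x y = es"
| "cand_of (Fam_left ls) es t x y = (if mem y ls then ls else es)"
| "cand_of (Fam_right ls) es t x y = (if mem x ls then ls else es)"

text \<open>True only if both actions are completely known and equal, so a partial table is never
  cut for lack of information.\<close>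

fun agree_left :: "elt list \<Rightarrow> tab \<Rightarrow> elt \<Rightarrow> elt \<Rightarrow> bool" where
  "agree_left [] t x y = True"
| "agree_left (i # is) t x y =
     (if same (mt t x i) EU then False else if same (mt t x i) (mt t y i) then agree_left is t x y else False)"

fun agree_right :: "elt list \<Rightarrow> tab \<Rightarrow> elt \<Rightarrow> elt \<Rightarrow> bool" where
  "agree_right [] t x y = True"
| "agree_right (i # is) t x y =
     (if same (mt t i x) EU then False else if same (mt t i x) (mt t i y) then agree_right is t x y else False)"

fun any_agree :: "(elt \<Rightarrow> elt \<Rightarrow> bool) \<Rightarrow> elt \<Rightarrow> elt list \<Rightarrow> bool" where
  "any_agree g x [] = False"
| "any_agree g x (y # ys) = (if g x y then True else any_agree g x ys)"

fun unfaithful :: "(elt \<Rightarrow> elt \<Rightarrow> bool) \<Rightarrow> elt list \<Rightarrow> bool" where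
  "unfaithful g [] = False"
| "unfaithful g (x # xs) = (if any_agree g x xs then True else unfaithful g xs)"

fun prune_of :: "fam \<Rightarrow> elt list \<Rightarrow> tab \<Rightarrow> bool" where
  "prune_of Fam_zero es t = unsorted False E2 (tl (tl (tl es))) t"
| "prune_of Fam_nil es t = False"
| "prune_of Fam_group es t = False"
| "prune_of Fam_any es t = False"
| "prune_of (Fam_left ls) es t = unfaithful (agree_left ls t) es"
| "prune_of (Fam_right ls) es t = unfaithful (agree_right ls t) es"

definition m_cand :: "mode \<Rightarrow> tab \<Rightarrow> elt \<Rightarrow> elt \<Rightarrow> elt list" where
  "m_cand m t x y = cand_of (m_fam m) (m_els m) t x y"

definition m_prune :: "mode \<Rightarrow> tab \<Rightarrow> bool" where
  "m_prune m t = prune_of (m_fam m) (m_els m) t"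

definition m_iso :: "mode \<Rightarrow> tab \<Rightarrow> bool" where
  "m_iso m t = iso_some False (m_els m) t (map fst (m_certs m)) (m_perms m)"

definition m_rest :: "mode \<Rightarrow> tab \<Rightarrow> bool" where
  "m_rest m t = unless (triple_zero (m_els m) (m_els m) t) (m_iso m) t"

definition m_leaf :: "mode \<Rightarrow> tab \<Rightarrow> bool" where
  "m_leaf m t = unless (decomposable (m_els m) (m_parts m) t) (m_rest m) t"

definition run :: "mode \<Rightarrow> bool" where
  "run m = search (m_els m) (m_cand m) (m_prune m) (m_leaf m) (m_cells m) (m_init m)"

definition m_solved :: "mode \<Rightarrow> bool" where
  "m_solved m = solved (m_els m) (m_parts m) (m_perms m) (m_certs m)"

fun has_cell :: "elt \<Rightarrow> elt \<Rightarrow> (elt \<times> elt) list \<Rightarrow> bool" where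
  "has_cell x y [] = False"
| "has_cell x y (c # cs) = (if same x (fst c) then if same y (snd c) then True else has_cell x y cs else has_cell x y cs)"

definition cell_ok :: "mode \<Rightarrow> elt \<Rightarrow> elt \<Rightarrow> bool" where
  "cell_ok m x y = (if same (mt (m_init m) x y) EU then has_cell x y (m_cells m) else True)"

definition cells_row :: "mode \<Rightarrow> elt \<Rightarrow> bool" where
  "cells_row m x = ball (cell_ok m x) (m_els m)"

definition cell_in :: "mode \<Rightarrow> elt \<times> elt \<Rightarrow> bool" where
  "cell_in m c = (if mem (fst c) (m_els m) then mem (snd c) (m_els m) else False)"

definition cells_ok :: "mode \<Rightarrow> bool" where
  "cells_ok m = (if ball (cells_row m) (m_els m) then ball (cell_in m) (m_cells m) else False)"

lemma runs: "run m"
proof -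
  have 1: "run Zero5"
    by code_simp
  have 2: "ball run [Nil5, Lft2_5, Lft3_5, Lft4_5, Lft5_5, Lft_Z5]"
    by code_simp
  have 3: "ball run [Zero2, Zero3, Zero4, Nil2, Nil3, Nil4, Lft2_2, Lft2_3, Lft3_3, Lft2_4, Lft3_4, Lft4_4, Rgt2_2,
      Rgt2_3, Rgt3_3, Rgt2_4, Rgt3_4, Rgt4_4, Rgt2_5, Rgt3_5, Rgt4_5, Rgt5_5, Grp2, Grp3, Grp4, Grp5, Lft_Z4,
      Rgt_Z4, Rgt_Z5]"
    by code_simp
  show ?thesis using 1 2 3 by (cases m) simp_all
qed

lemma solved_modes: "m_solved m"
proof -
  have "ball m_solved [Zero2, Zero3, Zero4, Zero5, Nil2, Nil3, Nil4, Nil5, Lft2_2, Lft2_3, Lft3_3, Lft2_4, Lft3_4,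
      Lft4_4, Lft2_5, Lft3_5, Lft4_5, Lft5_5, Rgt2_2, Rgt2_3, Rgt3_3, Rgt2_4, Rgt3_4, Rgt4_4, Rgt2_5, Rgt3_5,
      Rgt4_5, Rgt5_5, Grp2, Grp3, Grp4, Grp5, Lft_Z4, Lft_Z5, Rgt_Z4, Rgt_Z5]"
    by code_simp
  then show ?thesis by (cases m) simp_all
qed

lemma cells_modes: "cells_ok m"
proof -
  have "ball cells_ok [Zero2, Zero3, Zero4, Zero5, Nil2, Nil3, Nil4, Nil5, Lft2_2, Lft2_3, Lft3_3, Lft2_4, Lft3_4,
      Lft4_4, Lft2_5, Lft3_5, Lft4_5, Lft5_5, Rgt2_2, Rgt2_3, Rgt3_3, Rgt2_4, Rgt3_4, Rgt4_4, Rgt2_5, Rgt3_5,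
      Rgt4_5, Rgt5_5, Grp2, Grp3, Grp4, Grp5, Lft_Z4, Lft_Z5, Rgt_Z4, Rgt_Z5]"
    by code_simp
  then show ?thesis by (cases m) simp_all
qed

lemma unless_iff: "unless b k t \<longleftrightarrow> b \<or> k t"
  by (cases b) auto

lemma m_leaf_closed: "m_leaf m t \<Longrightarrow> closed_leaf (m_els m) (m_parts m) (m_perms m) (m_certs m) t"
  by (auto simp: m_leaf_def m_rest_def m_iso_def unless_iff closed_leaf_def)

lemma has_cell_iff: "has_cell x y cs \<longleftrightarrow> (x, y) \<in> set cs"
  by (induction cs) auto

lemma EU_els: "EU \<notin> set (m_els m)"
  by (cases m) simp_all

text \<open>Where algebra meets the search. A labelled semigroup only has to justify the initial
  entries, show that its products are among the candidates, and show that none of its partial tables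
  is pruned.\<close>

lemma mode_good:
  assumes S: "is_fsemigroup (set (m_els m), f)" "2 \<le> card (set (m_els m))"
    and IH: "\<And>Q :: elt sg. is_fsemigroup Q \<Longrightarrow> 2 \<le> card (sg_car Q) \<Longrightarrow> card (sg_car Q) < card (set (m_els m)) \<Longrightarrow> good Q"
    and cand: "\<And>t x y. extends (m_els m) f t \<Longrightarrow> x \<in> set (m_els m) \<Longrightarrow> y \<in> set (m_els m) \<Longrightarrow> (x, y) \<in> set (m_cells m) \<Longrightarrow>
      mt t x y = EU \<Longrightarrow> f x y \<in> set (cand_of (m_fam m) (m_els m) t x y)"
    and prune: "\<And>t. extends (m_els m) f t \<Longrightarrow> \<not> prune_of (m_fam m) (m_els m) t"
    and init: "extends (m_els m) f (m_init m)"
  shows "good (set (m_els m), f)"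
proof -
  have cells: "set (m_cells m) \<subseteq> set (m_els m) \<times> set (m_els m)"
    using cells_modes[of m] by (auto simp: cells_ok_def cell_in_def split: if_splits)
  have known: "(x, y) \<in> set (m_cells m)" if "x \<in> set (m_els m)" "y \<in> set (m_els m)" "mt (m_init m) x y = EU" for x y
    using cells_modes[of m] that by (auto simp: cells_ok_def cells_row_def cell_ok_def has_cell_iff split: if_splits)
  have "\<exists>t. m_leaf m t \<and> (\<forall>x\<in>set (m_els m). \<forall>y\<in>set (m_els m). mt t x y = f x y)"
  proof (rule search_sound[OF S(1) EU_els cells])
    show "f x y \<in> set (m_cand m t x y)"
      if "extends (m_els m) f t" "(x, y) \<in> set (m_cells m)" "mt t x y = EU" for t x y
      using cand[of t x y] that cells by (auto simp: m_cand_def)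
    show "\<not> m_prune m t" if "extends (m_els m) f t" for t
      using prune[OF that] by (simp add: m_prune_def)
    show "search (m_els m) (m_cand m) (m_prune m) (m_leaf m) (m_cells m) (m_init m)"
      using runs[of m] by (simp add: run_def)
  qed (use init known in auto)
  then obtain t where "m_leaf m t" "\<forall>x\<in>set (m_els m). \<forall>y\<in>set (m_els m). mt t x y = f x y" by blast
  then show ?thesis
    using good_by_leaf[OF S IH solved_modes[of m, unfolded m_solved_def] m_leaf_closed] by blast
qed

subsection \<open>Labelling a semigroup\<close>

definition all_els :: "elt list" where
  "all_els = [E0, E1, E2, E3, E4]"

lemma set_take_els: "x \<in> set (take n all_els) \<longleftrightarrow> num x < n \<and> x \<noteq> EU"
proof -
  consider "n = 0" | "n = 1" | "n = 2" | "n = 3" | "n = 4" | k where "n = Suc (Suc (Suc (Suc (Suc k))))"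
    by (metis One_nat_def Suc_1 numeral_3_eq_3 numeral_2_eq_2 eval_nat_numeral(2) not0_implies_Suc numeral_eq_Suc pred_numeral_simps(2) semiring_norm(26) semiring_norm(27))
  then show ?thesis by cases (cases x; auto simp: all_els_def)+
qed

text \<open>The label with number \<open>i\<close> stands for \<open>xs ! i\<close>. All
  normalisation consists in choosing the order of \<open>xs\<close>.\<close>

lemma labelling:
  fixes S :: "'a sg"
  assumes S: "is_fsemigroup S" and xs: "distinct xs" "set xs = sg_car S" "length xs = n" "n \<le> 5"
  obtains f where "is_fsemigroup (set (take n all_els), f)"
    and "good S \<longleftrightarrow> good (set (take n all_els), f)"
    and "\<And>x y. x \<in> set (take n all_els) \<Longrightarrow> y \<in> set (take n all_els) \<Longrightarrow>
      f x y \<in> set (take n all_els) \<and> xs ! num (f x y) = sg_mult S (xs ! num x) (xs ! num y)"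
    and "card (set (take n all_els)) = n"
proof -
  let ?E = "set (take n all_els)" and ?h = "\<lambda>x. xs ! num x"
  have idx: "\<exists>x. x \<in> ?E \<and> num x = i" if "i < n" for i
  proof -
    have "i = 0 \<or> i = 1 \<or> i = 2 \<or> i = 3 \<or> i = 4" using that xs(4) by linarith
    then show ?thesis using that
      by (elim disjE) (auto simp: set_take_els intro: exI[of _ E0] exI[of _ E1] exI[of _ E2] exI[of _ E3] exI[of _ E4])
  qed
  have bij: "bij_betw ?h ?E (sg_car S)"
    unfolding bij_betw_def
  proof
    show "inj_on ?h ?E"
      using xs by (auto simp: inj_on_def set_take_els nth_eq_iff_index_eq inj_num)
    show "?h ` ?E = sg_car S"
    proof
      have "?h x \<in> set xs" if "x \<in> ?E" for x using that xs(3) by (intro nth_mem) (simp add: set_take_els)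
      then show "?h ` ?E \<subseteq> sg_car S" using xs(2) by blast
      show "sg_car S \<subseteq> ?h ` ?E"
      proof
        fix s assume "s \<in> sg_car S"
        then obtain i where "i < n" "s = xs ! i" using xs by (metis in_set_conv_nth)
        then show "s \<in> ?h ` ?E" using idx by blast
      qed
    qed
  qed
  define f where "f = (\<lambda>x y. inv_into ?E ?h (sg_mult S (?h x) (?h y)))"
  have car: "?h x \<in> sg_car S" if "x \<in> ?E" for x using bij that by (auto simp: bij_betw_def)
  have f: "f x y \<in> ?E \<and> ?h (f x y) = sg_mult S (?h x) (?h y)" if "x \<in> ?E" "y \<in> ?E" for x y
  proof -
    have "sg_mult S (?h x) (?h y) \<in> ?h ` ?E"
      using bij fsg_closed[OF S car[OF that(1)] car[OF that(2)]] by (simp add: bij_betw_def)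
    then show ?thesis unfolding f_def using f_inv_into_f[of _ ?h ?E] inv_into_into[of _ ?h ?E] by blast
  qed
  have hom: "sg_hom ?h (?E, f) S" using f car by (auto simp: sg_hom_def)
  then have iso: "sg_iso (?E, f) S" unfolding sg_iso_def using bij by auto
  have inv: "sg_hom (inv_into ?E ?h) S (?E, f)"
    unfolding sg_hom_def
  proof (intro conjI ballI)
    show "inv_into ?E ?h x \<in> sg_car (?E, f)" if "x \<in> sg_car S" for x
      using bij that by (simp add: bij_betw_def inv_into_into)
    fix x y assume "x \<in> sg_car S" "y \<in> sg_car S"
    then show "inv_into ?E ?h (sg_mult S x y) = sg_mult (?E, f) (inv_into ?E ?h x) (inv_into ?E ?h y)"
      using bij f_inv_into_f[of x ?h ?E] f_inv_into_f[of y ?h ?E] by (simp add: f_def bij_betw_def)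
  qed
  have "inv_into ?E ?h ` sg_car S = ?E"
    using bij by (metis bij_betw_def bij_betw_inv_into)
  then have fsg: "is_fsemigroup (?E, f)" using fsg_hom_image[OF S inv] by simp
  have "good S \<longleftrightarrow> good (?E, f)" using good_iso[OF fsg iso] by simp
  moreover have "card ?E = n"
    using bij_betw_same_card[OF bij] xs distinct_card[OF xs(1)] by simp
  ultimately show thesis using that fsg f by blast
qed

lemma list_of_set:
  assumes "finite A"
  obtains xs where "set xs = A" "distinct xs"
  using finite_distinct_list[OF assms] by blast

text \<open>Stated for \<open>elt\<close>, because the quotients taken at a leaf live on the
  labels.\<close>

definition IH :: "nat \<Rightarrow> bool" where
  "IH n \<longleftrightarrow> (\<forall>Q :: elt sg. is_fsemigroup Q \<longrightarrow> 2 \<le> card (sg_car Q) \<longrightarrow> card (sg_car Q) < n \<longrightarrow> good Q)"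

lemma IHD: "IH n \<Longrightarrow> is_fsemigroup (Q :: elt sg) \<Longrightarrow> 2 \<le> card (sg_car Q) \<Longrightarrow> card (sg_car Q) < n \<Longrightarrow> good Q"
  by (auto simp: IH_def simp del: split_paired_All)

lemma extendsI: "(\<And>x y. x \<in> set es \<Longrightarrow> y \<in> set es \<Longrightarrow> mt t x y \<noteq> EU \<Longrightarrow> mt t x y = f x y) \<Longrightarrow> extends es f t"
  by (auto simp: extends_def)

subsection \<open>Semigroups with zero and a nonzero idempotent\<close>

text \<open>Each \<open>kind\<close> of a product is at most three, so the weights 16, 4 and 1 make
  this number encode the lexicographic comparison of \<open>key_greater\<close>.\<close>

definition key_of :: "(elt \<Rightarrow> elt \<Rightarrow> elt) \<Rightarrow> elt \<Rightarrow> nat" where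
  "key_of f x = 16 * num (kind (f E1 x) x) + 4 * num (kind (f x E1) x) + num (kind (f x x) x)"

lemma kind_bound: "v \<noteq> EU \<Longrightarrow> num (kind v x) \<le> 3" and kind_EU: "kind v x = EU \<longleftrightarrow> v = EU"
  by (cases v; simp)+

lemma cmp_gt: "cmp p q = E2 \<Longrightarrow> p \<noteq> EU \<and> q \<noteq> EU \<and> num p > num q"
  and cmp_eq: "cmp p q = E1 \<Longrightarrow> p \<noteq> EU \<and> q \<noteq> EU \<and> p = q"
  by (cases p; cases q; simp add: cmp_def mt_def)+

lemma key2_iff: "key2 c t x y \<longleftrightarrow> c = E2 \<or> c = E1 \<and> key3 (cmp (kind (mt t x E1) x) (kind (mt t y E1) y)) t x y"
  and key3_iff: "key3 c t x y \<longleftrightarrow> c = E2 \<or> c = E1 \<and> cmp (kind (mt t x x) x) (kind (mt t y y) y) = E2"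
  by (cases c; simp)+

text \<open>A comparison that comes out as greater or equal has used known entries only, and these
  are entries of \<open>f\<close>.\<close>

lemma key_greater_sound:
  assumes ext: "extends es f t" and x: "x \<in> set es" "y \<in> set es" "E1 \<in> set es"
    and cl: "\<And>x y. x \<in> set es \<Longrightarrow> y \<in> set es \<Longrightarrow> f x y \<noteq> EU"
    and "key_greater t x y"
  shows "key_of f y < key_of f x"
proof -
  have k: "kind (mt t a b) c \<noteq> EU \<Longrightarrow> mt t a b = f a b" if "a \<in> set es" "b \<in> set es" for a b c
    using extends_mt[OF ext that] by (simp add: kind_EU)
  have b: "num (kind (f a b) c) \<le> 3" if "a \<in> set es" "b \<in> set es" for a b c
    using kind_bound cl[OF that] by blast
  note bs = b[of x E1 x] b[of x x x] b[of y E1 y] b[of y y y]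
  consider "cmp (kind (mt t E1 x) x) (kind (mt t E1 y) y) = E2"
    | "cmp (kind (mt t E1 x) x) (kind (mt t E1 y) y) = E1" "cmp (kind (mt t x E1) x) (kind (mt t y E1) y) = E2"
    | "cmp (kind (mt t E1 x) x) (kind (mt t E1 y) y) = E1" "cmp (kind (mt t x E1) x) (kind (mt t y E1) y) = E1"
      "cmp (kind (mt t x x) x) (kind (mt t y y) y) = E2"
    using assms(6) by (auto simp: key_greater_def key2_iff key3_iff)
  then show ?thesis
  proof cases
    case 1
    note g = cmp_gt[OF 1]
    have "mt t E1 x = f E1 x" "mt t E1 y = f E1 y" using g k x by blast+
    then have "num (kind (f E1 y) y) < num (kind (f E1 x) x)" using g by simp
    then show ?thesis using bs x unfolding key_of_def by linarith
  next
    case 2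
    note g = cmp_eq[OF 2(1)] cmp_gt[OF 2(2)]
    have "mt t E1 x = f E1 x" "mt t E1 y = f E1 y" "mt t x E1 = f x E1" "mt t y E1 = f y E1" using g k x by blast+
    then have "num (kind (f E1 y) y) = num (kind (f E1 x) x)" "num (kind (f y E1) y) < num (kind (f x E1) x)"
      using g by simp_all
    then show ?thesis using bs x unfolding key_of_def by linarith
  next
    case 3
    note g = cmp_eq[OF 3(1)] cmp_eq[OF 3(2)] cmp_gt[OF 3(3)]
    have "mt t E1 x = f E1 x" "mt t E1 y = f E1 y" "mt t x E1 = f x E1" "mt t y E1 = f y E1"
      "mt t x x = f x x" "mt t y y = f y y" using g k x by blast+
    then have "num (kind (f E1 y) y) = num (kind (f E1 x) x)" "num (kind (f y E1) y) = num (kind (f x E1) x)"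
      "num (kind (f y y) y) < num (kind (f x x) x)"
      using g by simp_all
    then show ?thesis unfolding key_of_def by linarith
  qed
qed

lemma unsorted_sound:
  assumes ext: "extends es f t" and E1: "E1 \<in> set es"
    and cl: "\<And>x y. x \<in> set es \<Longrightarrow> y \<in> set es \<Longrightarrow> f x y \<noteq> EU"
  shows "set (x # ys) \<subseteq> set es \<Longrightarrow> sorted (map (key_of f) (x # ys)) \<Longrightarrow> \<not> unsorted False x ys t"
proof (induction ys arbitrary: x)
  case (Cons y ys)
  have "\<not> key_greater t x y"
    using key_greater_sound[OF ext _ _ E1 cl, of x y] Cons.prems by (auto simp: leD)
  then show ?case using Cons by auto
qed simp

lemma zero_init: "m_fam m = Fam_zero \<Longrightarrow> x \<in> set (m_els m) \<Longrightarrow> y \<in> set (m_els m) \<Longrightarrow> mt (m_init m) x y \<noteq> EU \<Longrightarrow>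
    (x = E0 \<or> y = E0) \<and> mt (m_init m) x y = E0 \<or> x = E1 \<and> y = E1 \<and> mt (m_init m) x y = E1"
  by (cases m) (auto simp: mt_def)

lemma good_zero_f:
  assumes m: "m_fam m = Fam_zero" "m_els m = take n all_els" "2 \<le> n" "n \<le> 5"
    and S: "is_fsemigroup (set (m_els m), f)" "card (set (m_els m)) = n" and IH: "IH n"
    and zero: "\<And>x. x \<in> set (m_els m) \<Longrightarrow> f E0 x = E0 \<and> f x E0 = E0" and idem: "f E1 E1 = E1"
    and sorted: "sorted (map (key_of f) (tl (tl (m_els m))))"
  shows "good (set (m_els m), f)"
proof (rule mode_good[OF S(1)])
  have cl: "f x y \<in> set (m_els m)" if "x \<in> set (m_els m)" "y \<in> set (m_els m)" for x y
    using fsg_closed[OF S(1)] that by simp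
  then have clU: "f x y \<noteq> EU" if "x \<in> set (m_els m)" "y \<in> set (m_els m)" for x y
    using that EU_els by metis
  show "extends (m_els m) f (m_init m)"
    using zero_init[OF m(1)] zero idem by (intro extendsI) metis
  show "f x y \<in> set (cand_of (m_fam m) (m_els m) t x y)" if "x \<in> set (m_els m)" "y \<in> set (m_els m)" for t x y
    using cl that m(1) by simp
  fix t assume ext: "extends (m_els m) f t"
  show "\<not> prune_of (m_fam m) (m_els m) t"
  proof (cases "n = 2")
    case True
    then show ?thesis using m by (simp add: all_els_def)
  next
    case False
    then have n: "n = 3 \<or> n = 4 \<or> n = 5" using m(3,4) by linarith
    then have e: "tl (tl (m_els m)) = E2 # tl (tl (tl (m_els m)))" "E1 \<in> set (m_els m)"
      "set (tl (tl (m_els m))) \<subseteq> set (m_els m)"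
      using m(2) by (auto simp: all_els_def)
    show ?thesis
      using unsorted_sound[OF ext e(2) clU, of E2 "tl (tl (tl (m_els m)))"] e sorted m(1) by simp
  qed
qed (use S m IHD[OF IH] in auto)

lemma size_cases: "2 \<le> n \<Longrightarrow> n \<le> 5 \<Longrightarrow> n = 2 \<or> n = 3 \<or> n = 4 \<or> n = (5 :: nat)"
  by linarith

lemma num_nth_els: "i < 5 \<Longrightarrow> num (all_els ! i) = i"
proof -
  assume "i < 5"
  then have "i = 0 \<or> i = 1 \<or> i = 2 \<or> i = 3 \<or> i = 4" by auto
  then show ?thesis by (auto simp: all_els_def)
qed

lemma length_all_els: "length all_els = 5"
  by (simp add: all_els_def)

lemma map_nth_els: "length xs = n \<Longrightarrow> n \<le> 5 \<Longrightarrow> map (\<lambda>x. xs ! num x) (take n all_els) = xs"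
  by (intro nth_equalityI) (auto simp: num_nth_els length_all_els)

lemma in_set_tl: "x \<in> set (tl l) \<Longrightarrow> x \<in> set l"
  by (cases l) auto

lemma nth_num_inj:
  "distinct xs \<Longrightarrow> length xs = n \<Longrightarrow> x \<in> set (take n all_els) \<Longrightarrow> y \<in> set (take n all_els) \<Longrightarrow>
    xs ! num x = xs ! num y \<longleftrightarrow> x = y"
  by (auto simp: set_take_els nth_eq_iff_index_eq inj_num)

lemma kind_alt: "kind v x = (if v = EU then EU else if v = E0 then E0 else if v = E1 then E1 else if v = x then E2 else E3)"
  by (cases v) auto

text \<open>Zero and idempotent become \<open>E0\<close> and \<open>E1\<close>; the other elements
  are sorted by their keys, so that the pruning of unsorted tables never removes this
  labelling.\<close>

lemma good_zero:
  fixes S :: "'a sg"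
  assumes S: "is_fsemigroup S" and n: "card (sg_car S) = n" "2 \<le> n" "n \<le> 5" and IH: "IH n"
    and z: "z \<in> sg_car S" "\<And>x. x \<in> sg_car S \<Longrightarrow> sg_mult S z x = z \<and> sg_mult S x z = z"
    and e: "e \<in> sg_car S" "sg_mult S e e = e" "e \<noteq> z"
  shows "good S"
proof -
  let ?m = "sg_mult S"
  \<comment> \<open>\<open>kind\<close> read in \<open>S\<close> before there are labels. It
    mentions only \<open>z\<close>, \<open>e\<close> and the element itself, so it is independent of
    the numbering of the rest.\<close>
  define kk where "kk = (\<lambda>v x. if v = z then 0 else if v = e then 1 else if v = x then 2 else 3 :: nat)"
  define key where "key = (\<lambda>x. 16 * kk (?m e x) x + 4 * kk (?m x e) x + kk (?m x x) x)"
  obtain rs where rs: "set rs = sg_car S - {z, e}" "distinct rs"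
    using list_of_set[of "sg_car S - {z, e}"] fsg_finite[OF S] by blast
  define xs where "xs = z # e # sort_key key rs"
  have xs: "distinct xs" "set xs = sg_car S" using rs z(1) e by (auto simp: xs_def)
  then have len: "length xs = n" using n(1) distinct_card by metis
  obtain f where f: "is_fsemigroup (set (take n all_els), f)" "good S \<longleftrightarrow> good (set (take n all_els), f)"
      "\<And>x y. x \<in> set (take n all_els) \<Longrightarrow> y \<in> set (take n all_els) \<Longrightarrow>
        f x y \<in> set (take n all_els) \<and> xs ! num (f x y) = ?m (xs ! num x) (xs ! num y)"
      "card (set (take n all_els)) = n"
    using labelling[OF S xs len n(3)] by blast
  let ?E = "set (take n all_els)"
  have E: "E0 \<in> ?E" "E1 \<in> ?E" using n by (auto simp: set_take_els)
  have h01: "xs ! num E0 = z" "xs ! num E1 = e" by (simp_all add: xs_def)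
  have hS: "xs ! num x \<in> sg_car S" if "x \<in> ?E" for x
    using that len xs(2) by (metis nth_mem set_take_els)
  note inj = nth_num_inj[OF xs(1) len]
  obtain m where m: "m_fam m = Fam_zero" "m_els m = take n all_els"
    using size_cases[OF n(2,3)] by (elim disjE) (auto simp: all_els_def intro: that[of Zero2] that[of Zero3] that[of Zero4] that[of Zero5])
  have kk: "num (kind v x) = kk (xs ! num v) (xs ! num x)" if "v \<in> ?E" "x \<in> ?E" for v x
  proof -
    have "v \<noteq> EU" using that by (simp add: set_take_els)
    moreover have "xs ! num v = z \<longleftrightarrow> v = E0" "xs ! num v = e \<longleftrightarrow> v = E1" using inj[OF that(1) E(1)] inj[OF that(1) E(2)] h01 by auto
    ultimately show ?thesis using inj[OF that] by (simp add: kk_def kind_alt)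
  qed
  have key: "key_of f x = key (xs ! num x)" if "x \<in> ?E" for x
    using f(3)[OF E(2) that] f(3)[OF that E(2)] f(3)[OF that that] kk that h01
    by (simp add: key_of_def key_def)
  have map: "map (\<lambda>x. xs ! num x) (tl (tl (take n all_els))) = tl (tl xs)"
    using arg_cong[OF map_nth_els[OF len n(3)], of "\<lambda>l. tl (tl l)"] by (simp add: map_tl)
  have "map (key_of f) (tl (tl (take n all_els))) = map (key \<circ> (\<lambda>x. xs ! num x)) (tl (tl (take n all_els)))"
    using key by (auto dest!: in_set_tl)
  also have "\<dots> = map key (sort_key key rs)"
    using arg_cong[OF map, of "map key"] by (simp add: xs_def)
  finally have sorted: "sorted (map (key_of f) (tl (tl (m_els m))))" using m(2) by simp
  have "good (set (m_els m), f)"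
  proof (rule good_zero_f[OF m n(2,3) _ _ IH _ _ sorted])
    show "f E0 x = E0 \<and> f x E0 = E0" if "x \<in> set (m_els m)" for x
    proof -
      have x: "x \<in> ?E" using that m(2) by simp
      have "xs ! num (f E0 x) = xs ! num E0" "xs ! num (f x E0) = xs ! num E0"
        using f(3)[OF E(1) x] f(3)[OF x E(1)] z(2)[OF hS[OF x]] h01 by auto
      then show ?thesis using inj f(3)[OF E(1) x] f(3)[OF x E(1)] E(1) by blast
    qed
    have "xs ! num (f E1 E1) = xs ! num E1" using f(3)[OF E(2,2)] h01 e by simp
    then show "f E1 E1 = E1" using inj f(3)[OF E(2,2)] E(2) by blast
  qed (use f m in simp_all)
  then show ?thesis using f(2) m(2) by simp
qed

subsection \<open>Nilpotent semigroups\<close>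

text \<open>Induction on the size of the subsemigroup \<open>A\<close>. For \<open>a\<close> in
  \<open>A\<close>, either \<open>Aa\<close> is a smaller subsemigroup, or \<open>a\<close> lies in
  \<open>Aa\<close> and its stabiliser \<open>{x. xa = a}\<close> is nonempty. The stabiliser is
  smaller than \<open>A\<close>, or it contains \<open>a\<close> itself.\<close>

lemma closed_has_idempotent:
  assumes S: "is_fsemigroup S" and "A \<subseteq> sg_car S" "A \<noteq> {}" "\<And>x y. x \<in> A \<Longrightarrow> y \<in> A \<Longrightarrow> sg_mult S x y \<in> A"
  shows "\<exists>a\<in>A. sg_mult S a a = a"
  using assms(2-)
proof (induction "card A" arbitrary: A rule: less_induct)
  case less
  let ?m = "sg_mult S"
  have fin: "finite A" using less.prems(1) fsg_finite[OF S] finite_subset by blast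
  note assoc = fsg_assoc[OF S]
  obtain a where a: "a \<in> A" using less.prems(2) by blast
  let ?B = "(\<lambda>x. ?m x a) ` A" and ?C = "{x \<in> A. ?m x a = a}"
  have B: "?B \<subseteq> A" using less.prems(3) a by auto
  show ?case
  proof (cases "?B = A")
    case False
    have "\<exists>b\<in>?B. ?m b b = b"
    proof (rule less.hyps)
      show "card ?B < card A" using B False fin by (simp add: psubset_card_mono psubsetI)
      show "?m x y \<in> ?B" if xy: "x \<in> ?B" "y \<in> ?B" for x y
      proof -
        obtain u v where uv: "u \<in> A" "v \<in> A" "x = ?m u a" "y = ?m v a" using xy by auto
        have "?m x y = ?m (?m x v) a" using uv a less.prems assoc by (metis B subsetD xy(1))
        moreover have "?m x v \<in> A" using less.prems(3) B xy(1) uv(2) by blast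
        ultimately show ?thesis by blast
      qed
    qed (use B less.prems in auto)
    then show ?thesis using B by blast
  next
    case True
    then have ne: "?C \<noteq> {}" using a by auto (metis (mono_tags, lifting) imageE)
    show ?thesis
    proof (cases "?C = A")
      case True
      then show ?thesis using a by blast
    next
      case False
      have "\<exists>b\<in>?C. ?m b b = b"
      proof (rule less.hyps)
        show "card ?C < card A" using False fin by (intro psubset_card_mono) auto
        show "?m x y \<in> ?C" if "x \<in> ?C" "y \<in> ?C" for x y
        proof -
          have xy: "x \<in> A" "y \<in> A" "?m x a = a" "?m y a = a" using that by auto
          then have "?m (?m x y) a = a" using assoc[of x y a] a less.prems(1) by auto
          then show ?thesis using xy less.prems(3) by blast
        qed
      qed (use ne less.prems in auto)
      then show ?thesis by blast
    qed
  qed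
qed

lemma lower_iff: "x \<noteq> EU \<Longrightarrow> v \<in> set (lower x) \<longleftrightarrow> v \<noteq> EU \<and> num v < num x"
  by (cases x; cases v) simp_all

lemma common_iff: "v \<in> set (common xs ys) \<longleftrightarrow> v \<in> set xs \<and> v \<in> set ys"
  by (induction xs) auto

lemma nil_init: "m_fam m = Fam_nil \<Longrightarrow> x \<in> set (m_els m) \<Longrightarrow> y \<in> set (m_els m) \<Longrightarrow> mt (m_init m) x y \<noteq> EU \<Longrightarrow>
    (x = E0 \<or> y = E0) \<and> mt (m_init m) x y = E0"
  by (cases m) (auto simp: mt_def)

lemma nil_cells: "m_fam m = Fam_nil \<Longrightarrow> (x, y) \<in> set (m_cells m) \<Longrightarrow> x \<noteq> E0 \<and> y \<noteq> E0"
  by (cases m) auto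

lemma good_nil_f:
  assumes m: "m_fam m = Fam_nil" "m_els m = take n all_els" "2 \<le> n" "n \<le> 5"
    and S: "is_fsemigroup (set (m_els m), f)" "card (set (m_els m)) = n" and IH: "IH n"
    and zero: "\<And>x. x \<in> set (m_els m) \<Longrightarrow> f E0 x = E0 \<and> f x E0 = E0"
    and less: "\<And>x y. x \<in> set (m_els m) \<Longrightarrow> y \<in> set (m_els m) \<Longrightarrow> x \<noteq> E0 \<Longrightarrow> y \<noteq> E0 \<Longrightarrow>
      num (f x y) < num x \<and> num (f x y) < num y"
  shows "good (set (m_els m), f)"
proof (rule mode_good[OF S(1)])
  have cl: "f x y \<in> set (m_els m)" if "x \<in> set (m_els m)" "y \<in> set (m_els m)" for x y
    using fsg_closed[OF S(1)] that by simp
  then have clU: "f x y \<noteq> EU" if "x \<in> set (m_els m)" "y \<in> set (m_els m)" for x y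
    using that EU_els by metis
  show "extends (m_els m) f (m_init m)"
    using nil_init[OF m(1)] zero by (intro extendsI) metis
  show "f x y \<in> set (cand_of (m_fam m) (m_els m) t x y)"
    if "x \<in> set (m_els m)" "y \<in> set (m_els m)" "(x, y) \<in> set (m_cells m)" for t x y
  proof -
    have "x \<noteq> EU" "y \<noteq> EU" using that(1,2) EU_els by metis+
    then show ?thesis
      using less[OF that(1,2)] nil_cells[OF m(1) that(3)] clU[OF that(1,2)] m(1) by (simp add: common_iff lower_iff)
  qed
qed (use S m IHD[OF IH] in auto)

text \<open>A nonzero product generates a principal ideal strictly inside those of both factors.
  Ordering the elements by the size of their principal ideals therefore places each nonzero product
  before its factors.\<close>

lemma good_nil:
  fixes S :: "'a sg"
  assumes S: "is_fsemigroup S" and n: "card (sg_car S) = n" "2 \<le> n" "n \<le> 5" and IH: "IH n"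
    and z: "z \<in> sg_car S" "\<And>x. x \<in> sg_car S \<Longrightarrow> sg_mult S z x = z \<and> sg_mult S x z = z"
    and idem: "\<And>x. x \<in> sg_car S \<Longrightarrow> sg_mult S x x = x \<Longrightarrow> x = z"
  shows "good S"
proof -
  let ?m = "sg_mult S" and ?S = "sg_car S"
  note cl = fsg_closed[OF S] and assoc = fsg_assoc[OF S]
  have z_in: "z \<in> A" if "A \<subseteq> ?S" "A \<noteq> {}" "\<And>x y. x \<in> A \<Longrightarrow> y \<in> A \<Longrightarrow> ?m x y \<in> A" for A
    using closed_has_idempotent[OF S that] idem that(1) by (metis subsetD)
  \<comment> \<open>The stabiliser of \<open>x\<close> is a subsemigroup, so it contains the only
    idempotent \<open>z\<close>, and \<open>x = xz = z\<close>.\<close>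
  have fix_r: "x = z" if "x \<in> ?S" "w \<in> ?S" "x = ?m x w" for x w
  proof -
    have "z \<in> {w \<in> ?S. ?m x w = x}"
      by (rule z_in) (use that cl in \<open>auto simp flip: assoc\<close>)
    then show ?thesis using z that(1) by auto
  qed
  have fix_l: "x = z" if "x \<in> ?S" "w \<in> ?S" "x = ?m w x" for x w
  proof -
    have "z \<in> {w \<in> ?S. ?m w x = x}"
      by (rule z_in) (use that cl in \<open>auto simp: assoc\<close>)
    then show ?thesis using z that(1) by auto
  qed
  have fix_lr: "x = z" if "x \<in> ?S" "p \<in> ?S" "w \<in> ?S" "x = ?m (?m p x) w" for x p w
  proof -
    \<comment> \<open>The set is closed because witnesses multiply in reverse order:
      \<open>p\<close> for \<open>u\<close> and \<open>q\<close> for \<open>v\<close> give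
      \<open>q p\<close> for \<open>u v\<close>.\<close>
    have "z \<in> {w \<in> ?S. \<exists>p\<in>?S. ?m (?m p x) w = x}"
    proof (rule z_in)
      fix u v assume "u \<in> {w \<in> ?S. \<exists>p\<in>?S. ?m (?m p x) w = x}" "v \<in> {w \<in> ?S. \<exists>p\<in>?S. ?m (?m p x) w = x}"
      then obtain p q where pq: "u \<in> ?S" "v \<in> ?S" "p \<in> ?S" "q \<in> ?S" "?m (?m p x) u = x" "?m (?m q x) v = x" by auto
      have "?m (?m (?m q p) x) (?m u v) = ?m (?m q (?m (?m p x) u)) v"
        using pq(1-4) that(1) cl assoc by simp
      also have "\<dots> = x" using pq by simp
      finally show "?m u v \<in> {w \<in> ?S. \<exists>p\<in>?S. ?m (?m p x) w = x}" using pq cl by blast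
    qed (use that(2,3) that(4)[symmetric] in auto)
    then obtain p where "p \<in> ?S" "?m (?m p x) z = x" by auto
    then show ?thesis using z cl that(1) by metis
  qed
  \<comment> \<open>The principal two-sided ideal, spelled out in four parts because no identity
    element is available.\<close>
  define I where "I = (\<lambda>x. {x} \<union> (\<lambda>s. ?m s x) ` ?S \<union> (\<lambda>s. ?m x s) ` ?S \<union> (\<lambda>(s, t). ?m (?m s x) t) ` (?S \<times> ?S))"
  have I_iff: "w \<in> I x \<longleftrightarrow> w = x \<or> (\<exists>s\<in>?S. w = ?m s x) \<or> (\<exists>s\<in>?S. w = ?m x s) \<or> (\<exists>s\<in>?S. \<exists>t\<in>?S. w = ?m (?m s x) t)"
    for w x by (auto simp: I_def)
  have I_sub: "I (?m x y) \<subseteq> I x" "I (?m x y) \<subseteq> I y" if xy: "x \<in> ?S" "y \<in> ?S" for x y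
  proof -
    have "w \<in> I x \<and> w \<in> I y" if "w \<in> I (?m x y)" for w
    proof -
      from that consider "w = ?m x y" | s where "s \<in> ?S" "w = ?m s (?m x y)" | s where "s \<in> ?S" "w = ?m (?m x y) s"
        | s t where "s \<in> ?S" "t \<in> ?S" "w = ?m (?m s (?m x y)) t"
        unfolding I_iff by blast
      then show ?thesis
      proof cases
        case 1
        then show ?thesis unfolding I_iff using xy by blast
      next
        case 2
        then have "w = ?m (?m s x) y" "?m s x \<in> ?S" using xy cl assoc by auto
        then show ?thesis unfolding I_iff using xy 2(1) by blast
      next
        case 3
        then have "w = ?m x (?m y s)" "?m y s \<in> ?S" using xy cl assoc by auto
        then show ?thesis unfolding I_iff using xy 3 by blast
      next
        case 4
        then have "w = ?m (?m s x) (?m y t)" "?m y t \<in> ?S" "w = ?m (?m (?m s x) y) t" "?m s x \<in> ?S"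
          using xy cl assoc by auto
        then show ?thesis unfolding I_iff using 4(1,2) by blast
      qed
    qed
    then show "I (?m x y) \<subseteq> I x" "I (?m x y) \<subseteq> I y" by auto
  qed
  have I_notin: "x \<notin> I (?m x y)" "y \<notin> I (?m x y)" if "x \<in> ?S" "y \<in> ?S" "?m x y \<noteq> z" for x y
  proof -
    have nz: "x \<noteq> z" "y \<noteq> z" using that z by auto
    show "x \<notin> I (?m x y)"
    proof
      assume "x \<in> I (?m x y)"
      then consider "x = ?m x y" | s where "s \<in> ?S" "x = ?m s (?m x y)" | s where "s \<in> ?S" "x = ?m (?m x y) s"
        | s t where "s \<in> ?S" "t \<in> ?S" "x = ?m (?m s (?m x y)) t"
        unfolding I_def by auto
      then show False
      proof cases
        case 1 then show ?thesis using fix_r that nz by blast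
      next
        case 2 then show ?thesis using fix_lr[of x s y] that nz assoc by simp
      next
        case 3 then show ?thesis using fix_r[of x "?m y s"] that nz assoc cl by simp
      next
        case 4 then show ?thesis using fix_lr[of x s "?m y t"] that nz assoc cl by simp
      qed
    qed
    show "y \<notin> I (?m x y)"
    proof
      assume "y \<in> I (?m x y)"
      then consider "y = ?m x y" | s where "s \<in> ?S" "y = ?m s (?m x y)" | s where "s \<in> ?S" "y = ?m (?m x y) s"
        | s t where "s \<in> ?S" "t \<in> ?S" "y = ?m (?m s (?m x y)) t"
        unfolding I_def by auto
      then show False
      proof cases
        case 1 then show ?thesis using fix_l that nz by blast
      next
        case 2 then show ?thesis using fix_l[of y "?m s x"] that nz assoc cl by simp
      next
        case 3 then show ?thesis using fix_lr[of y x s] that nz assoc by simp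
      next
        case 4 then show ?thesis using fix_lr[of y "?m s x" t] that nz assoc cl by simp
      qed
    qed
  qed
  have I_fin: "finite (I x)" for x using fsg_finite[OF S] by (auto simp: I_def)
  have I_less: "card (I (?m x y)) < card (I x) \<and> card (I (?m x y)) < card (I y)"
    if "x \<in> ?S" "y \<in> ?S" "?m x y \<noteq> z" for x y
  proof -
    have "x \<in> I x" "y \<in> I y" by (auto simp: I_def)
    then show ?thesis using I_sub[OF that(1,2)] I_notin[OF that] I_fin by (metis psubsetI psubset_card_mono)
  qed
  obtain rs where rs: "set rs = ?S - {z}" "distinct rs"
    using list_of_set[of "?S - {z}"] fsg_finite[OF S] by blast
  define ys where "ys = sort_key (\<lambda>x. card (I x)) rs"
  define xs where "xs = z # ys"
  have xs: "distinct xs" "set xs = ?S" using rs z(1) by (auto simp: xs_def ys_def)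
  then have len: "length xs = n" using n(1) distinct_card by metis
  obtain f where f: "is_fsemigroup (set (take n all_els), f)" "good S \<longleftrightarrow> good (set (take n all_els), f)"
      "\<And>x y. x \<in> set (take n all_els) \<Longrightarrow> y \<in> set (take n all_els) \<Longrightarrow>
        f x y \<in> set (take n all_els) \<and> xs ! num (f x y) = ?m (xs ! num x) (xs ! num y)"
      "card (set (take n all_els)) = n"
    using labelling[OF S xs len n(3)] by blast
  let ?E = "set (take n all_els)"
  have E: "E0 \<in> ?E" using n by (auto simp: set_take_els)
  have h0: "xs ! num E0 = z" by (simp add: xs_def)
  have hS: "xs ! num x \<in> ?S" if "x \<in> ?E" for x
    using that len xs(2) by (metis nth_mem set_take_els)
  note inj = nth_num_inj[OF xs(1) len]
  obtain m where m: "m_fam m = Fam_nil" "m_els m = take n all_els"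
    using size_cases[OF n(2,3)] by (elim disjE) (auto simp: all_els_def intro: that[of Nil2] that[of Nil3] that[of Nil4] that[of Nil5])
  have mono: "num v < num x" if "v \<in> ?E" "x \<in> ?E" "x \<noteq> E0" "v \<noteq> E0 \<Longrightarrow> card (I (xs ! num v)) < card (I (xs ! num x))" for v x
  proof (cases "v = E0")
    case True
    then show ?thesis using that by (cases x) auto
  next
    case False
    show ?thesis
    proof (rule ccontr)
      assume "\<not> num v < num x"
      \<comment> \<open>The zero stands in front of \<open>ys\<close>, so labels are shifted by one
        against positions in \<open>ys\<close>.\<close>
      then have le: "num x - 1 \<le> num v - 1" by simp
      have pos: "0 < num v" "0 < num x" using False that(3) by (cases v; cases x; simp)+
      have "sorted (map (\<lambda>x. card (I x)) ys)" by (simp add: ys_def)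
      moreover have "num v - 1 < length ys" using pos(1) that(1) len by (auto simp: xs_def set_take_els)
      ultimately have "card (I (ys ! (num x - 1))) \<le> card (I (ys ! (num v - 1)))"
        using le sorted_nth_mono[of "map (\<lambda>x. card (I x)) ys" "num x - 1" "num v - 1"] by simp
      then show False using that(4)[OF False] pos by (simp add: xs_def nth_Cons')
    qed
  qed
  have "good (set (m_els m), f)"
  proof (rule good_nil_f[OF m n(2,3) _ _ IH])
    show "f E0 x = E0 \<and> f x E0 = E0" if "x \<in> set (m_els m)" for x
    proof -
      have x: "x \<in> ?E" using that m(2) by simp
      have "xs ! num (f E0 x) = xs ! num E0" "xs ! num (f x E0) = xs ! num E0"
        using f(3)[OF E(1) x] f(3)[OF x E(1)] z(2)[OF hS[OF x]] h0 by auto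
      then show ?thesis using inj f(3)[OF E(1) x] f(3)[OF x E(1)] E(1) by blast
    qed
    fix x y assume xy: "x \<in> set (m_els m)" "y \<in> set (m_els m)" "x \<noteq> E0" "y \<noteq> E0"
    then have E: "x \<in> ?E" "y \<in> ?E" "f x y \<in> ?E" using m(2) f(3) by auto
    have "card (I (xs ! num (f x y))) < card (I (xs ! num x)) \<and> card (I (xs ! num (f x y))) < card (I (xs ! num y))"
      if "f x y \<noteq> E0"
    proof -
      have "?m (xs ! num x) (xs ! num y) \<noteq> z"
        using that inj[OF E(3) \<open>E0 \<in> ?E\<close>] f(3)[OF E(1,2)] h0 by auto
      then show ?thesis using I_less hS E f(3)[OF E(1,2)] by simp
    qed
    then show "num (f x y) < num x \<and> num (f x y) < num y" using mono E xy(3,4) by blast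
  qed (use f m in simp_all)
  then show ?thesis using f(2) m(2) by simp
qed

subsection \<open>Groups\<close>

lemma in_row_iff: "in_row cs t x v \<longleftrightarrow> (\<exists>c\<in>set cs. mt t x c = v)"
  and in_col_iff: "in_col cs t y v \<longleftrightarrow> (\<exists>c\<in>set cs. mt t c y = v)"
  by (induction cs) auto

lemma latin_iff: "v \<in> set (latin vs es t x y) \<longleftrightarrow> v \<in> set vs \<and> \<not> in_row es t x v \<and> \<not> in_col es t y v"
  by (induction vs) auto

lemma group_init: "m_fam m = Fam_group \<Longrightarrow> x \<in> set (m_els m) \<Longrightarrow> y \<in> set (m_els m) \<Longrightarrow> mt (m_init m) x y \<noteq> EU \<Longrightarrow>
    x = E0 \<and> mt (m_init m) x y = y \<or> y = E0 \<and> mt (m_init m) x y = x"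
  by (cases m) (auto simp: mt_def)

text \<open>The identity is labelled \<open>E0\<close>; two-sided cancellation justifies the
  candidates of \<open>latin\<close>.\<close>

lemma good_group:
  fixes S :: "'a sg"
  assumes S: "is_fsemigroup S" and n: "card (sg_car S) = n" "2 \<le> n" "n \<le> 5" and IH: "IH n"
    and e: "e \<in> sg_car S" "\<And>x. x \<in> sg_car S \<Longrightarrow> sg_mult S e x = x \<and> sg_mult S x e = x"
    and inv: "\<And>x. x \<in> sg_car S \<Longrightarrow> \<exists>y\<in>sg_car S. sg_mult S x y = e \<and> sg_mult S y x = e"
  shows "good S"
proof -
  let ?m = "sg_mult S" and ?S = "sg_car S"
  have canc_l: "y = w" if "x \<in> ?S" "y \<in> ?S" "w \<in> ?S" "?m x y = ?m x w" for x y w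
    using inv[OF that(1)] e(2) that fsg_assoc[OF S] by metis
  have canc_r: "y = w" if "x \<in> ?S" "y \<in> ?S" "w \<in> ?S" "?m y x = ?m w x" for x y w
    using inv[OF that(1)] e(2) that fsg_assoc[OF S] by metis
  obtain rs where rs: "set rs = ?S - {e}" "distinct rs"
    using list_of_set[of "?S - {e}"] fsg_finite[OF S] by blast
  define xs where "xs = e # rs"
  have xs: "distinct xs" "set xs = ?S" using rs e(1) by (auto simp: xs_def)
  then have len: "length xs = n" using n(1) distinct_card by metis
  obtain f where f: "is_fsemigroup (set (take n all_els), f)" "good S \<longleftrightarrow> good (set (take n all_els), f)"
      "\<And>x y. x \<in> set (take n all_els) \<Longrightarrow> y \<in> set (take n all_els) \<Longrightarrow>
        f x y \<in> set (take n all_els) \<and> xs ! num (f x y) = ?m (xs ! num x) (xs ! num y)"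
      "card (set (take n all_els)) = n"
    using labelling[OF S xs len n(3)] by blast
  let ?E = "set (take n all_els)"
  have E: "E0 \<in> ?E" using n by (auto simp: set_take_els)
  have h0: "xs ! num E0 = e" by (simp add: xs_def)
  have hS: "xs ! num x \<in> ?S" if "x \<in> ?E" for x
    using that len xs(2) by (metis nth_mem set_take_els)
  note inj = nth_num_inj[OF xs(1) len]
  obtain m where m: "m_fam m = Fam_group" "m_els m = take n all_els"
    using size_cases[OF n(2,3)] by (elim disjE) (auto simp: all_els_def intro: that[of Grp2] that[of Grp3] that[of Grp4] that[of Grp5])
  have fl: "y = w" if "x \<in> ?E" "y \<in> ?E" "w \<in> ?E" "f x y = f x w" for x y w
    using canc_l[of "xs ! num x" "xs ! num y" "xs ! num w"] hS f(3) inj that by metis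
  have fr: "y = w" if "x \<in> ?E" "y \<in> ?E" "w \<in> ?E" "f y x = f w x" for x y w
    using canc_r[of "xs ! num x" "xs ! num y" "xs ! num w"] hS f(3) inj that by metis
  have id: "f E0 x = x \<and> f x E0 = x" if x: "x \<in> ?E" for x
  proof -
    have "xs ! num (f E0 x) = xs ! num x" "xs ! num (f x E0) = xs ! num x"
      using f(3)[OF E x] f(3)[OF x E] e(2)[OF hS[OF x]] h0 by auto
    then show ?thesis using inj f(3)[OF E x] f(3)[OF x E] x by blast
  qed
  have "good (set (m_els m), f)"
  proof (rule mode_good)
    show "extends (m_els m) f (m_init m)"
      using group_init[OF m(1)] id m(2) by (intro extendsI) metis
    fix t x y assume t: "extends (m_els m) f t" "x \<in> set (m_els m)" "y \<in> set (m_els m)" "mt t x y = EU"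
    have v: "f x y \<in> set (m_els m)" "f x y \<noteq> EU" using f(3) t(2,3) m(2) EU_els by metis+
    have "mt t x c \<noteq> f x y" if "c \<in> set (m_els m)" for c
      using extends_mt[OF t(1,2) that] fl[of x y c] t that v(2) m(2) by auto
    moreover have "mt t c y \<noteq> f x y" if "c \<in> set (m_els m)" for c
      using extends_mt[OF t(1) that t(3)] fr[of y x c] t that v(2) m(2) by auto
    ultimately show "f x y \<in> set (cand_of (m_fam m) (m_els m) t x y)"
      using v(1) m(1) by (auto simp: latin_iff in_row_iff in_col_iff)
  qed (use f m n IHD[OF IH] in auto)
  then show ?thesis using f(2) m(2) by simp
qed

subsection \<open>Faithful actions on left or right zeros\<close>

lemma left_init: "m_fam m = Fam_left ls \<Longrightarrow> x \<in> set (m_els m) \<Longrightarrow> y \<in> set (m_els m) \<Longrightarrow> mt (m_init m) x y \<noteq> EU \<Longrightarrow>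
    x \<in> set ls \<and> mt (m_init m) x y = x"
  by (cases m) (auto simp: mt_def)

lemma right_init: "m_fam m = Fam_right ls \<Longrightarrow> x \<in> set (m_els m) \<Longrightarrow> y \<in> set (m_els m) \<Longrightarrow> mt (m_init m) x y \<noteq> EU \<Longrightarrow>
    y \<in> set ls \<and> mt (m_init m) x y = y"
  by (cases m) (auto simp: mt_def)

lemma unfaithful_sound:
  "distinct xs \<Longrightarrow> unfaithful g xs \<Longrightarrow> \<exists>x\<in>set xs. \<exists>y\<in>set xs. x \<noteq> y \<and> g x y"
proof (induction xs)
  case (Cons x xs)
  have "any_agree g x ys \<Longrightarrow> \<exists>y\<in>set ys. g x y" for ys
    by (induction ys) (auto split: if_splits)
  with Cons show ?case by (auto split: if_splits) metis
qed simp

lemma agree_left_sound: "agree_left is t x y \<Longrightarrow> i \<in> set is \<Longrightarrow> mt t x i \<noteq> EU \<and> mt t x i = mt t y i"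
  and agree_right_sound: "agree_right is t x y \<Longrightarrow> i \<in> set is \<Longrightarrow> mt t i x \<noteq> EU \<and> mt t i x = mt t i y"
  by (induction "is") (auto split: if_splits)

lemma distinct_m_els: "distinct (m_els m)"
  by (cases m) auto

lemma left_mode:
  assumes "2 \<le> l" "l \<le> n" "n \<le> 5"
  shows "\<exists>m. m_fam m = Fam_left (take l all_els) \<and> m_els m = take n all_els"
proof -
  have "n = 2 \<and> l = 2 \<or> n = 3 \<and> l = 2 \<or> n = 3 \<and> l = 3 \<or> n = 4 \<and> l = 2 \<or> n = 4 \<and> l = 3 \<or> n = 4 \<and> l = 4 \<or> n = 5 \<and> l = 2 \<or> n = 5 \<and> l = 3 \<or> n = 5 \<and> l = 4 \<or> n = 5 \<and> l = 5"
    using assms by presburger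
  then consider "n = 2" "l = 2" | "n = 3" "l = 2" | "n = 3" "l = 3" | "n = 4" "l = 2" | "n = 4" "l = 3" | "n = 4" "l = 4" | "n = 5" "l = 2" | "n = 5" "l = 3" | "n = 5" "l = 4" | "n = 5" "l = 5"
    by blast
  then show ?thesis
  proof cases
    case 1
    then show ?thesis by (intro exI[of _ Lft2_2]) (simp add: all_els_def)
  next
    case 2
    then show ?thesis by (intro exI[of _ Lft2_3]) (simp add: all_els_def)
  next
    case 3
    then show ?thesis by (intro exI[of _ Lft3_3]) (simp add: all_els_def)
  next
    case 4
    then show ?thesis by (intro exI[of _ Lft2_4]) (simp add: all_els_def)
  next
    case 5
    then show ?thesis by (intro exI[of _ Lft3_4]) (simp add: all_els_def)
  next
    case 6
    then show ?thesis by (intro exI[of _ Lft4_4]) (simp add: all_els_def)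
  next
    case 7
    then show ?thesis by (intro exI[of _ Lft2_5]) (simp add: all_els_def)
  next
    case 8
    then show ?thesis by (intro exI[of _ Lft3_5]) (simp add: all_els_def)
  next
    case 9
    then show ?thesis by (intro exI[of _ Lft4_5]) (simp add: all_els_def)
  next
    case 10
    then show ?thesis by (intro exI[of _ Lft5_5]) (simp add: all_els_def)
  qed
qed

lemma right_mode:
  assumes "2 \<le> l" "l \<le> n" "n \<le> 5"
  shows "\<exists>m. m_fam m = Fam_right (take l all_els) \<and> m_els m = take n all_els"
proof -
  have "n = 2 \<and> l = 2 \<or> n = 3 \<and> l = 2 \<or> n = 3 \<and> l = 3 \<or> n = 4 \<and> l = 2 \<or> n = 4 \<and> l = 3 \<or> n = 4 \<and> l = 4 \<or> n = 5 \<and> l = 2 \<or> n = 5 \<and> l = 3 \<or> n = 5 \<and> l = 4 \<or> n = 5 \<and> l = 5"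
    using assms by presburger
  then consider "n = 2" "l = 2" | "n = 3" "l = 2" | "n = 3" "l = 3" | "n = 4" "l = 2" | "n = 4" "l = 3" | "n = 4" "l = 4" | "n = 5" "l = 2" | "n = 5" "l = 3" | "n = 5" "l = 4" | "n = 5" "l = 5"
    by blast
  then show ?thesis
  proof cases
    case 1
    then show ?thesis by (intro exI[of _ Rgt2_2]) (simp add: all_els_def)
  next
    case 2
    then show ?thesis by (intro exI[of _ Rgt2_3]) (simp add: all_els_def)
  next
    case 3
    then show ?thesis by (intro exI[of _ Rgt3_3]) (simp add: all_els_def)
  next
    case 4
    then show ?thesis by (intro exI[of _ Rgt2_4]) (simp add: all_els_def)
  next
    case 5
    then show ?thesis by (intro exI[of _ Rgt3_4]) (simp add: all_els_def)
  next
    case 6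
    then show ?thesis by (intro exI[of _ Rgt4_4]) (simp add: all_els_def)
  next
    case 7
    then show ?thesis by (intro exI[of _ Rgt2_5]) (simp add: all_els_def)
  next
    case 8
    then show ?thesis by (intro exI[of _ Rgt3_5]) (simp add: all_els_def)
  next
    case 9
    then show ?thesis by (intro exI[of _ Rgt4_5]) (simp add: all_els_def)
  next
    case 10
    then show ?thesis by (intro exI[of _ Rgt5_5]) (simp add: all_els_def)
  qed
qed

text \<open>The elements of \<open>L\<close> are listed before all others, so they receive exactly
  the first \<open>l\<close> labels.\<close>

lemma zeros_labelling:
  fixes S :: "'a sg"
  assumes S: "is_fsemigroup S" and n: "card (sg_car S) = n" "n \<le> 5"
    and L: "L \<subseteq> sg_car S" "card L = l"
  obtains f xs where "is_fsemigroup (set (take n all_els), f)" "good S \<longleftrightarrow> good (set (take n all_els), f)"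
    "\<And>x y. x \<in> set (take n all_els) \<Longrightarrow> y \<in> set (take n all_els) \<Longrightarrow>
      f x y \<in> set (take n all_els) \<and> xs ! num (f x y) = sg_mult S (xs ! num x) (xs ! num y)"
    "card (set (take n all_els)) = n"
    "\<And>x y. x \<in> set (take n all_els) \<Longrightarrow> y \<in> set (take n all_els) \<Longrightarrow> xs ! num x = xs ! num y \<longleftrightarrow> x = y"
    "\<And>x. x \<in> set (take n all_els) \<Longrightarrow> xs ! num x \<in> sg_car S"
    "\<And>x. x \<in> set (take n all_els) \<Longrightarrow> x \<in> set (take l all_els) \<longleftrightarrow> xs ! num x \<in> L"
    "\<And>i. i \<in> L \<Longrightarrow> \<exists>x\<in>set (take n all_els). xs ! num x = i" "l \<le> n"
proof -
  have fin: "finite L" using L(1) fsg_finite[OF S] finite_subset by blast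
  obtain as where as: "set as = L" "distinct as" using list_of_set[OF fin] by blast
  obtain bs where bs: "set bs = sg_car S - L" "distinct bs"
    using list_of_set[of "sg_car S - L"] fsg_finite[OF S] by blast
  define xs where "xs = as @ bs"
  have xs: "distinct xs" "set xs = sg_car S" using as bs L(1) by (auto simp: xs_def)
  have len: "length xs = n" using xs n(1) distinct_card by metis
  have la: "length as = l" using as L(2) distinct_card by metis
  obtain f where f: "is_fsemigroup (set (take n all_els), f)" "good S \<longleftrightarrow> good (set (take n all_els), f)"
      "\<And>x y. x \<in> set (take n all_els) \<Longrightarrow> y \<in> set (take n all_els) \<Longrightarrow>
        f x y \<in> set (take n all_els) \<and> xs ! num (f x y) = sg_mult S (xs ! num x) (xs ! num y)"
      "card (set (take n all_els)) = n"
    using labelling[OF S xs len n(2)] by blast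
  let ?E = "set (take n all_els)"
  have inL: "x \<in> set (take l all_els) \<longleftrightarrow> xs ! num x \<in> L" if x: "x \<in> ?E" for x
  proof (cases "num x < l")
    case True
    then show ?thesis using x la as by (auto simp: set_take_els xs_def nth_append)
  next
    case False
    then have "xs ! num x = bs ! (num x - l)" "num x - l < length bs"
      using x la len by (auto simp: set_take_els xs_def nth_append)
    then have "xs ! num x \<in> set bs" by simp
    then show ?thesis using False bs by (auto simp: set_take_els)
  qed
  have ex: "\<exists>x\<in>?E. xs ! num x = i" if "i \<in> L" for i
  proof -
    have "i \<in> set (map (\<lambda>x. xs ! num x) (take n all_els))"
      using that L(1) xs(2) map_nth_els[OF len n(2)] by auto
    then show ?thesis by auto
  qed
  have ln: "l \<le> n" using la len by (simp add: xs_def)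
  have car: "xs ! num x \<in> sg_car S" if "x \<in> ?E" for x
    using that len xs(2) by (metis nth_mem set_take_els)
  show thesis
    by (rule that[of f xs]) (fact f nth_num_inj[OF xs(1) len] car inL ex ln)+
qed

text \<open>Elements are determined by their left action on the ideal \<open>L\<close>, so two
  labels known to act alike show that a partial table does not come from \<open>S\<close>.\<close>

lemma good_left_zeros:
  fixes S :: "'a sg"
  assumes S: "is_fsemigroup S" and n: "card (sg_car S) = n" "2 \<le> n" "n \<le> 5" and IH: "IH n"
    and L: "L \<subseteq> sg_car S" "2 \<le> card L"
    and zero: "\<And>i x. i \<in> L \<Longrightarrow> x \<in> sg_car S \<Longrightarrow> sg_mult S i x = i"
    and ideal: "\<And>i x. i \<in> L \<Longrightarrow> x \<in> sg_car S \<Longrightarrow> sg_mult S x i \<in> L"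
    and faith: "\<And>x y. x \<in> sg_car S \<Longrightarrow> y \<in> sg_car S \<Longrightarrow> (\<And>i. i \<in> L \<Longrightarrow> sg_mult S x i = sg_mult S y i) \<Longrightarrow> x = y"
  shows "good S"
proof -
  define l where "l = card L"
  obtain f xs where f: "is_fsemigroup (set (take n all_els), f)" "good S \<longleftrightarrow> good (set (take n all_els), f)"
    "\<And>x y. x \<in> set (take n all_els) \<Longrightarrow> y \<in> set (take n all_els) \<Longrightarrow>
      f x y \<in> set (take n all_els) \<and> xs ! num (f x y) = sg_mult S (xs ! num x) (xs ! num y)"
    "card (set (take n all_els)) = n"
    and inj: "\<And>x y. x \<in> set (take n all_els) \<Longrightarrow> y \<in> set (take n all_els) \<Longrightarrow> xs ! num x = xs ! num y \<longleftrightarrow> x = y"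
    and hS: "\<And>x. x \<in> set (take n all_els) \<Longrightarrow> xs ! num x \<in> sg_car S"
    and inL: "\<And>x. x \<in> set (take n all_els) \<Longrightarrow> x \<in> set (take l all_els) \<longleftrightarrow> xs ! num x \<in> L"
    and ex: "\<And>i. i \<in> L \<Longrightarrow> \<exists>x\<in>set (take n all_els). xs ! num x = i" and ln: "l \<le> n"
    using zeros_labelling[OF S n(1,3) L(1) l_def[symmetric]] by blast
  let ?E = "set (take n all_els)"
  obtain m where m: "m_fam m = Fam_left (take l all_els)" "m_els m = take n all_els"
    using left_mode[of l n] L(2) l_def ln n(3) by auto
  have fz: "f i x = i" if "i \<in> ?E" "x \<in> ?E" "i \<in> set (take l all_els)" for i x
  proof -
    have "xs ! num (f i x) = xs ! num i" using that f(3) zero inL hS by metis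
    then show ?thesis using inj f(3) that by blast
  qed
  have fi: "f x i \<in> set (take l all_els)" if "i \<in> ?E" "x \<in> ?E" "i \<in> set (take l all_els)" for i x
    using that f(3) ideal inL hS by metis
  have ff: "x = y" if "x \<in> ?E" "y \<in> ?E" "\<And>i. i \<in> ?E \<Longrightarrow> i \<in> set (take l all_els) \<Longrightarrow> f x i = f y i" for x y
  proof -
    have "xs ! num x = xs ! num y"
    proof (rule faith[OF hS[OF that(1)] hS[OF that(2)]])
      fix i assume "i \<in> L"
      then obtain j where "j \<in> ?E" "xs ! num j = i" "j \<in> set (take l all_els)" using ex inL by blast
      then show "sg_mult S (xs ! num x) i = sg_mult S (xs ! num y) i" using f(3) that by metis
    qed
    then show ?thesis using inj that by blast
  qed
  have sub: "set (take l all_els) \<subseteq> ?E" using ln by (auto simp: set_take_els)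
  have "good (set (m_els m), f)"
  proof (rule mode_good)
    show "extends (m_els m) f (m_init m)"
      using left_init[OF m(1)] fz m(2) by (intro extendsI) metis
    show "f x y \<in> set (cand_of (m_fam m) (m_els m) t x y)" if "x \<in> set (m_els m)" "y \<in> set (m_els m)" for t x y
      using that f(3) fi m by auto
    fix t assume t: "extends (m_els m) f t"
    show "\<not> prune_of (m_fam m) (m_els m) t"
    proof
      assume "prune_of (m_fam m) (m_els m) t"
      then obtain x y where xy: "x \<in> ?E" "y \<in> ?E" "x \<noteq> y" "agree_left (take l all_els) t x y"
        using unfaithful_sound[OF distinct_m_els[of m], of "agree_left (take l all_els) t"] m by auto
      have "f x i = f y i" if "i \<in> ?E" "i \<in> set (take l all_els)" for i
        using agree_left_sound[OF xy(4) that(2)] extends_mt[OF t, of x i] extends_mt[OF t, of y i] xy that m(2) by auto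
      then show False using ff xy by blast
    qed
  qed (use f m n IHD[OF IH] in auto)
  then show ?thesis using f(2) m(2) by simp
qed

lemma good_right_zeros:
  fixes S :: "'a sg"
  assumes S: "is_fsemigroup S" and n: "card (sg_car S) = n" "2 \<le> n" "n \<le> 5" and IH: "IH n"
    and L: "L \<subseteq> sg_car S" "2 \<le> card L"
    and zero: "\<And>i x. i \<in> L \<Longrightarrow> x \<in> sg_car S \<Longrightarrow> sg_mult S x i = i"
    and ideal: "\<And>i x. i \<in> L \<Longrightarrow> x \<in> sg_car S \<Longrightarrow> sg_mult S i x \<in> L"
    and faith: "\<And>x y. x \<in> sg_car S \<Longrightarrow> y \<in> sg_car S \<Longrightarrow> (\<And>i. i \<in> L \<Longrightarrow> sg_mult S i x = sg_mult S i y) \<Longrightarrow> x = y"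
  shows "good S"
proof -
  define l where "l = card L"
  obtain f xs where f: "is_fsemigroup (set (take n all_els), f)" "good S \<longleftrightarrow> good (set (take n all_els), f)"
    "\<And>x y. x \<in> set (take n all_els) \<Longrightarrow> y \<in> set (take n all_els) \<Longrightarrow>
      f x y \<in> set (take n all_els) \<and> xs ! num (f x y) = sg_mult S (xs ! num x) (xs ! num y)"
    "card (set (take n all_els)) = n"
    and inj: "\<And>x y. x \<in> set (take n all_els) \<Longrightarrow> y \<in> set (take n all_els) \<Longrightarrow> xs ! num x = xs ! num y \<longleftrightarrow> x = y"
    and hS: "\<And>x. x \<in> set (take n all_els) \<Longrightarrow> xs ! num x \<in> sg_car S"
    and inL: "\<And>x. x \<in> set (take n all_els) \<Longrightarrow> x \<in> set (take l all_els) \<longleftrightarrow> xs ! num x \<in> L"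
    and ex: "\<And>i. i \<in> L \<Longrightarrow> \<exists>x\<in>set (take n all_els). xs ! num x = i" and ln: "l \<le> n"
    using zeros_labelling[OF S n(1,3) L(1) l_def[symmetric]] by blast
  let ?E = "set (take n all_els)"
  obtain m where m: "m_fam m = Fam_right (take l all_els)" "m_els m = take n all_els"
    using right_mode[of l n] L(2) l_def ln n(3) by auto
  have fz: "f x i = i" if "i \<in> ?E" "x \<in> ?E" "i \<in> set (take l all_els)" for i x
  proof -
    have "xs ! num (f x i) = xs ! num i" using that f(3) zero inL hS by metis
    then show ?thesis using inj f(3) that by blast
  qed
  have fi: "f i x \<in> set (take l all_els)" if "i \<in> ?E" "x \<in> ?E" "i \<in> set (take l all_els)" for i x
    using that f(3) ideal inL hS by metis
  have ff: "x = y" if "x \<in> ?E" "y \<in> ?E" "\<And>i. i \<in> ?E \<Longrightarrow> i \<in> set (take l all_els) \<Longrightarrow> f i x = f i y" for x y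
  proof -
    have "xs ! num x = xs ! num y"
    proof (rule faith[OF hS[OF that(1)] hS[OF that(2)]])
      fix i assume "i \<in> L"
      then obtain j where "j \<in> ?E" "xs ! num j = i" "j \<in> set (take l all_els)" using ex inL by blast
      then show "sg_mult S i (xs ! num x) = sg_mult S i (xs ! num y)" using f(3) that by metis
    qed
    then show ?thesis using inj that by blast
  qed
  have "good (set (m_els m), f)"
  proof (rule mode_good)
    show "extends (m_els m) f (m_init m)"
      using right_init[OF m(1)] fz m(2) by (intro extendsI) metis
    show "f x y \<in> set (cand_of (m_fam m) (m_els m) t x y)" if "x \<in> set (m_els m)" "y \<in> set (m_els m)" for t x y
      using that f(3) fi m by auto
    fix t assume t: "extends (m_els m) f t"
    show "\<not> prune_of (m_fam m) (m_els m) t"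
    proof
      assume "prune_of (m_fam m) (m_els m) t"
      then obtain x y where xy: "x \<in> ?E" "y \<in> ?E" "x \<noteq> y" "agree_right (take l all_els) t x y"
        using unfaithful_sound[OF distinct_m_els[of m], of "agree_right (take l all_els) t"] m by auto
      have "f i x = f i y" if "i \<in> ?E" "i \<in> set (take l all_els)" for i
        using agree_right_sound[OF xy(4) that(2)] extends_mt[OF t, of i x] extends_mt[OF t, of i y] xy that m(2) by auto
      then show False using ff xy by blast
    qed
  qed (use f m n IHD[OF IH] in auto)
  then show ?thesis using f(2) m(2) by simp
qed

text \<open>The four elements with known products \<open>B\<close> come first, and at most one
  further element remains. \<open>B\<close> is a parameter so that the block and its dual are
  treated together.\<close>

lemma good_block:
  fixes S :: "'a sg"
  assumes S: "is_fsemigroup S" and n: "card (sg_car S) = n" "n \<le> 5" and IH: "IH n"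
    and b: "set [a, g, c, d] \<subseteq> sg_car S" "distinct [a, g, c, d]"
    and B: "\<And>x y. x \<in> {E0, E1, E2, E3} \<Longrightarrow> y \<in> {E0, E1, E2, E3} \<Longrightarrow>
        B x y \<in> {E0, E1, E2, E3} \<and> sg_mult S ([a, g, c, d] ! num x) ([a, g, c, d] ! num y) = [a, g, c, d] ! num (B x y)"
    and modes: "\<And>n. n = 4 \<or> n = 5 \<Longrightarrow> \<exists>m. m_fam m = Fam_any \<and> m_els m = take n all_els \<and>
        (\<forall>x\<in>set (m_els m). \<forall>y\<in>set (m_els m). mt (m_init m) x y \<noteq> EU \<longrightarrow>
          x \<in> {E0, E1, E2, E3} \<and> y \<in> {E0, E1, E2, E3} \<and> mt (m_init m) x y = B x y)"
  shows "good S"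
proof -
  obtain rs where rs: "set rs = sg_car S - set [a, g, c, d]" "distinct rs"
    using list_of_set[of "sg_car S - set [a, g, c, d]"] fsg_finite[OF S] by blast
  define xs where "xs = [a, g, c, d] @ rs"
  have xs: "distinct xs" "set xs = sg_car S" using rs b by (auto simp: xs_def)
  then have len: "length xs = n" using n(1) distinct_card by metis
  moreover have "4 \<le> length xs" by (simp add: xs_def)
  ultimately have n4: "n = 4 \<or> n = 5" using n(2) by linarith
  obtain f where f: "is_fsemigroup (set (take n all_els), f)" "good S \<longleftrightarrow> good (set (take n all_els), f)"
      "\<And>x y. x \<in> set (take n all_els) \<Longrightarrow> y \<in> set (take n all_els) \<Longrightarrow>
        f x y \<in> set (take n all_els) \<and> xs ! num (f x y) = sg_mult S (xs ! num x) (xs ! num y)"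
      "card (set (take n all_els)) = n"
    using labelling[OF S xs len n(2)] by blast
  let ?E = "set (take n all_els)"
  obtain m where m: "m_fam m = Fam_any" "m_els m = take n all_els"
      "\<forall>x\<in>set (m_els m). \<forall>y\<in>set (m_els m). mt (m_init m) x y \<noteq> EU \<longrightarrow>
          x \<in> {E0, E1, E2, E3} \<and> y \<in> {E0, E1, E2, E3} \<and> mt (m_init m) x y = B x y"
    using modes[OF n4] by blast
  have low: "xs ! num x = [a, g, c, d] ! num x" "x \<in> ?E" if "x \<in> {E0, E1, E2, E3}" for x
    using that n4 by (auto simp: xs_def nth_append set_take_els)
  have fB: "f x y = B x y" if "x \<in> {E0, E1, E2, E3}" "y \<in> {E0, E1, E2, E3}" for x y
  proof -
    have "B x y \<in> {E0, E1, E2, E3}" using B[OF that] by blast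
    then have "xs ! num (f x y) = xs ! num (B x y)" "B x y \<in> ?E"
      using f(3)[OF low(2)[OF that(1)] low(2)[OF that(2)]] low B[OF that] that by metis+
    then show ?thesis using nth_num_inj[OF xs(1) len] f(3)[OF low(2)[OF that(1)] low(2)[OF that(2)]] by blast
  qed
  have "good (set (m_els m), f)"
  proof (rule mode_good)
    show "extends (m_els m) f (m_init m)"
      using m(3) fB by (intro extendsI) metis
    show "f x y \<in> set (cand_of (m_fam m) (m_els m) t x y)" if "x \<in> set (m_els m)" "y \<in> set (m_els m)" for t x y
      using that f(3) m by auto
  qed (use f m n4 IHD[OF IH] in auto)
  then show ?thesis using f(2) m(2) by simp
qed

subsection \<open>The minimal ideal\<close>

lemma op_simps [simp]: "sg_car (sg_op S) = sg_car S" "sg_mult (sg_op S) x y = sg_mult S y x"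
  by (simp_all add: sg_op_def)

text \<open>The local monoid \<open>eSe\<close>. For a suitable idempotent it is a maximal subgroup
  of the minimal ideal.\<close>

definition corner :: "'a sg \<Rightarrow> 'a \<Rightarrow> 'a set" where
  "corner S e = (\<lambda>x. sg_mult S (sg_mult S e x) e) ` sg_car S"

lemma corner_op: "is_fsemigroup S \<Longrightarrow> e \<in> sg_car S \<Longrightarrow> corner (sg_op S) e = corner S e"
  by (auto simp: corner_def fsg_assoc)

lemma corner_id:
  assumes S: "is_fsemigroup S" and e: "e \<in> sg_car S" "sg_mult S e e = e" and x: "x \<in> corner S e"
  shows "x \<in> sg_car S" "sg_mult S e x = x" "sg_mult S x e = x"
proof -
  note cl = fsg_closed[OF S] and assoc = fsg_assoc[OF S]
  obtain y where y: "y \<in> sg_car S" "x = sg_mult S (sg_mult S e y) e" using x by (auto simp: corner_def)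
  show "x \<in> sg_car S" using y e cl by simp
  show "sg_mult S x e = x" using y e cl assoc by simp
  have "sg_mult S e x = sg_mult S (sg_mult S (sg_mult S e e) y) e" using y e(1) cl assoc by simp
  then show "sg_mult S e x = x" using y e(2) by simp
qed

lemma corner_iff:
  assumes S: "is_fsemigroup S" and e: "e \<in> sg_car S" "sg_mult S e e = e"
  shows "x \<in> corner S e \<longleftrightarrow> x \<in> sg_car S \<and> sg_mult S e x = x \<and> sg_mult S x e = x"
proof
  assume "x \<in> corner S e"
  then show "x \<in> sg_car S \<and> sg_mult S e x = x \<and> sg_mult S x e = x" using corner_id[OF S e] by blast
next
  assume x: "x \<in> sg_car S \<and> sg_mult S e x = x \<and> sg_mult S x e = x"
  then have "x = sg_mult S (sg_mult S e x) e" by simp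
  then show "x \<in> corner S e" using x unfolding corner_def by blast
qed

lemma corner_mult:
  assumes S: "is_fsemigroup S" and e: "e \<in> sg_car S" "sg_mult S e e = e"
    and "x \<in> corner S e" "y \<in> corner S e"
  shows "sg_mult S x y \<in> corner S e"
proof -
  have "x \<in> sg_car S" "y \<in> sg_car S" "sg_mult S e x = x" "sg_mult S y e = y"
    using assms(4,5) corner_iff[OF S e] by auto
  then show ?thesis
    using fsg_assoc[OF S e(1), of x y] fsg_assoc[OF S _ _ e(1), of x y] fsg_closed[OF S] corner_iff[OF S e] by auto
qed

text \<open>An idempotent with the smallest possible \<open>eSe\<close> works. For \<open>x\<close>
  in \<open>eSe\<close> the right ideal \<open>x eSe\<close> contains an idempotent
  \<open>g\<close>; then \<open>gSg\<close> lies in \<open>eSe\<close>, minimality makes them equal,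
  and \<open>g = e\<close>.\<close>

lemma group_corner:
  assumes S: "is_fsemigroup S"
  obtains e where "e \<in> sg_car S" "sg_mult S e e = e"
    "\<And>x. x \<in> corner S e \<Longrightarrow> \<exists>y\<in>corner S e. sg_mult S x y = e \<and> sg_mult S y x = e"
proof -
  let ?m = "sg_mult S" and ?S = "sg_car S"
  note cl = fsg_closed[OF S] and assoc = fsg_assoc[OF S]
  have "\<exists>e\<in>?S. ?m e e = e"
    by (rule closed_has_idempotent[OF S]) (use fsg_nonempty[OF S] cl in auto)
  then have "\<exists>e. e \<in> ?S \<and> ?m e e = e" by blast
  then obtain e where e: "e \<in> ?S \<and> ?m e e = e"
    and min: "\<And>g. g \<in> ?S \<and> ?m g g = g \<Longrightarrow> card (corner S e) \<le> card (corner S g)"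
    using ex_has_least_nat[of "\<lambda>e. e \<in> ?S \<and> ?m e e = e" _ "\<lambda>e. card (corner S e)"] by blast
  have e1: "e \<in> ?S" and e2: "?m e e = e" using e by auto
  note C = corner_iff[OF S e1 e2]
  have right_inv: "\<exists>y\<in>corner S e. ?m x y = e" if x: "x \<in> corner S e" for x
  proof -
    let ?A = "(\<lambda>y. ?m x y) ` corner S e"
    have A_sub: "?A \<subseteq> corner S e" using corner_mult[OF S e1 e2 x] by blast
    have "\<exists>g\<in>?A. ?m g g = g"
    proof (rule closed_has_idempotent[OF S])
      show "?A \<subseteq> ?S" using A_sub C by blast
      show "?A \<noteq> {}" using x by blast
      fix u v assume u: "u \<in> ?A" and v: "v \<in> ?A"
      then obtain y where y: "y \<in> corner S e" "u = ?m x y" by blast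
      have "v \<in> corner S e" using v A_sub by blast
      then have "?m y v \<in> corner S e" "?m u v = ?m x (?m y v)"
        using corner_mult[OF S e1 e2] y x C assoc by auto
      then show "?m u v \<in> ?A" by blast
    qed
    then obtain y g where g: "y \<in> corner S e" "g = ?m x y" "?m g g = g" by blast
    then have gC: "g \<in> corner S e" using corner_mult[OF S e1 e2 x] by blast
    then have g1: "g \<in> ?S" "?m e g = g" "?m g e = g" using C by auto
    note Cg = corner_iff[OF S g1(1) g(3)]
    have "corner S g \<subseteq> corner S e"
    proof
      fix w assume "w \<in> corner S g"
      then have w: "w \<in> ?S" "?m g w = w" "?m w g = w" using Cg by auto
      have "?m e w = w" using w g1 e1 assoc[of e g w] by simp
      moreover have "?m w e = w" using w g1 e1 assoc[of w g e] by simp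
      ultimately show "w \<in> corner S e" using C w by auto
    qed
    moreover have "finite (corner S e)" using fsg_finite[OF S] by (simp add: corner_def)
    ultimately have "corner S g = corner S e" using min[of g] g1(1) g(3) card_seteq by blast
    moreover have "e \<in> corner S e" using C e1 e2 by simp
    ultimately have "?m g e = e" using Cg by blast
    then show ?thesis using g1(3) g(1,2) by auto
  qed
  have "\<exists>y\<in>corner S e. ?m x y = e \<and> ?m y x = e" if x: "x \<in> corner S e" for x
  proof -
    obtain y where y: "y \<in> corner S e" "?m x y = e" using right_inv[OF x] by blast
    obtain w where w: "w \<in> corner S e" "?m y w = e" using right_inv[OF y(1)] by blast
    have m: "x \<in> ?S" "y \<in> ?S" "w \<in> ?S" "?m x e = x" "?m e w = w" using x y(1) w(1) C by auto
    have "?m x (?m y w) = ?m (?m x y) w" using assoc[OF m(1-3)] by simp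
    \<comment> \<open>A right inverse that has a right inverse is two-sided:
      \<open>x = xe = x(yw) = (xy)w = w\<close>.\<close>
    then have "x = w" using m(4,5) y(2) w(2) by simp
    then show ?thesis using y w by blast
  qed
  then show thesis using that e1 e2 by blast
qed

text \<open>Direct product of a two-element left zero semigroup and the group of order two; the pair
  \<open>(l, z)\<close> has the label with number \<open>2 l + z\<close>.\<close>

definition block :: "elt \<Rightarrow> elt \<Rightarrow> elt" where
  "block = mt (m_init Lft_Z4)"

text \<open>The cases in order: \<open>e\<close> is a left zero, \<open>e\<close> is an identity, or
  a copy of \<open>block\<close> occurs with \<open>e\<close> in its first place.\<close>

definition trichotomy :: "'a sg \<Rightarrow> 'a \<Rightarrow> bool" where
  "trichotomy S e \<longleftrightarrow> (\<forall>x\<in>sg_car S. sg_mult S e x = e) \<or> (\<forall>x\<in>sg_car S. sg_mult S e x = x \<and> sg_mult S x e = x) \<or>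
    (\<exists>g c d. set [e, g, c, d] \<subseteq> sg_car S \<and> distinct [e, g, c, d] \<and>
      (\<forall>x\<in>{E0, E1, E2, E3}. \<forall>y\<in>{E0, E1, E2, E3}.
        sg_mult S ([e, g, c, d] ! num x) ([e, g, c, d] ! num y) = [e, g, c, d] ! num (block x y)))"

text \<open>The hypothesis \<open>faith\<close> says that left multiplication on \<open>Se\<close>
  separates the elements. Either the group \<open>eSe\<close> is trivial, or \<open>Se\<close>
  equals \<open>eSe\<close> and then all of \<open>S\<close> does, or \<open>Se\<close> contains two
  disjoint copies of \<open>eSe\<close>; with five elements available the group then has order
  two.\<close>

lemma faithful_cases:
  assumes S: "is_fsemigroup S" "card (sg_car S) \<le> 5" and e: "e \<in> sg_car S" "sg_mult S e e = e"
    and inv: "\<And>x. x \<in> corner S e \<Longrightarrow> \<exists>y\<in>corner S e. sg_mult S x y = e \<and> sg_mult S y x = e"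
    and faith: "\<And>x y. x \<in> sg_car S \<Longrightarrow> y \<in> sg_car S \<Longrightarrow>
      (\<And>s. s \<in> sg_car S \<Longrightarrow> sg_mult S (sg_mult S x s) e = sg_mult S (sg_mult S y s) e) \<Longrightarrow> x = y"
  shows "trichotomy S e"
proof -
  let ?m = "sg_mult S" and ?S = "sg_car S" and ?M = "corner S e"
  note cl = fsg_closed[OF S(1)] and assoc = fsg_assoc[OF S(1)] and C = corner_iff[OF S(1) e]
    and mult = corner_mult[OF S(1) e]
  have eM: "e \<in> ?M" using C e by simp
  have ese: "?m (?m e s) e \<in> ?M" if "s \<in> ?S" for s using that by (auto simp: corner_def)
  show ?thesis
  proof (cases "?M = {e}")
    case True
    \<comment> \<open>Both \<open>exse\<close> and \<open>ese\<close> lie in the trivial corner, so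
      \<open>ex\<close> and \<open>e\<close> act alike on \<open>Se\<close>.\<close>
    have "?m e x = e" if x: "x \<in> ?S" for x
    proof (rule faith)
      fix s assume s: "s \<in> ?S"
      have "?m (?m e (?m x s)) e = e" "?m (?m e s) e = e" using ese True x s cl by blast+
      then show "?m (?m (?m e x) s) e = ?m (?m e s) e" using x s e(1) cl assoc by simp
    qed (use x e cl in auto)
    then show ?thesis unfolding trichotomy_def by blast
  next
    case False
    show ?thesis
    proof (cases "\<forall>s\<in>?S. ?m s e = ?m (?m e s) e")
      case True
      have "x = ?m (?m e x) e" if x: "x \<in> ?S" for x
      proof (rule faith)
        fix s assume s: "s \<in> ?S"
        have "?m (?m (?m (?m e x) e) s) e = ?m (?m e x) (?m (?m e s) e)" using x s e(1) cl assoc by simp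
        also have "\<dots> = ?m (?m e x) (?m s e)" using True s by simp
        also have "\<dots> = ?m (?m e (?m x s)) e" using x s e(1) cl assoc by simp
        also have "\<dots> = ?m (?m x s) e" using True x s cl by simp
        finally show "?m (?m x s) e = ?m (?m (?m (?m e x) e) s) e" by simp
      qed (use x e cl in auto)
      then have "x \<in> ?M" if "x \<in> ?S" for x using that ese by metis
      then show ?thesis using C unfolding trichotomy_def by blast
    next
      case nonleft: False
      then obtain c0 where c0: "c0 \<in> ?S" "?m c0 e \<noteq> ?m (?m e c0) e" by blast
      define c1 where "c1 = ?m c0 e"
      have c1: "c1 \<in> ?S" "?m c1 e = c1" "?m e c1 \<noteq> c1" "?m e c1 \<in> ?M"
        using c0 e cl assoc ese[OF c0(1)] by (auto simp: c1_def)
      obtain w where w: "w \<in> ?M" "?m (?m e c1) w = e" "?m w (?m e c1) = e" using inv[OF c1(4)] by blast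
      have wS: "w \<in> ?S" "?m e w = w" "?m w e = w" using w(1) C by auto
      \<comment> \<open>Dividing \<open>c1\<close> by its corner component \<open>e c1\<close> gives
        an idempotent with \<open>ec = e\<close> and \<open>ce = c\<close>: a second left zero
        beside \<open>e\<close>.\<close>
      define c where "c = ?m c1 w"
      have c: "c \<in> ?S" "?m c e = c" "?m e c = e"
        using c1 wS e w(2) cl assoc by (auto simp: c_def)
      have c_ne: "c \<noteq> e"
      proof
        assume "c = e"
        then have "?m c (?m e c1) = ?m e c1" using e c1(1) cl assoc[of e e c1] by simp
        moreover have "?m c (?m e c1) = c1"
        proof -
          have "?m c (?m e c1) = ?m c1 (?m w (?m e c1))"
            using c1(1) wS(1) e(1) cl assoc by (simp add: c_def)
          then show ?thesis using w(3) c1(2) by simp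
        qed
        ultimately show False using c1(3) by simp
      qed
      have c_notin: "c \<notin> ?M" using c(3) c_ne C by auto
      obtain g where g: "g \<in> ?M" "g \<noteq> e" using False eM by blast
      have gS: "g \<in> ?S" "?m e g = g" "?m g e = g" using g(1) C by auto
      have c_inj: "?m c x \<notin> ?M" if x: "x \<in> ?M" for x
      proof
        assume a: "?m c x \<in> ?M"
        obtain y where y: "y \<in> ?M" "?m x y = e" using inv[OF x] by blast
        have "x \<in> ?S" "y \<in> ?S" using x y(1) C by blast+
        then have "?m (?m c x) y = c" using assoc[OF c(1), of x y] y(2) c(2) by simp
        then show False using mult[OF a y(1)] c_notin by simp
      qed
      have c_canc: "x = y" if "x \<in> ?M" "y \<in> ?M" "?m c x = ?m c y" for x y
      proof -
        have "?m e (?m c x) = x" if "x \<in> ?M" for x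
        proof -
          have "x \<in> ?S" "?m e x = x" using that C by blast+
          then show ?thesis using assoc[OF e(1) c(1), of x] c(3) by simp
        qed
        then show ?thesis using that by metis
      qed
      \<comment> \<open>Otherwise \<open>e\<close>, \<open>g\<close> and the square of
        \<open>g\<close> are distinct, and with their multiples by \<open>c\<close>, which lie
        outside the corner, there would be six elements.\<close>
      have gg: "?m g g = e"
      proof (rule ccontr)
        assume ne: "?m g g \<noteq> e"
        have gg: "?m g g \<in> ?M" using mult g by blast
        obtain h where h: "h \<in> ?M" "?m g h = e" using inv[OF g(1)] by blast
        have ne2: "?m g g \<noteq> g"
        proof
          assume "?m g g = g"
          then have "?m (?m g g) h = e" using h by simp
          moreover have "h \<in> ?S" using h(1) C by blast
          ultimately have "?m g e = e" using h(2) assoc[OF gS(1) gS(1), of h] by simp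
          then show False using gS g(2) by simp
        qed
        define A where "A = {e, g, ?m g g}"
        have A: "A \<subseteq> ?M" "card A = 3" "finite A" using eM g gg ne ne2 by (auto simp: A_def)
        define B where "B = (\<lambda>x. ?m c x) ` A"
        have inj: "inj_on (\<lambda>x. ?m c x) A" using A(1) c_canc by (intro inj_onI) blast
        have B: "card B = 3" "finite B" using A(2,3) card_image[OF inj] by (simp_all add: B_def)
        have "A \<inter> B = {}"
        proof (rule ccontr)
          assume "A \<inter> B \<noteq> {}"
          then obtain x where "x \<in> A" "?m c x \<in> A" unfolding B_def by blast
          then show False using c_inj[of x] A(1) by blast
        qed
        then have "card (A \<union> B) = 6" using A(2,3) B card_Un_disjoint[of A B] by simp
        moreover have "A \<union> B \<subseteq> ?S"
        proof -
          have "?M \<subseteq> ?S" using C by blast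
          then have "A \<subseteq> ?S" using A(1) by blast
          moreover from this have "B \<subseteq> ?S" using c(1) cl by (auto simp: B_def)
          ultimately show ?thesis by blast
        qed
        ultimately have "6 \<le> card ?S" using card_mono[OF fsg_finite[OF S(1)]] by metis
        then show False using S(2) by simp
      qed
      define d where "d = ?m c g"
      have d: "d \<in> ?S" "d \<notin> ?M" using c gS cl c_inj[OF g(1)] by (auto simp: d_def)
      have "c \<noteq> d" using c_canc[OF eM g(1)] c(2) g(2) by (auto simp: d_def)
      then have dist: "distinct [e, g, c, d]" using g d c_notin eM by auto
      have tab: "?m g c = g" "?m e d = g" "?m g d = e" "?m c c = c" "?m c d = d" "?m d e = d" "?m d g = c"
        "?m d c = d" "?m d d = c"
      proof -
        show gc: "?m g c = g" using gS c e assoc[of g e c] by simp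
        show ed: "?m e d = g" using gS c e assoc[of e c g] by (simp add: d_def)
        show gd: "?m g d = e" using gS c gc gg assoc[of g c g] by (simp add: d_def)
        show cc: "?m c c = c" using c e assoc[of c e c] by simp
        show "?m c d = d" using c gS cc assoc[of c c g] by (simp add: d_def)
        show "?m d e = d" using c gS e assoc[of c g e] by (simp add: d_def)
        show dg: "?m d g = c" using c gS gg assoc[of c g g] by (simp add: d_def)
        show "?m d c = d" using c gS gc assoc[of c g c] by (simp add: d_def)
        show "?m d d = c" using c gS d dg gd assoc[of c g d] by (simp add: d_def)
      qed
      have "set [e, g, c, d] \<subseteq> ?S" using e gS c d by auto
      moreover have "?m ([e, g, c, d] ! num x) ([e, g, c, d] ! num y) = [e, g, c, d] ! num (block x y)"
        if "x \<in> {E0, E1, E2, E3}" "y \<in> {E0, E1, E2, E3}" for x y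
        using that by (elim insertE emptyE; simp add: block_def mt_def tab e gS gg c flip: d_def)
      ultimately show ?thesis using dist unfolding trichotomy_def by blast
    qed
  qed
qed

lemma left_block_mode: "n = 4 \<or> n = 5 \<Longrightarrow> \<exists>m. m_fam m = Fam_any \<and> m_els m = take n all_els \<and>
    (\<forall>x\<in>set (m_els m). \<forall>y\<in>set (m_els m). mt (m_init m) x y \<noteq> EU \<longrightarrow>
      x \<in> {E0, E1, E2, E3} \<and> y \<in> {E0, E1, E2, E3} \<and> mt (m_init m) x y = block x y)"
  by (elim disjE; (intro exI[of _ Lft_Z4], simp add: all_els_def block_def mt_def; fail)?;
      intro exI[of _ Lft_Z5]; simp add: all_els_def block_def mt_def)

lemma right_block_mode: "n = 4 \<or> n = 5 \<Longrightarrow> \<exists>m. m_fam m = Fam_any \<and> m_els m = take n all_els \<and>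
    (\<forall>x\<in>set (m_els m). \<forall>y\<in>set (m_els m). mt (m_init m) x y \<noteq> EU \<longrightarrow>
      x \<in> {E0, E1, E2, E3} \<and> y \<in> {E0, E1, E2, E3} \<and> mt (m_init m) x y = block y x)"
  by (elim disjE; (intro exI[of _ Rgt_Z4], simp add: all_els_def block_def mt_def; fail)?;
      intro exI[of _ Rgt_Z5]; simp add: all_els_def block_def mt_def)

lemma block_low: "x \<in> {E0, E1, E2, E3} \<Longrightarrow> y \<in> {E0, E1, E2, E3} \<Longrightarrow> block x y \<in> {E0, E1, E2, E3}"
  by (auto simp: block_def mt_def)

text \<open>The elements \<open>xe\<close> are again left zeros, and they cannot all be equal to
  \<open>e\<close>, since \<open>e\<close> would then be a zero.\<close>

lemma two_zeros:
  assumes S: "is_fsemigroup S" and L: "L = {l \<in> sg_car S. \<forall>x\<in>sg_car S. sg_mult S l x = l}" "e \<in> L"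
    and nozero: "\<not> (\<exists>z\<in>sg_car S. \<forall>x\<in>sg_car S. sg_mult S z x = z \<and> sg_mult S x z = z)"
  shows "2 \<le> card L" "\<And>i x. i \<in> L \<Longrightarrow> x \<in> sg_car S \<Longrightarrow> sg_mult S x i \<in> L"
proof -
  show ideal: "sg_mult S x i \<in> L" if "i \<in> L" "x \<in> sg_car S" for i x
    using that L(1) fsg_closed[OF S] fsg_assoc[OF S] by auto
  obtain x where x: "x \<in> sg_car S" "sg_mult S x e \<noteq> e" using nozero L by blast
  then have "{e, sg_mult S x e} \<subseteq> L" "card {e, sg_mult S x e} = 2" using ideal L(2) by auto
  moreover have "finite L" using L(1) fsg_finite[OF S] by simp
  ultimately show "2 \<le> card L" by (metis card_mono)
qed

text \<open>With \<open>J = SeS\<close>, the congruence \<open>la\<close> compares left actions on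
  \<open>Se\<close>, \<open>ra\<close> compares right actions on \<open>eS\<close>, and
  \<open>io\<close> collapses \<open>J\<close>. Since they meet in equality, \<open>S\<close>
  decomposes if \<open>la\<close> and \<open>ra\<close> are both nontrivial; otherwise
  \<open>faithful_cases\<close> applies to \<open>S\<close> or to its dual.\<close>

lemma good_no_zero:
  fixes S :: "elt sg"
  assumes S: "is_fsemigroup S" and n: "card (sg_car S) = n" "2 \<le> n" "n \<le> 5" and IH: "IH n"
    and nozero: "\<not> (\<exists>z\<in>sg_car S. \<forall>x\<in>sg_car S. sg_mult S z x = z \<and> sg_mult S x z = z)"
  shows "good S"
proof -
  let ?m = "sg_mult S" and ?S = "sg_car S"
  note cl = fsg_closed[OF S] and assoc = fsg_assoc[OF S]
  obtain e where e: "e \<in> ?S" "?m e e = e"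
    and inv: "\<And>x. x \<in> corner S e \<Longrightarrow> \<exists>y\<in>corner S e. ?m x y = e \<and> ?m y x = e"
    using group_corner[OF S] by blast
  note C = corner_iff[OF S e]
  have corner: "?m (?m e s) e \<in> corner S e" if "s \<in> ?S" for s using that by (auto simp: corner_def)
  have group: "good S" if "\<forall>x\<in>?S. ?m e x = x \<and> ?m x e = x"
  proof (rule good_group[OF S n IH e(1)])
    have "corner S e = ?S" using that C by blast
    then show "\<exists>y\<in>?S. ?m x y = e \<and> ?m y x = e" if "x \<in> ?S" for x using inv that by simp
  qed (use that in auto)
  define J where "J = {?m (?m a e) b | a b. a \<in> ?S \<and> b \<in> ?S}"
  define la where "la = {(x, y). x \<in> ?S \<and> y \<in> ?S \<and> (\<forall>s\<in>?S. ?m (?m x s) e = ?m (?m y s) e)}"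
  define ra where "ra = {(x, y). x \<in> ?S \<and> y \<in> ?S \<and> (\<forall>s\<in>?S. ?m e (?m s x) = ?m e (?m s y))}"
  define io where "io = {(x, y). x \<in> ?S \<and> y \<in> ?S \<and> (x = y \<or> x \<in> J \<and> y \<in> J)}"
  have J_ideal: "?m x j \<in> J \<and> ?m j x \<in> J" if x: "x \<in> ?S" and "j \<in> J" for x j
  proof -
    obtain a b where ab: "a \<in> ?S" "b \<in> ?S" "j = ?m (?m a e) b" using \<open>j \<in> J\<close> by (auto simp: J_def)
    have "?m x j = ?m (?m (?m x a) e) b" "?m j x = ?m (?m a e) (?m b x)" using ab x e(1) cl assoc by auto
    then show ?thesis using ab x cl unfolding J_def by blast
  qed
  have eJ: "e \<in> J" using e unfolding J_def by (auto intro!: exI[of _ e])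
  have J_sub: "J \<subseteq> ?S" using e(1) cl by (auto simp: J_def)
  have sep: "x = y" if "(x, y) \<in> la" "(x, y) \<in> ra" "(x, y) \<in> io" for x y
  proof (cases "x = y")
    case False
    then have "x \<in> J" "y \<in> J" using that(3) by (auto simp: io_def)
    then obtain a b c d where ab: "a \<in> ?S" "b \<in> ?S" "x = ?m (?m a e) b"
      and cd: "c \<in> ?S" "d \<in> ?S" "y = ?m (?m c e) d" by (auto simp: J_def)
    have xS: "x \<in> ?S" "y \<in> ?S" using J_sub \<open>x \<in> J\<close> \<open>y \<in> J\<close> by auto
    have L: "?m (?m x s) e = ?m (?m y s) e" and R: "?m e (?m s x) = ?m e (?m s y)" if "s \<in> ?S" for s
      using \<open>(x, y) \<in> la\<close> \<open>(x, y) \<in> ra\<close> that by (auto simp: la_def ra_def)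
    obtain g where g: "g \<in> corner S e" "?m (?m (?m e (?m b a)) e) g = e"
      using inv[OF corner[OF cl[OF ab(2,1)]]] by blast
    obtain h where h: "h \<in> corner S e" "?m h (?m (?m e (?m d c)) e) = e"
      using inv[OF corner[OF cl[OF cd(2,1)]]] by blast
    have gS: "g \<in> ?S" "?m e g = g" "?m g e = g" and hS: "h \<in> ?S" "?m e h = h" "?m h e = h"
      using g(1) h(1) C by auto
    have ge: "?m g (?m e w) = ?m g w" "?m e (?m g w) = ?m g w" "?m h (?m e w) = ?m h w" if "w \<in> ?S" for w
      using that gS hS e(1) assoc[of g e w] assoc[of e g w] assoc[of h e w] by simp_all
    \<comment> \<open>\<open>v\<close> is a right identity for \<open>x = aeb\<close>, built with
      the inverse \<open>g\<close> of \<open>ebae\<close> in the group \<open>eSe\<close>; dually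
      \<open>u\<close> is a left identity for \<open>y = ced\<close>.\<close>
    define v where "v = ?m (?m (?m a g) e) b"
    define u where "u = ?m (?m c h) d"
    have uv: "u \<in> ?S" "v \<in> ?S" using ab cd gS hS e(1) cl by (auto simp: u_def v_def)
    have xv: "?m x v = x"
    proof -
      have "?m x v = ?m (?m a (?m (?m (?m e (?m b a)) e) g)) b"
        using ab gS(1) e(1) cl assoc ge by (simp add: v_def)
      then show ?thesis using g(2) ab assoc[OF ab(1) e(1) ab(2)] by simp
    qed
    \<comment> \<open>\<open>v\<close> passes through \<open>e\<close>, so \<open>la\<close> permits
      replacing \<open>x\<close> by \<open>y\<close> on its left.\<close>
    have yv: "?m y v = x"
    proof -
      have "?m y v = ?m (?m (?m y (?m a g)) e) b" using ab(1,2) gS(1) e(1) xS(2) cl assoc by (simp add: v_def)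
      also have "\<dots> = ?m (?m (?m x (?m a g)) e) b" using L[OF cl[OF ab(1) gS(1)]] by simp
      also have "\<dots> = ?m x v" using ab(1,2) gS(1) e(1) xS(1) cl assoc by (simp add: v_def)
      finally show ?thesis using xv by simp
    qed
    have uy: "?m u y = y"
    proof -
      have "?m u y = ?m (?m c (?m h (?m (?m e (?m d c)) e))) d"
        using cd hS(1) e(1) cl assoc ge by (simp add: u_def)
      then show ?thesis using h(2) cd assoc[OF cd(1) e(1) cd(2)] by simp
    qed
    have ux: "?m u x = y"
    proof -
      have hx: "?m u w = ?m (?m c h) (?m e (?m d w))" if "w \<in> ?S" for w
        using cd(1,2) hS(1) e(1) cl assoc ge that by (simp add: u_def)
      have "?m u x = ?m u y" using hx xS R[OF cd(2)] by simp
      then show ?thesis using uy by simp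
    qed
    \<comment> \<open>The crossed products \<open>ux = y\<close> and \<open>yv = x\<close> meet by
      associativity: \<open>y = u(xv) = (ux)v = yv = x\<close>.\<close>
    have "y = ?m u x" using ux by simp
    also have "\<dots> = ?m u (?m x v)" using xv by simp
    also have "\<dots> = ?m (?m u x) v" using uv xS assoc by simp
    also have "\<dots> = x" using ux yv by simp
    finally show ?thesis by simp
  qed
  \<comment> \<open>If \<open>J\<close> had only one element, that element would be a zero.\<close>
  have io_nontriv: "\<exists>(x, y)\<in>io. x \<noteq> y"
  proof (rule ccontr)
    assume "\<not> (\<exists>(x, y)\<in>io. x \<noteq> y)"
    then have "j = e" if "j \<in> J" for j using that eJ J_sub by (auto simp: io_def)
    then have "?m e x = e \<and> ?m x e = e" if "x \<in> ?S" for x using J_ideal[OF that eJ] by blast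
    then show False using nozero e(1) by blast
  qed
  consider (left) "\<forall>(x, y)\<in>la. x = y" | (right) "\<forall>(x, y)\<in>ra. x = y"
    | (none) "\<exists>(x, y)\<in>la. x \<noteq> y" "\<exists>(x, y)\<in>ra. x \<noteq> y" by blast
  then show ?thesis
  proof cases
    case none
    show ?thesis
    proof (rule good_congruences[OF S, of "[la, ra, io]"])
      fix r assume "r \<in> set [la, ra, io]"
      then consider "r = la" | "r = ra" | "r = io" by auto
      note r = this
      show "equiv ?S r"
        using r by cases (auto simp: la_def ra_def io_def equiv_def refl_on_def sym_def trans_def)
      show "\<exists>(x, y)\<in>r. x \<noteq> y" using r none io_nontriv by cases auto
      fix x y w assume xy: "(x, y) \<in> r" and w: "w \<in> ?S"
      show "(?m x w, ?m y w) \<in> r \<and> (?m w x, ?m w y) \<in> r"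
        using r
      proof cases
        case 1
        have xyS: "x \<in> ?S" "y \<in> ?S" and F: "\<And>s. s \<in> ?S \<Longrightarrow> ?m (?m x s) e = ?m (?m y s) e"
          using xy 1 by (auto simp: la_def)
        have "?m (?m (?m x w) s) e = ?m (?m (?m y w) s) e" "?m (?m (?m w x) s) e = ?m (?m (?m w y) s) e" if s: "s \<in> ?S" for s
        proof -
          show "?m (?m (?m x w) s) e = ?m (?m (?m y w) s) e"
            using F[OF cl[OF w s]] assoc[OF xyS(1) w s] assoc[OF xyS(2) w s] by simp
          have "?m w (?m (?m x s) e) = ?m w (?m (?m y s) e)" using F[OF s] by simp
          then show "?m (?m (?m w x) s) e = ?m (?m (?m w y) s) e"
            using xyS w s e(1) cl assoc by simp
        qed
        then show ?thesis using xyS w cl 1 unfolding la_def by blast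
      next
        case 2
        have xyS: "x \<in> ?S" "y \<in> ?S" and F: "\<And>s. s \<in> ?S \<Longrightarrow> ?m e (?m s x) = ?m e (?m s y)"
          using xy 2 by (auto simp: ra_def)
        have "?m e (?m s (?m x w)) = ?m e (?m s (?m y w))" "?m e (?m s (?m w x)) = ?m e (?m s (?m w y))" if s: "s \<in> ?S" for s
        proof -
          show "?m e (?m s (?m w x)) = ?m e (?m s (?m w y))"
            using F[OF cl[OF s w]] assoc[OF s w xyS(1)] assoc[OF s w xyS(2)] by simp
          have "?m (?m e (?m s x)) w = ?m (?m e (?m s y)) w" using F[OF s] by simp
          then show "?m e (?m s (?m x w)) = ?m e (?m s (?m y w))"
            using xyS w s e(1) cl assoc by simp
        qed
        then show ?thesis using xyS w cl 2 unfolding ra_def by blast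
      next
        case 3
        then show ?thesis using xy w cl J_ideal by (auto simp: io_def)
      qed
    next
      fix x y assume "x \<in> ?S" "y \<in> ?S" "\<And>r. r \<in> set [la, ra, io] \<Longrightarrow> (x, y) \<in> r"
      then show "x = y" using sep by simp
    qed (use n IHD[OF IH] in auto)
  next
    case left
    have faith: "x = y" if "x \<in> ?S" "y \<in> ?S" "\<And>s. s \<in> ?S \<Longrightarrow> ?m (?m x s) e = ?m (?m y s) e" for x y
      using left that by (auto simp: la_def)
    have "card ?S \<le> 5" using n by simp
    have "trichotomy S e"
    proof (rule faithful_cases[OF S \<open>card ?S \<le> 5\<close> e])
      show "x = y" if "x \<in> ?S" "y \<in> ?S" "\<And>s. s \<in> ?S \<Longrightarrow> ?m (?m x s) e = ?m (?m y s) e" for x y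
        using faith that by blast
    qed (rule inv)
    then show ?thesis
      unfolding trichotomy_def
    proof (elim disjE exE conjE)
      assume ee: "\<forall>x\<in>?S. ?m e x = e"
      define L where "L = {l \<in> ?S. \<forall>x\<in>?S. ?m l x = l}"
      have eL: "e \<in> L" using ee e by (simp add: L_def)
      note two = two_zeros[OF S L_def eL nozero]
      show ?thesis
      proof (rule good_left_zeros[OF S n IH _ two(1)])
        fix x y assume xy: "x \<in> ?S" "y \<in> ?S" and eq: "\<And>i. i \<in> L \<Longrightarrow> ?m x i = ?m y i"
        \<comment> \<open>Every \<open>se\<close> belongs to \<open>L\<close>, so agreement on
          \<open>L\<close> includes agreement on \<open>Se\<close>.\<close>
        show "x = y"
        proof (rule faith[OF xy])
          fix s assume s: "s \<in> ?S"
          show "?m (?m x s) e = ?m (?m y s) e"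
            using eq[OF two(2)[OF eL s]] xy s e(1) assoc by simp
        qed
      qed (use two(2) in \<open>auto simp: L_def\<close>)
    next
      assume "\<forall>x\<in>?S. ?m e x = x \<and> ?m x e = x"
      then show ?thesis by (rule group)
    next
      fix g c d
      assume b: "set [e, g, c, d] \<subseteq> ?S" "distinct [e, g, c, d]"
        "\<forall>x\<in>{E0, E1, E2, E3}. \<forall>y\<in>{E0, E1, E2, E3}.
          ?m ([e, g, c, d] ! num x) ([e, g, c, d] ! num y) = [e, g, c, d] ! num (block x y)"
      show ?thesis
        by (rule good_block[OF S n(1,3) IH b(1,2) _ left_block_mode]) (use b(3) block_low in blast)
    qed
  next
    case right
    have fop: "is_fsemigroup (sg_op S)" "e \<in> sg_car (sg_op S)" "sg_mult (sg_op S) e e = e" using fsg_op[OF S] e by auto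
    have faith: "x = y" if "x \<in> ?S" "y \<in> ?S" "\<And>s. s \<in> ?S \<Longrightarrow> ?m e (?m s x) = ?m e (?m s y)" for x y
      using right that by (auto simp: ra_def)
    have inv': "\<exists>y\<in>corner (sg_op S) e. sg_mult (sg_op S) x y = e \<and> sg_mult (sg_op S) y x = e"
      if "x \<in> corner (sg_op S) e" for x
      using inv[of x] that corner_op[OF S e(1)] by auto
    have "card (sg_car (sg_op S)) \<le> 5" using n by simp
    have "trichotomy (sg_op S) e"
    proof (rule faithful_cases[OF fop(1) \<open>card (sg_car (sg_op S)) \<le> 5\<close> fop(2,3) inv'])
      fix x y assume "x \<in> sg_car (sg_op S)" "y \<in> sg_car (sg_op S)"
        "\<And>s. s \<in> sg_car (sg_op S) \<Longrightarrow> sg_mult (sg_op S)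
          (sg_mult (sg_op S) x s) e = sg_mult (sg_op S) (sg_mult (sg_op S) y s) e"
      then show "x = y" using faith by simp
    qed
    then have "(\<forall>x\<in>?S. ?m x e = e) \<or> (\<forall>x\<in>?S. ?m x e = x \<and> ?m e x = x) \<or>
      (\<exists>g c d. set [e, g, c, d] \<subseteq> ?S \<and> distinct [e, g, c, d] \<and>
        (\<forall>x\<in>{E0, E1, E2, E3}. \<forall>y\<in>{E0, E1, E2, E3}.
          ?m ([e, g, c, d] ! num y) ([e, g, c, d] ! num x) = [e, g, c, d] ! num (block x y)))"
      by (simp add: trichotomy_def)
    then show ?thesis
    proof (elim disjE exE conjE)
      assume ee: "\<forall>x\<in>?S. ?m x e = e"
      define L where "L = {l \<in> ?S. \<forall>x\<in>?S. ?m x l = l}"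
      have eL: "e \<in> L" using ee e by (simp add: L_def)
      have "L = {l \<in> sg_car (sg_op S). \<forall>x\<in>sg_car (sg_op S). sg_mult (sg_op S) l x = l}" by (simp add: L_def)
      note two = two_zeros[OF fop(1) this eL]
      have two1: "2 \<le> card L" using two(1) nozero by auto
      have two2: "?m i x \<in> L" if "i \<in> L" "x \<in> ?S" for i x using two(2)[of i x] nozero that by auto
      show ?thesis
      proof (rule good_right_zeros[OF S n IH _ two1])
        fix x y assume xy: "x \<in> ?S" "y \<in> ?S" and eq: "\<And>i. i \<in> L \<Longrightarrow> ?m i x = ?m i y"
        show "x = y"
        proof (rule faith[OF xy])
          fix s assume s: "s \<in> ?S"
          show "?m e (?m s x) = ?m e (?m s y)"
            using eq[OF two2[OF eL s]] xy s e(1) by (simp add: assoc)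
        qed
      qed (use two2 in \<open>auto simp: L_def\<close>)
    next
      assume "\<forall>x\<in>?S. ?m x e = x \<and> ?m e x = x"
      then show ?thesis using group by blast
    next
      fix g c d
      assume b: "set [e, g, c, d] \<subseteq> ?S" "distinct [e, g, c, d]"
        "\<forall>x\<in>{E0, E1, E2, E3}. \<forall>y\<in>{E0, E1, E2, E3}.
          ?m ([e, g, c, d] ! num y) ([e, g, c, d] ! num x) = [e, g, c, d] ! num (block x y)"
      show ?thesis
        by (rule good_block[OF S n(1,3) IH b(1,2) _ right_block_mode]) (use b(3) block_low in blast)
    qed
  qed
qed

lemma good_small:
  fixes S :: "elt sg"
  assumes "is_fsemigroup S" "2 \<le> card (sg_car S)" "card (sg_car S) \<le> 5"
  shows "good S"
  using assms
proof (induction "card (sg_car S)" arbitrary: S rule: less_induct)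
  case less
  note S = less.prems(1) and n = refl less.prems(2,3)
  have IH: "IH (card (sg_car S))"
    unfolding IH_def
  proof (intro allI impI)
    fix Q :: "elt sg"
    assume "is_fsemigroup Q" "2 \<le> card (sg_car Q)" "card (sg_car Q) < card (sg_car S)"
    then show "good Q" using less.hyps[of Q] less.prems(3) by simp
  qed
  show ?case
  proof (cases "\<exists>z\<in>sg_car S. \<forall>x\<in>sg_car S. sg_mult S z x = z \<and> sg_mult S x z = z")
    case True
    then obtain z where z: "z \<in> sg_car S" "\<And>x. x \<in> sg_car S \<Longrightarrow> sg_mult S z x = z \<and> sg_mult S x z = z" by blast
    show ?thesis
    proof (cases "\<exists>e\<in>sg_car S. sg_mult S e e = e \<and> e \<noteq> z")
      case True
      then show ?thesis using good_zero[OF S n IH z] by blast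
    next
      case False
      then show ?thesis using good_nil[OF S n IH z] by blast
    qed
  next
    case False
    then show ?thesis using good_no_zero[OF S n IH] by blast
  qed
qed

theorem theorem7p1:
  fixes S :: "'a sg"
  assumes "is_fsemigroup S"
    and "2 \<le> card (sg_car S)"
    and "card (sg_car S) \<le> 5"
    and "join_irreducible (gen_pv S)"
  shows "\<exists>T\<in>set the_list. gen_pv S = gen_pv T"
proof -
  obtain xs where xs: "set xs = sg_car S" "distinct xs"
    using list_of_set[OF fsg_finite[OF assms(1)]] by blast
  define n where "n = card (sg_car S)"
  have len: "length xs = n" using xs distinct_card by (metis n_def)
  have n: "2 \<le> n" "n \<le> 5" using assms(2,3) by (simp_all add: n_def)
  obtain f where f: "is_fsemigroup (set (take n all_els), f)" "good S \<longleftrightarrow> good (set (take n all_els), f)"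
      "\<And>x y. x \<in> set (take n all_els) \<Longrightarrow> y \<in> set (take n all_els) \<Longrightarrow>
        f x y \<in> set (take n all_els) \<and> xs ! num (f x y) = sg_mult S (xs ! num x) (xs ! num y)"
      "card (set (take n all_els)) = n"
    using labelling[OF assms(1) xs(2,1) len n(2)] by blast
  \<comment> \<open>The induction ran over \<open>elt\<close>; the labelling brings its result back
    to the type \<open>'a\<close>.\<close>
  have "good S" using good_small[OF f(1)] f(2,4) n by simp
  then show ?thesis using assms(4) by (simp add: good_def)
qed

end
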